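(* Let $\mathbb F=\mathbb F_q$ be the field of order $q=p^d$, $p$ a prime. Let $w$ be a primitive element of $\mathbb F$ and $a$ the automorphism $x\mapsto x^p$ of $\mathbb F$. A minimal nontrivial one-dimensional affine scheme on $\mathbb F$ is isomorphic to $\operatorname{Inv}(G)$, where $G=G_0\ltimes\mathbb F^+$ and $G_0$ is one of the following subgroups of $\operatorname{\Gamma L}_1(q)=\langle a,w\rangle$: (1) $M(r)=\langle a,w^r\rangle$, where $r$ is a prime divisor of $q-1$; (2) $P=\langle aw,w^4\rangle$, provided $p\equiv-1\pmod 4$ and $d$ is even. Moreover, two such schemes corresponding to distinct groups are nonisomorphic, unless $q=9$ and the groups are those with $G_0=M(2)$ and $G_0=P$, in which case the corresponding schemes are isomorphic.
   Context: $\mathbb F^+$ is the additive group of $\mathbb F$, acting on $\mathbb F$ by translations; $\operatorname{\Gamma L}_1(q)=\langle a\rangle\ltimes\mathbb F^*$ acts on $\mathbb F$, where an element of $\mathbb F^*$ (in particular $w$) acts by multiplication and $a$ acts as $x\mapsto x^p$ (permutations act on the right, so $aw$ is $x\mapsto x^pw$); $\operatorname{A\Gamma L}_1(q)=\operatorname{\Gamma L}_1(q)\ltimes\mathbb F^+$. A one-dimensional affine group is a subgroup $G\leqslant\operatorname{A\Gamma L}_1(q)$ containing $\mathbb F^+$, i.e. $G=G_0\ltimes\mathbb F^+$ with $G_0\leqslant\operatorname{\Gamma L}_1(q)$ the stabilizer of $0$. For a transitive permutation group $G$ on $\mathbb F$, $\operatorname{Inv}(G)$ is the association scheme on $\mathbb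 F$ whose basis relations are the orbits of $G$ on $\mathbb F\times\mathbb F$ under the componentwise action. An association scheme on $\mathbb F$ is one-dimensional affine if it equals $\operatorname{Inv}(G)$ for some one-dimensional affine group $G\leqslant\operatorname{A\Gamma L}_1(q)$. The trivial scheme is the scheme of rank $2$ (with exactly two basis relations). Schemes are partially ordered by $\mathcal X\leqslant\mathcal X'$ iff each basis relation of $\mathcal X$ is a union of basis relations of $\mathcal X'$; a minimal nontrivial one-dimensional affine scheme is a minimal element, in this order, of the set of nontrivial one-dimensional affine schemes on $\mathbb F$. Two schemes on $\mathbb F$ are isomorphic if there is a permutation of $\mathbb F$ mapping the basis relations of one to the basis relations of the other. *)

theory Defs
  imports
    "HOL-Library.Cardinality"
    "HOL-Library.Disjoint_Sets"
    "HOL-Computational_Algebra.Primes"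
    "HOL-Number_Theory.Cong"
    "HOL-Algebra.Group_Action"
    "HOL-Algebra.Generated_Groups"
begin

section \<open>Permutation groups on a finite field\<close>

text \<open>
  Permutation groups are subgroups of \<^term>\<open>BijGroup UNIV\<close>, whose product is
  \<open>g \<otimes> f = g \<circ> f\<close>. With permutations acting on the right, the product written \<open>fg\<close>
  (first \<open>f\<close>, then \<open>g\<close>) is therefore \<open>g \<circ> f\<close> here.
\<close>

abbreviation Sym :: "('a \<Rightarrow> 'a) monoid" where
  "Sym \<equiv> BijGroup UNIV"

definition primitive_element :: "'a::field \<Rightarrow> bool" where
  "primitive_element w \<longleftrightarrow> range (\<lambda>k::nat. w ^ k) = UNIV - {0}"

text \<open>
  For a field of order \<open>p\<^sup>d\<close> the characteristic is \<open>p\<close> (lemma \<open>CHAR_eq_prime\<close> below).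
\<close>

definition frob :: "'a::finite_field \<Rightarrow> 'a" where
  "frob x = x ^ CHAR('a)"

definition mul_by :: "'a::finite_field \<Rightarrow> 'a \<Rightarrow> 'a" where
  "mul_by u x = x * u"

definition mult_group :: "('a::finite_field \<Rightarrow> 'a) set" where
  "mult_group = {mul_by u | u. u \<noteq> 0}"

definition translation_group :: "('a::finite_field \<Rightarrow> 'a) set" where
  "translation_group = {(\<lambda>x. x + b) | b. True}"

text \<open>
  The groups \<open>\<langle>a\<rangle> \<ltimes> F\<^sup>*\<close> and \<open>G\<^sub>0 \<ltimes> F\<^sup>+\<close> are internal semidirect products, that is,
  products of subsets of \<^term>\<open>Sym\<close>; the factors are swapped because of the order of composition.
\<close>

definition GammaL1 :: "('a::finite_field \<Rightarrow> 'a) set" where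
  "GammaL1 = mult_group <#>\<^bsub>Sym\<^esub> generate Sym {frob}"

definition semidirect_translations :: "('a::finite_field \<Rightarrow> 'a) set \<Rightarrow> ('a \<Rightarrow> 'a) set" where
  "semidirect_translations G0 = translation_group <#>\<^bsub>Sym\<^esub> G0"

definition AGammaL1 :: "('a::finite_field \<Rightarrow> 'a) set" where
  "AGammaL1 = semidirect_translations GammaL1"

definition one_dim_affine_group :: "('a::finite_field \<Rightarrow> 'a) set \<Rightarrow> bool" where
  "one_dim_affine_group G \<longleftrightarrow> subgroup G Sym \<and> G \<subseteq> AGammaL1 \<and> translation_group \<subseteq> G"

text \<open>Acting on the right, \<open>aw\<close> is \<open>x \<mapsto> x\<^sup>p w\<close>, that is \<open>mul_by w \<circ> frob\<close>.\<close>

definition M_group :: "'a::finite_field \<Rightarrow> nat \<Rightarrow> ('a \<Rightarrow> 'a) set" where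
  "M_group w r = generate Sym {frob, mul_by (w ^ r)}"

definition P_group :: "'a::finite_field \<Rightarrow> ('a \<Rightarrow> 'a) set" where
  "P_group w = generate Sym {mul_by w \<circ> frob, mul_by (w ^ 4)}"

definition candidate_stabilizers :: "'a::finite_field \<Rightarrow> nat \<Rightarrow> nat \<Rightarrow> ('a \<Rightarrow> 'a) set set" where
  "candidate_stabilizers w p d =
     {M_group w r | r. prime r \<and> r dvd CARD('a) - 1} \<union>
     (if [int p = -1] (mod 4) \<and> even d then {P_group w} else {})"


section \<open>Association schemes\<close>

text \<open>
  A scheme on the finite set \<^term>\<open>UNIV :: 'a set\<close> is given by its set of basis relations.
  Schemes need be neither symmetric nor commutative.
\<close>

definition association_scheme :: "('a::finite \<times> 'a) set set \<Rightarrow> bool" where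
  "association_scheme X \<longleftrightarrow>
     partition_on UNIV X \<and> Id \<in> X \<and> (\<forall>R\<in>X. R\<inverse> \<in> X) \<and>
     (\<forall>R\<in>X. \<forall>S\<in>X. \<forall>T\<in>X. \<exists>c. \<forall>(x, y)\<in>T. card {z. (x, z) \<in> R \<and> (z, y) \<in> S} = c)"

definition Inv :: "('a \<Rightarrow> 'a) set \<Rightarrow> ('a \<times> 'a) set set" where
  "Inv G = orbits (Sym\<lparr>carrier := G\<rparr>) UNIV (\<lambda>g. map_prod g g)"

definition one_dim_affine_scheme :: "('a::finite_field \<times> 'a) set set \<Rightarrow> bool" where
  "one_dim_affine_scheme X \<longleftrightarrow>
     association_scheme X \<and> (\<exists>G. one_dim_affine_group G \<and> X = Inv G)"

definition trivial_scheme :: "('a \<times> 'a) set set \<Rightarrow> bool" where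
  "trivial_scheme X \<longleftrightarrow> card X = 2"

definition scheme_le :: "('a \<times> 'a) set set \<Rightarrow> ('a \<times> 'a) set set \<Rightarrow> bool" where
  "scheme_le X Y \<longleftrightarrow> (\<forall>R\<in>X. \<exists>\<S>\<subseteq>Y. R = \<Union>\<S>)"

definition minimal_nontrivial_scheme :: "('a::finite_field \<times> 'a) set set \<Rightarrow> bool" where
  "minimal_nontrivial_scheme X \<longleftrightarrow>
     one_dim_affine_scheme X \<and> \<not> trivial_scheme X \<and>
     (\<forall>Y. one_dim_affine_scheme Y \<and> \<not> trivial_scheme Y \<and> scheme_le Y X \<longrightarrow> Y = X)"

definition scheme_iso :: "('a \<times> 'a) set set \<Rightarrow> ('a \<times> 'a) set set \<Rightarrow> bool" where
  "scheme_iso X Y \<longleftrightarrow> (\<exists>f. bij f \<and> (\<lambda>R. map_prod f f ` R) ` X = Y)"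


section \<open>Basic facts\<close>

lemma CHAR_eq_prime:
  assumes "prime p" "CARD('a::finite_field) = p ^ d"
  shows "CHAR('a) = p"
proof -
  have "of_nat CARD('a) = (0 :: 'a)"
  proof -
    have "bij_betw (\<lambda>x::'a. x + 1) UNIV UNIV"
      by (rule bij_betwI[where g = "\<lambda>x. x - 1"]) auto
    then have "(\<Sum>x\<in>UNIV. x + 1) = (\<Sum>x\<in>(UNIV::'a set). x)"
      by (rule sum.reindex_bij_betw)
    then show ?thesis
      by (simp add: sum.distrib)
  qed
  then have "CHAR('a) dvd p ^ d"
    using assms(2) by (metis of_nat_eq_0_iff_char_dvd)
  then show ?thesis
    using assms(1) CHAR_prime[where 'a = 'a] prime_dvd_power primes_dvd_imp_eq by blast
qed

lemma subgroup_SymD: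
  fixes G :: "('a \<Rightarrow> 'a) set"
  assumes "subgroup G Sym"
  shows "id \<in> G" "\<And>f. f \<in> G \<Longrightarrow> bij f"
    "\<And>f g. f \<in> G \<Longrightarrow> g \<in> G \<Longrightarrow> f \<circ> g \<in> G"
    "\<And>f. f \<in> G \<Longrightarrow> \<exists>g\<in>G. g \<circ> f = id \<and> f \<circ> g = id"
proof -
  interpret S: group "Sym :: ('a \<Rightarrow> 'a) monoid" by (rule group_BijGroup)
  have one: "\<one>\<^bsub>Sym\<^esub> = (id :: 'a \<Rightarrow> 'a)" by (auto simp: BijGroup_def)
  have car: "f \<in> carrier Sym \<longleftrightarrow> bij f" for f :: "'a \<Rightarrow> 'a"
    by (auto simp: BijGroup_def Bij_def)
  have mul: "f \<otimes>\<^bsub>Sym\<^esub> g = f \<circ> g" if "bij f" "bij g" for f g :: "'a \<Rightarrow> 'a"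
    using that by (auto simp: BijGroup_def Bij_def compose_def)
  show "id \<in> G" using subgroup.one_closed[OF assms] one by simp
  show b: "bij f" if "f \<in> G" for f using subgroup.mem_carrier[OF assms that] car by simp
  show "f \<circ> g \<in> G" if "f \<in> G" "g \<in> G" for f g
    using subgroup.m_closed[OF assms that] mul b that by simp
  show "\<exists>g\<in>G. g \<circ> f = id \<and> f \<circ> g = id" if f: "f \<in> G" for f
  proof (intro bexI conjI)
    let ?g = "inv\<^bsub>Sym\<^esub> f"
    show g: "?g \<in> G" using subgroup.m_inv_closed[OF assms f] .
    have "f \<in> carrier Sym" using subgroup.mem_carrier[OF assms f] .
    then show "?g \<circ> f = id" "f \<circ> ?g = id"
      using mul[OF b[OF g] b[OF f]] mul[OF b[OF f] b[OF g]] one S.l_inv S.r_inv by metis+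
  qed
qed

lemma Inv_eq: "Inv G = {{(g x, g y) | g. g \<in> G} | x y. True}"
  by (auto simp: Inv_def orbits_def orbit_def)

lemma association_scheme_Inv:
  fixes G :: "('a::finite \<Rightarrow> 'a) set"
  assumes G: "subgroup G Sym" and trans: "\<And>x y. \<exists>g\<in>G. g x = y"
  shows "association_scheme (Inv G)"
proof -
  note D = subgroup_SymD[OF G]
  define Orb where "Orb x y = {(g x, g y) | g. g \<in> G}" for x y :: 'a
  have Inv: "Inv G = {Orb x y | x y. True}"
    unfolding Inv_eq Orb_def ..
  have self: "(x, y) \<in> Orb x y" for x y
    unfolding Orb_def using D(1) by (auto intro!: exI[of _ id])
  have sub: "Orb u v \<subseteq> Orb x y" if "(u, v) \<in> Orb x y" for u v x y
    using that D(3) unfolding Orb_def by (fastforce simp: o_def)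
  have sym: "(x, y) \<in> Orb u v" if "(u, v) \<in> Orb x y" for u v x y
  proof -
    from that obtain g where g: "g \<in> G" "u = g x" "v = g y" by (auto simp: Orb_def)
    obtain h where "h \<in> G" "h \<circ> g = id" using D(4)[OF g(1)] by blast
    then have "h u = x" "h v = y" using g by (auto simp: fun_eq_iff)
    then show ?thesis unfolding Orb_def using \<open>h \<in> G\<close> by force
  qed
  have eq: "Orb u v = Orb x y" if "(u, v) \<in> Orb x y" for u v x y
    using sub[OF that] sub[OF sym[OF that]] by blast
  have inv: "(g u, g v) \<in> R \<longleftrightarrow> (u, v) \<in> R" if "R \<in> Inv G" "g \<in> G" for R g u v
  proof -
    have "(g u, g v) \<in> Orb u v" using that(2) by (auto simp: Orb_def)
    then have "Orb (g u) (g v) = Orb u v" by (rule eq)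
    then show ?thesis using that(1) self eq unfolding Inv by blast
  qed
  have "partition_on UNIV (Inv G)"
  proof (rule partition_onI)
    show "\<Union> (Inv G) = UNIV" unfolding Inv using self by auto
    show "disjnt R S" if "R \<in> Inv G" "S \<in> Inv G" "R \<noteq> S" for R S
    proof -
      have "R = Orb u v" "S = Orb u v" if "(u, v) \<in> R" "(u, v) \<in> S" for u v
        using that \<open>R \<in> Inv G\<close> \<open>S \<in> Inv G\<close> eq unfolding Inv by blast+
      then show ?thesis using \<open>R \<noteq> S\<close> unfolding disjnt_def by fast
    qed
    show "{} \<notin> Inv G" using self unfolding Inv by blast
  qed
  moreover have "Id \<in> Inv G"
  proof -
    have "Id = Orb x x" for x
    proof -
      have "(y, y) \<in> Orb x x" for y
        using trans[of x y] unfolding Orb_def by auto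
      then show ?thesis unfolding Orb_def by auto
    qed
    then show ?thesis unfolding Inv by blast
  qed
  moreover have "R\<inverse> \<in> Inv G" if "R \<in> Inv G" for R
  proof -
    have "(Orb x y)\<inverse> = Orb y x" for x y by (auto simp: Orb_def)
    then show ?thesis using that unfolding Inv by blast
  qed
  moreover have "\<exists>c. \<forall>(x, y)\<in>T. card {z. (x, z) \<in> R \<and> (z, y) \<in> S} = c"
    if RST: "R \<in> Inv G" "S \<in> Inv G" "T \<in> Inv G" for R S T
  proof -
    obtain x y where T: "T = Orb x y" using RST(3) unfolding Inv by blast
    have "card {z. (g x, z) \<in> R \<and> (z, g y) \<in> S} = card {z. (x, z) \<in> R \<and> (z, y) \<in> S}"
      if g: "g \<in> G" for g
    proof -
      have "{z. (g x, z) \<in> R \<and> (z, g y) \<in> S} = g ` {z. (x, z) \<in> R \<and> (z, y) \<in> S}"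
      proof (rule Set.set_eqI)
        fix z
        obtain z' where z: "z = g z'" using bij_is_surj[OF D(2)[OF g]] by (rule surjE)
        have "inj g" using D(2)[OF g] by (rule bij_is_inj)
        then show "z \<in> {z. (g x, z) \<in> R \<and> (z, g y) \<in> S} \<longleftrightarrow>
            z \<in> g ` {z. (x, z) \<in> R \<and> (z, y) \<in> S}"
          using inv[OF RST(1) g] inv[OF RST(2) g] unfolding z by (simp add: inj_image_mem_iff)
      qed
      moreover have "inj_on g {z. (x, z) \<in> R \<and> (z, y) \<in> S}"
        using bij_is_inj[OF D(2)[OF g]] by (rule inj_on_subset) simp
      ultimately show ?thesis by (simp add: card_image)
    qed
    then show ?thesis unfolding T Orb_def by auto
  qed
  ultimately show ?thesis unfolding association_scheme_def by blast
qed

lemma association_scheme_Inv_affine: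
  assumes "one_dim_affine_group G"
  shows "association_scheme (Inv G)"
proof (rule association_scheme_Inv)
  show "subgroup G Sym" using assms by (simp add: one_dim_affine_group_def)
  show "\<exists>g\<in>G. g x = y" for x y
  proof
    show "(\<lambda>z. z + (y - x)) \<in> G"
      using assms by (auto simp: one_dim_affine_group_def translation_group_def)
  qed simp
qed

end

(*
  Isomorphism to a candidate.  The stabilizer of 0 in a group with a nontrivial scheme is
  intransitive on the nonzero elements.  It is generated by some w^n and some x -> w^e x^(p^s), and
  the latter acts on exponents modulo n as the affine map k -> p^s k + e.  By the Hull-Dobell
  criterion this map is an n-cycle unless it fixes a class modulo a prime divisor r of n or n is
  divisible by 4 and p^s = 3 modulo 4.  After conjugation by a multiplication, the stabilizer lies
  in M(r) in the first case and in P in the second, and minimality gives equality of the schemes.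

  Nonisomorphism.  The least nontrivial valency of Inv(M(r)) is (q-1)/r, and that of Inv(P) is
  (q-1)/2, so only M(2) and P remain.  An isomorphism g from the Paley to the Peisert scheme
  satisfies, with e = (q-1)/4 and suitable constants,
    alpha (g(x) - g(y))^e + beta (g(x) - g(y))^(3e) = epsilon (x - y)^(2e).
  Comparing coefficients of powers of z = g(y), Lucas' theorem shows that, for many exponents j, the
  reduced polynomial of g^j contains only powers of x whose base p digits are at most (p-1)/2.
  Applied to j = 1, 2, ..., this bounds the digits of deg g: for d > 2 no degree is left, and for
  d = 2 the map g is additive up to a constant, g(x) = ax + bx^p, which is excluded by a comparison of
  polynomials in x^(p-1) unless p = 3.
*)

theory Submission
  imports Defs "HOL-Computational_Algebra.Polynomial"
begin

section \<open>Finite fields with a primitive element\<close>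

text \<open>The identity in g comes from quartic residues: x^e runs through the powers of the fourth
  root of unity i = w^e, and a suitable combination of x^e and x^(3e) is the +-1 indicator of the
  two nondiagonal Peisert relations, as (x - y)^(2e) is for the Paley relations. The direction from
  Paley to Peisert matters. The side in x is a single binomial power, so only exponents k with
  binom(2e, k) nonzero modulo p can occur. The side in g has two terms, which are separated by a
  power z^l with binom(e, l) nonzero and binom(3e, l) zero modulo p; such l exist because the digits
  3h + 2 and h stand in opposite places in e and 3e. For q = 9, that is d = 2 and h = 0, the
  argument has to break down, since the schemes are isomorphic. For d = 2 it therefore uses h > 0 in
  two places: to obtain one more power of g that excludes x^(p+1), and to see that a certain
  polynomial in x^(p-1) vanishes at a nonzero point.\<close>

lemma coeff_one_plus_X_power: "coeff ([:1, 1:] ^ n) i = (of_nat (n choose i) :: 'a::comm_semiring_1)"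
proof (cases "i \<le> n")
  case False
  have "degree ([:1, 1:] ^ n :: 'a poly) \<le> n"
    using degree_power_le[of "[:1, 1:] :: 'a poly" n] by simp
  with False show ?thesis by (simp add: coeff_eq_0 binomial_eq_0)
qed (simp add: coeff_linear_poly_power)

text \<open>By the Frobenius identity, (1 + X)^(r a + b) = (1 + X^r)^a (1 + X)^b. The first factor
  has only exponents divisible by r and the second has degree b < r, so X^(r c + k) with k < r
  arises from a single product.\<close>

lemma of_nat_choose_Lucas:
  fixes a b c k :: nat
  defines "r \<equiv> CHAR('a::finite_field)"
  assumes b: "b < r" and k: "k < r"
  shows "of_nat ((r * a + b) choose (r * c + k)) = (of_nat (a choose c) * of_nat (b choose k) :: 'a)"
proof -
  have pr: "prime r" unfolding r_def by (rule CHAR_prime)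
  define B :: "'a poly" where "B = [:1, 1:] ^ b"
  define Q :: "'a poly" where "Q = (monom 1 r + 1) ^ a"
  have lin: "[:1, 1:] = (monom 1 1 + 1 :: 'a poly)"
    by (simp add: monom_altdef one_pCons)
  have "[:1, 1:] ^ r = (monom 1 r + 1 :: 'a poly)"
    using freshmans_dream[where 'a = "'a poly" and y = 1 and x = "monom 1 1" and n = r] pr r_def
    by (simp add: lin monom_power)
  then have split: "[:1, 1:] ^ (r * a + b) = Q * B"
    by (simp add: Q_def B_def power_add power_mult)
  have r_pos: "r > 0" using pr by (rule prime_gt_0_nat)
  have "Q = (\<Sum>i\<le>a. monom (of_nat (a choose i)) (r * i))"
    unfolding Q_def binomial_ring
    by (simp add: monom_power of_nat_poly smult_monom)
  then have "coeff Q n = (\<Sum>i\<le>a. if r * i = n then of_nat (a choose i) else 0)" for n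
    by (simp add: coeff_sum)
  then have Q: "coeff Q (r * j) = of_nat (a choose j)" "\<not> r dvd n \<Longrightarrow> coeff Q n = 0" for j n
    using r_pos by (auto simp: sum.delta binomial_eq_0 intro!: sum.neutral)
  have "coeff (Q * B) (r * c + k) = (\<Sum>i\<le>r * c + k. coeff Q i * coeff B (r * c + k - i))"
    by (rule coeff_mult)
  also have "\<dots> = (\<Sum>i\<in>{r * c}. coeff Q i * coeff B (r * c + k - i))"
  proof (rule sum.mono_neutral_right)
    show "\<forall>i\<in>{..r * c + k} - {r * c}. coeff Q i * coeff B (r * c + k - i) = 0"
    proof
      fix i assume i: "i \<in> {..r * c + k} - {r * c}"
      show "coeff Q i * coeff B (r * c + k - i) = 0"
      proof (cases "r dvd i")
        case True
        then obtain j where j: "i = r * j" by auto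
        \<comment> \<open>An index j > c is ruled out by i <= r c + k and k < r; for j < c the
          remaining exponent is at least r, beyond the degree b of \<open>B\<close>.\<close>
        have "j < c"
        proof (rule ccontr)
          assume "\<not> j < c"
          moreover have "j \<noteq> c" using i j by auto
          ultimately have "r * (c + 1) \<le> r * j" by (intro mult_left_mono) auto
          then show False using i j k by auto
        qed
        then have "r * (j + 1) \<le> r * c" by (intro mult_left_mono) auto
        then have "b < r * c + k - i" using b j by (simp add: algebra_simps)
        then show ?thesis by (simp add: B_def coeff_one_plus_X_power binomial_eq_0)
      next
        case False
        then show ?thesis by (simp add: Q)
      qed
    qed
  qed auto
  also have "\<dots> = of_nat (a choose c) * of_nat (b choose k)"
    by (simp add: Q B_def coeff_one_plus_X_power)
  finally show ?thesis
    unfolding split[symmetric] by (simp add: coeff_one_plus_X_power)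
qed

section \<open>Powers of a primitive element, power sums and binomials modulo p\<close>

locale primitive_field =
  fixes w :: "'a::finite_field" and p d :: nat
  assumes prime_p: "prime p" and card_eq: "CARD('a) = p ^ d" and prim: "primitive_element w"
begin

definition q :: nat where "q = p ^ d"

lemma CARD_eq [simp]: "CARD('a) = q"
  using card_eq by (simp add: q_def)

lemma CHAR_eq: "CHAR('a) = p"
  using CHAR_eq_prime[OF prime_p card_eq] .

lemma q_gt_1: "q > 1"
proof -
  have "card {0, 1 :: 'a} \<le> CARD('a)" by (intro card_mono) auto
  then show ?thesis by simp
qed

lemma d_pos: "d > 0"
  using q_gt_1 unfolding q_def by (cases d) auto

lemma w_nz [simp]: "w \<noteq> 0"
proof -
  have "w ^ 1 \<in> range (\<lambda>k::nat. w ^ k)" by blast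
  then show ?thesis using prim by (simp add: primitive_element_def)
qed

lemma power_q: "x ^ q = (x :: 'a)"
  using finite_field_power_card_eq_same[of x] by simp

lemma power_q_minus_1: "x \<noteq> 0 \<Longrightarrow> x ^ (q - 1) = (1 :: 'a)"
  using power_q[of x] q_gt_1 power_eq_if[of x q] by auto

lemma power_mod_q: "x \<noteq> 0 \<Longrightarrow> x ^ (k mod (q - 1)) = (x :: 'a) ^ k"
proof -
  assume "x \<noteq> 0"
  have "x ^ k = x ^ ((q - 1) * (k div (q - 1)) + k mod (q - 1))"
    by (simp only: mult_div_mod_eq)
  also have "\<dots> = x ^ (k mod (q - 1))"
    by (simp only: power_add power_mult power_q_minus_1[OF \<open>x \<noteq> 0\<close>] power_one mult_1)
  finally show ?thesis by (rule sym)
qed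

lemma ex_power: assumes "x \<noteq> 0" obtains k where "k < q - 1" "x = w ^ k"
proof -
  have "x \<in> range (\<lambda>k::nat. w ^ k)" using assms prim by (simp add: primitive_element_def)
  then obtain k where "x = w ^ k" by auto
  then have "x = w ^ (k mod (q - 1))" by (simp only: power_mod_q[OF w_nz])
  moreover have "k mod (q - 1) < q - 1" using q_gt_1 by simp
  ultimately show ?thesis using that by blast
qed

lemma power_eq_iff: "w ^ i = w ^ j \<longleftrightarrow> [i = j] (mod (q - 1))"
proof -
  have "(\<lambda>k. w ^ k) ` {..<q - 1} = UNIV - {0}"
  proof (intro equalityI subsetI)
    fix x assume "x \<in> UNIV - {0 :: 'a}"
    then obtain k where "k < q - 1" "x = w ^ k" by (auto elim: ex_power)
    then show "x \<in> (\<lambda>k. w ^ k) ` {..<q - 1}" by blast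
  qed auto
  then have "card ((\<lambda>k. w ^ k) ` {..<q - 1}) = card {..<q - 1}"
    by (simp add: card_Diff_singleton)
  then have inj: "inj_on (\<lambda>k. w ^ k) {..<q - 1}"
    by (simp add: eq_card_imp_inj_on)
  have "w ^ i = w ^ j \<longleftrightarrow> w ^ (i mod (q - 1)) = w ^ (j mod (q - 1))"
    by (simp only: power_mod_q[OF w_nz])
  also have "\<dots> \<longleftrightarrow> i mod (q - 1) = j mod (q - 1)"
    using inj_on_eq_iff[OF inj] q_gt_1 by simp
  finally show ?thesis by (simp add: cong_def)
qed

lemma power_eq_1_iff: "w ^ i = 1 \<longleftrightarrow> q - 1 dvd i"
  using power_eq_iff[of i 0] by (simp add: cong_0_iff)

text \<open>Replacing z by w z multiplies the sum by w^t, so it vanishes unless w^t = 1. The bounds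
  on t leave q - 1 as the only multiple of q - 1; there the nonzero elements contribute q - 1 =
  -1.\<close>

lemma sum_powers:
  assumes "0 < t" "t < 2 * (q - 1)"
  shows "(\<Sum>z\<in>UNIV. z ^ t) = (if t = q - 1 then -1 else 0 :: 'a)"
proof (cases "t = q - 1")
  case True
  have "(\<Sum>z\<in>UNIV. z ^ t) = (\<Sum>z\<in>UNIV - {0}. (z::'a) ^ t)"
    using assms by (intro sum.mono_neutral_right) auto
  also have "\<dots> = (\<Sum>z\<in>UNIV - {0::'a}. 1)"
    using True power_q_minus_1 by (intro sum.cong) auto
  also have "\<dots> = of_nat (q - 1)" by (simp add: card_Diff_singleton)
  also have "\<dots> = of_nat (p ^ d) - 1" using q_gt_1 by (simp add: of_nat_diff q_def)
  also have "of_nat (p ^ d) = (0 :: 'a)"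
    using d_pos of_nat_eq_0_iff_char_dvd[of "p ^ d", where 'a = 'a] CHAR_eq by (simp add: dvd_power)
  finally show ?thesis using True by simp
next
  case False
  have "\<not> q - 1 dvd t"
  proof
    assume "q - 1 dvd t"
    then obtain c where c: "t = (q - 1) * c" by auto
    with assms have "c > 0" "c < 2" by auto
    then have "c = 1" by simp
    with c False show False by simp
  qed
  then have ne: "w ^ t \<noteq> 1" by (simp add: power_eq_1_iff)
  have "bij_betw (\<lambda>z. w * z) UNIV UNIV"
    by (rule bij_betwI[where g = "\<lambda>z. z / w"]) auto
  then have "(\<Sum>z\<in>UNIV. (w * z) ^ t) = (\<Sum>z\<in>UNIV. z ^ t)"
    by (rule sum.reindex_bij_betw)
  then have "w ^ t * (\<Sum>z\<in>UNIV. z ^ t) = (\<Sum>z\<in>UNIV. z ^ t)"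
    by (simp add: power_mult_distrib sum_distrib_left)
  then have "(w ^ t - 1) * (\<Sum>z\<in>UNIV. z ^ t) = 0" by (simp add: algebra_simps)
  then show ?thesis using ne False by simp
qed

text \<open>Orthogonality of powers: the exponents q - 1 - l + i lie strictly between 0 and 2(q - 1)
  and equal q - 1 only for i = l. So a coefficient can be read off from the values of the
  polynomial.\<close>

lemma sum_extract_coeff:
  fixes P :: "'a poly"
  assumes "degree P < q - 1" "l < q - 1"
  shows "(\<Sum>z\<in>UNIV. z ^ (q - 1 - l) * poly P z) = - coeff P l"
proof -
  have "(\<Sum>z\<in>UNIV. z ^ (q - 1 - l) * poly P z)
      = (\<Sum>z\<in>UNIV. \<Sum>i\<le>degree P. coeff P i * z ^ (q - 1 - l + i))"
    by (rule sum.cong) (simp_all only: poly_altdef sum_distrib_left power_add mult_ac)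
  also have "\<dots> = (\<Sum>i\<le>degree P. coeff P i * (\<Sum>z\<in>UNIV. z ^ (q - 1 - l + i)))"
    by (subst sum.swap) (simp add: sum_distrib_left)
  also have "\<dots> = (\<Sum>i\<le>degree P. if i = l then - coeff P i else 0)"
    using assms by (intro sum.cong refl) (subst sum_powers, auto)
  also have "\<dots> = - coeff P l"
    by (simp add: sum.delta coeff_eq_0 not_le)
  finally show ?thesis .
qed

lemma poly_eqI_q:
  assumes "\<And>x. poly P x = poly Q (x :: 'a)" "degree P \<le> q - 1" "degree Q \<le> q - 1"
  shows "P = Q"
  using assms q_gt_1 by (intro poly_eqI_degree[of UNIV]) auto

text \<open>Lucas' theorem in the form in which it is iterated: each use strips the last base p
  digit and passes the nonvanishing on to the remaining digits.\<close>

lemma choose_nz_digit_le: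
  assumes "s < p" "of_nat ((p * a + s) choose k) \<noteq> (0 :: 'a)"
  shows "k mod p \<le> s" "of_nat (a choose (k div p)) \<noteq> (0 :: 'a)"
proof -
  have "of_nat ((p * a + s) choose (p * (k div p) + k mod p))
      = (of_nat (a choose (k div p)) * of_nat (s choose (k mod p)) :: 'a)"
    using of_nat_choose_Lucas[where 'a = 'a, of s "k mod p" a "k div p"] assms(1)
    by (simp add: CHAR_eq prime_gt_0_nat[OF prime_p])
  then have nz: "of_nat (a choose (k div p)) * of_nat (s choose (k mod p)) \<noteq> (0 :: 'a)"
    using assms(2) by simp
  then show "of_nat (a choose (k div p)) \<noteq> (0 :: 'a)" by auto
  from nz have "s choose (k mod p) \<noteq> 0" by (metis mult_zero_right of_nat_0)
  then show "k mod p \<le> s" by (simp add: binomial_eq_0_iff)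
qed

text \<open>The last digit contributes the factor \<open>s choose j\<close>, a divisor of s!, and s
  < p keeps p out of s!.\<close>

lemma choose_nzI:
  assumes "s < p" "j \<le> s" "of_nat (a choose k) \<noteq> (0 :: 'a)"
  shows "of_nat ((p * a + s) choose (p * k + j)) \<noteq> (0 :: 'a)"
proof -
  have "\<not> p dvd s choose j"
  proof
    assume "p dvd s choose j"
    then have "p dvd fact s"
      using binomial_fact_lemma[OF assms(2)] by (metis dvd_triv_right dvd_trans)
    then show False using assms(1) prime_dvd_fact_iff[OF prime_p] by simp
  qed
  then show ?thesis
    using of_nat_choose_Lucas[where 'a = 'a, of s j a k] assms
    by (simp add: CHAR_eq of_nat_eq_0_iff_char_dvd)
qed

text \<open>No carries occur when every product of c and a digit stays below p.\<close>

lemma digit_mult: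
  assumes "\<And>i. c * (k div p ^ i mod p) < p"
  shows "(c * k) div p ^ i mod p = c * (k div p ^ i mod p)"
  using assms
proof (induction i arbitrary: k)
  case 0
  have "(c * k) mod p = c * (k mod p) mod p" by (simp add: mod_mult_right_eq)
  then show ?case using "0.prems"[of 0] by simp
next
  case (Suc i)
  have "c * k = c * (k mod p) + p * (c * (k div p))"
    by (metis distrib_left mod_mult_div_eq mult.left_commute)
  then have "c * k div p = c * (k div p)" using Suc.prems[of 0] by simp
  moreover have "k div p div p ^ i = k div p ^ Suc i" for k i
    by (simp add: div_mult2_eq)
  ultimately show ?case
    using Suc.IH[of "k div p"] Suc.prems by (metis (no_types, lifting))
qed

end

section \<open>Maps from the Paley to the Peisert scheme\<close>

text \<open>
  The digits of \<open>e = (q - 1)/4\<close> to the base \<open>p = 4h + 3\<close> are alternately \<open>3h + 2\<close> and \<open>h\<close>,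
  those of \<open>3e\<close> are alternately \<open>h\<close> and \<open>3h + 2\<close>, and all digits of \<open>2e\<close> are \<open>2h + 1\<close>.
\<close>

locale peisert_field = primitive_field +
  fixes h \<delta> e :: nat
  assumes p_eq: "p = 4 * h + 3" and d_eq: "d = 2 * \<delta>" and q_eq: "q = 4 * e + 1"
begin

section \<open>Base p digits of e, 3e and the exponents of (x - y)^(2e)\<close>

lemma \<delta>_pos: "\<delta> > 0"
  using d_pos d_eq by simp

lemma q_pow: "q = p ^ (2 * \<delta>)"
  by (metis q_def d_eq)

text \<open>Since p^2 = 4 (p h + 3h + 2) + 1, passing from (p^(2i) - 1)/4 to (p^(2i+2) - 1)/4
  appends the two low digits h, 3h + 2. Tripling turns these into 3h + 2, h, because 3 (3h + 2) = 2p
  + h carries 2 into 3h.\<close>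

lemma quarter_digits:
  assumes "4 * x + 1 = p ^ (2 * Suc i)" "4 * y + 1 = p ^ (2 * i)"
  shows "x = p * (p * y + h) + (3 * h + 2)" "3 * x = p * (p * (3 * y) + (3 * h + 2)) + h"
proof -
  have "4 * x + 1 = p * p * (4 * y + 1)" using assms by simp
  then have "4 * x + 1 = 4 * (p * p * y) + p * p" by (simp add: ring_distribs)
  moreover have "p * p = 4 * (p * h) + 4 * (3 * h + 2) + 1" by (simp add: p_eq algebra_simps)
  moreover define A B where "A = p * p * y" and "B = p * h"
  ultimately have "x = A + B + (3 * h + 2)" by simp
  then show x: "x = p * (p * y + h) + (3 * h + 2)" by (simp add: A_def B_def ring_distribs)
  show "3 * x = p * (p * (3 * y) + (3 * h + 2)) + h"
    unfolding x by (simp add: p_eq algebra_simps)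
qed

lemma ex_quarter: "\<exists>y. 4 * y + 1 = p ^ (2 * i)"
proof (induction i)
  case (Suc i)
  then obtain y where y: "4 * y + 1 = p ^ (2 * i)" by auto
  have "p ^ (2 * Suc i) = p * p * (4 * y + 1)" unfolding y by simp
  also have "\<dots> = 4 * (p * (p * y + h) + (3 * h + 2)) + 1" by (simp add: p_eq algebra_simps)
  finally show ?case by metis
qed simp

lemma e_digits:
  obtains y where "4 * y + 1 = p ^ (2 * (\<delta> - 1))"
    "e = p * (p * y + h) + (3 * h + 2)" "3 * e = p * (p * (3 * y) + (3 * h + 2)) + h"
proof -
  obtain y where y: "4 * y + 1 = p ^ (2 * (\<delta> - 1))" using ex_quarter by blast
  have "4 * e + 1 = p ^ (2 * Suc (\<delta> - 1))" using q_eq q_pow \<delta>_pos by simp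
  from that[OF y quarter_digits[OF this y]] show ?thesis .
qed

lemma e_pos: "e > 0"
  using q_gt_1 q_eq by simp

text \<open>The exponents of x that survive in the expansion of (x - y)^(2e) over the field. Every
  digit of 2e is (p - 1)/2, so such an exponent has no larger digit.\<close>

definition good :: "nat \<Rightarrow> bool" where
  "good k \<longleftrightarrow> of_nat ((2 * e) choose k) \<noteq> (0 :: 'a)"

lemma good_le: "good k \<Longrightarrow> k \<le> 2 * e"
  unfolding good_def by (metis binomial_eq_0 not_le of_nat_0)

text \<open>With z = (p^(i-1) - 1)/2 one has y = p z + (2h + 1). So every digit of y is 2h + 1, and
  Lucas' theorem bounds the digits of k one after another.\<close>

lemma half_choose_digit:
  assumes "2 * y + 1 = p ^ i" "of_nat (y choose k) \<noteq> (0 :: 'a)"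
  shows "k div p ^ j mod p \<le> 2 * h + 1"
  using assms
proof (induction i arbitrary: y k j)
  case 0
  then have "k = 0" by (cases k) auto
  then show ?case by simp
next
  case (Suc i)
  have "odd (p ^ i)" by (simp add: p_eq)
  then obtain z where z: "p ^ i = 2 * z + 1" by (elim oddE)
  have "2 * y + 1 = p * (2 * z + 1)" using Suc.prems(1) z by simp
  then have y: "y = p * z + (2 * h + 1)" by (simp add: p_eq algebra_simps)
  note * = choose_nz_digit_le[of "2 * h + 1" z k]
  show ?case
  proof (cases j)
    case 0
    then show ?thesis using * Suc.prems(2) y by (simp add: p_eq)
  next
    case (Suc j')
    have "k div p div p ^ j' mod p \<le> 2 * h + 1"
      using * Suc.prems(2) y Suc.IH[of z "k div p" j'] z by (simp add: p_eq)
    then show ?thesis by (simp add: Suc div_mult2_eq)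
  qed
qed

lemma good_digit: "good k \<Longrightarrow> k div p ^ j mod p \<le> 2 * h + 1"
  unfolding good_def by (rule half_choose_digit[of _ d]) (use q_eq in \<open>simp_all add: q_def\<close>)

text \<open>The constants are arbitrary nonzero elements, so that the property survives composing g
  with Frobenius, which exchanges \<alpha> and \<beta>.\<close>

definition kernel :: "'a \<Rightarrow> 'a \<Rightarrow> 'a \<Rightarrow> ('a \<Rightarrow> 'a) \<Rightarrow> bool" where
  "kernel \<alpha> \<beta> \<epsilon> g \<longleftrightarrow> bij g \<and> \<alpha> \<noteq> 0 \<and> \<beta> \<noteq> 0 \<and> \<epsilon> \<noteq> 0 \<and>
     (\<forall>x y. \<alpha> * (g x - g y) ^ e + \<beta> * (g x - g y) ^ (3 * e) = \<epsilon> * (x - y) ^ (2 * e))"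

text \<open>Good exponents are at most 2e < q - 1, so the polynomial is the reduced one and its
  exponents are determined by the function.\<close>

definition good_fun :: "('a \<Rightarrow> 'a) \<Rightarrow> bool" where
  "good_fun f \<longleftrightarrow> (\<exists>P. (\<forall>k. coeff P k \<noteq> 0 \<longrightarrow> good k) \<and> (\<forall>x. poly P x = f x))"

lemma good_fun_poly:
  assumes "good_fun (poly P)" "degree P \<le> q - 1" "coeff P k \<noteq> 0"
  shows "good k"
proof -
  obtain R where R: "\<And>k. coeff R k \<noteq> 0 \<Longrightarrow> good k" "\<And>x. poly R x = poly P x"
    using assms(1) unfolding good_fun_def by blast
  have "degree R \<le> q - 1"
  proof (rule degree_le, intro allI impI)
    fix k assume "q - 1 < k"
    then have "\<not> good k" using good_le[of k] q_eq by auto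
    then show "coeff R k = 0" using R(1) by blast
  qed
  with R assms(2) have "R = P" by (intro poly_eqI_q) auto
  then show ?thesis using R(1) assms(3) by simp
qed

text \<open>
  For fixed \<open>x\<close>, both sides of the kernel identity are functions of \<open>z = g y\<close>; comparing the
  coefficients of \<open>z\<^sup>l\<close>, the left one involves a power of \<open>g x\<close> and the right one only good
  powers of \<open>x\<close>.
\<close>

lemma good_fun_power:
  assumes ker: "kernel \<alpha> \<beta> \<epsilon> g" and l: "l \<le> e"
    and nz: "of_nat (e choose l) \<noteq> (0 :: 'a)" and z: "of_nat ((3 * e) choose l) = (0 :: 'a)"
  shows "good_fun (\<lambda>x. g x ^ (e - l))"
proof -
  have g: "bij g" and "\<alpha> \<noteq> 0"
    and K: "\<And>x y. \<alpha> * (g x - g y) ^ e + \<beta> * (g x - g y) ^ (3 * e) = \<epsilon> * (x - y) ^ (2 * e)"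
    using ker by (auto simp: kernel_def)
  \<comment> \<open>The right side of the kernel identity, as a function of z = g y, is paired with
    z^(q - 1 - l). The result extracts the coefficient of z^l while remaining a polynomial in
    x.\<close>
  define R where "R = (\<Sum>y\<in>UNIV. smult (\<epsilon> * g y ^ (q - 1 - l)) ([:- y, 1:] ^ (2 * e)))"
  define c where "c = \<alpha> * of_nat (e choose l) * (- 1) ^ l"
  have c: "c \<noteq> 0" using \<open>\<alpha> \<noteq> 0\<close> nz by (simp add: c_def)
  have "poly R x = - (c * g x ^ (e - l))" for x
  proof -
    define P where "P = smult \<alpha> ([:g x, -1:] ^ e) + smult \<beta> ([:g x, -1:] ^ (3 * e))"
    have deg: "degree ([:g x, -1:] ^ i) \<le> i" for i
      using degree_power_le[of "[:g x, -1:]" i] by simp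
    have "degree P \<le> 3 * e"
      unfolding P_def using deg[of e] deg[of "3 * e"]
      by (intro degree_add_le) (auto intro: order.trans[OF degree_smult_le])
    then have "degree P < q - 1" using e_pos q_eq by simp
    moreover have "l < q - 1" using l e_pos q_eq by simp
    ultimately have "(\<Sum>z\<in>UNIV. z ^ (q - 1 - l) * poly P z) = - coeff P l"
      by (rule sum_extract_coeff)
    \<comment> \<open>The term with 3e drops out because \<open>(3 * e) choose l\<close> vanishes;
      one power of g x remains.\<close>
    moreover have "coeff P l = c * g x ^ (e - l)"
      using l z by (simp add: P_def c_def coeff_linear_poly_power)
    moreover have "(\<Sum>z\<in>UNIV. z ^ (q - 1 - l) * poly P z)
        = (\<Sum>y\<in>UNIV. g y ^ (q - 1 - l) * poly P (g y))"
      by (rule sum.reindex_bij_betw[OF g, symmetric])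
    moreover have "poly P (g y) = \<epsilon> * (x - y) ^ (2 * e)" for y
      using K[of x y] by (simp add: P_def)
    ultimately show ?thesis
      by (simp add: R_def poly_sum mult_ac)
  qed
  then have "poly (smult (- inverse c) R) x = g x ^ (e - l)" for x
    using c by simp
  moreover have "good k" if "coeff (smult (- inverse c) R) k \<noteq> 0" for k
  proof (rule ccontr)
    assume "\<not> good k"
    then have "coeff ([:- y, 1:] ^ (2 * e)) k = 0" for y :: 'a
      using degree_power_le[of "[:- y, 1:]" "2 * e"]
      by (cases "k \<le> 2 * e") (simp_all add: good_def coeff_linear_poly_power coeff_eq_0)
    then show False using that by (simp add: R_def coeff_sum)
  qed
  ultimately show ?thesis unfolding good_fun_def by blast
qed

text \<open>Take l = e - j. The last digit 3h + 2 of e is at least j, so binom(e, l) = binom(e, j)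
  survives. The last digit of l is 3h + 2 - j, which exceeds the last digit h of 3e as long as j <=
  2h + 1. For j = 2h + 2 the last digits agree, and the vanishing comes from the third digit, 3h + 2
  in l against h in 3e; it is present only for \<open>\<delta> \<ge> 2\<close>.\<close>

lemma good_fun_power_initial:
  assumes ker: "kernel \<alpha> \<beta> \<epsilon> g" and j: "j \<le> 2 * h + 1 \<or> \<delta> \<ge> 2 \<and> j \<le> 2 * h + 2"
  shows "good_fun (\<lambda>x. g x ^ j)"
proof -
  obtain y where y: "4 * y + 1 = p ^ (2 * (\<delta> - 1))"
    "e = p * (p * y + h) + (3 * h + 2)" "3 * e = p * (p * (3 * y) + (3 * h + 2)) + h"
    by (rule e_digits)
  have je: "j \<le> 3 * h + 2" "j \<le> e" using j y(2) by auto
  have nz: "of_nat (e choose j) \<noteq> (0 :: 'a)"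
    using choose_nzI[of "3 * h + 2" j "p * y + h" 0] je y(2) by (simp add: p_eq)
  then have "of_nat (e choose (e - j)) \<noteq> (0 :: 'a)"
    using je by (simp add: binomial_symmetric[of j e])
  moreover have "of_nat ((3 * e) choose (e - j)) = (0 :: 'a)"
  proof (rule ccontr)
    assume "of_nat ((3 * e) choose (e - j)) \<noteq> (0 :: 'a)"
    then have *: "of_nat ((p * (p * (3 * y) + (3 * h + 2)) + h) choose (e - j)) \<noteq> (0 :: 'a)"
      using y(3) by simp
    have ej: "e - j = p * (p * y + h) + (3 * h + 2 - j)" using y(2) je by simp
    have small: "3 * h + 2 - j < p" "h < p" "3 * h + 2 < p" by (simp_all add: p_eq)
    have "(e - j) mod p = 3 * h + 2 - j" "(e - j) div p = p * y + h"
      using small by (simp_all add: ej)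
    with choose_nz_digit_le[OF small(2) *] have
      le: "3 * h + 2 - j \<le> h" and "of_nat ((p * (3 * y) + (3 * h + 2)) choose (p * y + h)) \<noteq> (0 :: 'a)"
      by auto
    with choose_nz_digit_le(2)[OF small(3) this(2)] small
    have **: "of_nat ((3 * y) choose y) \<noteq> (0 :: 'a)" by simp
    \<comment> \<open>Here 3h + 2 - j <= h, that is j >= 2h + 2, which only the second alternative
      of the hypothesis allows.\<close>
    have "\<delta> \<ge> 2" using le j by auto
    then obtain i where i: "\<delta> - 1 = Suc i" by (cases "\<delta> - 1") auto
    obtain z where z: "4 * z + 1 = p ^ (2 * i)" using ex_quarter by blast
    note yz = quarter_digits[OF y(1)[unfolded i] z]
    have "of_nat ((p * (p * (3 * z) + (3 * h + 2)) + h) choose y) \<noteq> (0 :: 'a)"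
      using ** unfolding yz(2) .
    from choose_nz_digit_le(1)[OF small(2) this] have "y mod p \<le> h" .
    moreover have "y mod p = 3 * h + 2" 
      unfolding yz(1) mod_mult_self4 using small(3) by (rule mod_less)
    ultimately show False by simp
  qed
  ultimately have "good_fun (\<lambda>x. g x ^ (e - (e - j)))"
    using ker by (intro good_fun_power[OF ker]) auto
  moreover have "e - (e - j) = j" using je by simp
  ultimately show ?thesis by simp
qed

section \<open>The degree of an isomorphism\<close>

lemma kernel_poly:
  assumes "kernel \<alpha> \<beta> \<epsilon> g"
  obtains F where "\<And>x. poly F x = g x" "\<And>k. coeff F k \<noteq> 0 \<Longrightarrow> good k" "degree F > 0"
proof -
  have "good_fun (\<lambda>x. g x ^ 1)" by (rule good_fun_power_initial[OF assms]) simp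
  then obtain F where F: "\<And>x. poly F x = g x" "\<And>k. coeff F k \<noteq> 0 \<Longrightarrow> good k"
    unfolding good_fun_def by auto
  have "degree F \<noteq> 0"
  proof
    assume "degree F = 0"
    then obtain c where "F = [:c:]" by (elim degree_eq_zeroE)
    then have "g 0 = g 1" using F(1)[of 0] F(1)[of 1] by simp
    moreover have "inj g" using assms by (simp add: kernel_def bij_is_inj)
    ultimately show False by (simp add: inj_eq)
  qed
  then show ?thesis using that F by blast
qed

text \<open>The leading exponent j deg F of F^j is good once it is at most q - 1, and then its
  digits are at most 2h + 1. Induction on j keeps everything in range: deg F and j deg F are at most
  2e, so (j + 1) deg F <= 4e = q - 1; and for j > 0, (j + 1) times a digit of deg F is at most 2 (2h
  + 1) < p, so no carry arises.\<close>

lemma kernel_degree_digit: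
  assumes ker: "kernel \<alpha> \<beta> \<epsilon> g" and F: "\<And>x. poly F x = g x" and F0: "degree F > 0"
    and good: "\<And>k. coeff F k \<noteq> 0 \<Longrightarrow> good k" and J: "J \<le> 2 * h + 1 \<or> \<delta> \<ge> 2 \<and> J \<le> 2 * h + 2"
  shows "J * (degree F div p ^ i mod p) \<le> 2 * h + 1"
proof -
  have F_nz: "F \<noteq> 0" using F0 by auto
  have step: "good (Suc j * degree F)" if "Suc j \<le> J" "Suc j * degree F \<le> q - 1" for j
  proof (rule good_fun_poly)
    have "good_fun (\<lambda>x. g x ^ Suc j)"
      by (rule good_fun_power_initial[OF ker]) (use that J in auto)
    then show "good_fun (poly (F ^ Suc j))" by (simp add: F good_fun_def)
    show "degree (F ^ Suc j) \<le> q - 1" using that unfolding degree_power_eq[OF F_nz] by simp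
    have "coeff (F ^ Suc j) (degree (F ^ Suc j)) \<noteq> 0"
      using F_nz by simp
    then show "coeff (F ^ Suc j) (Suc j * degree F) \<noteq> 0"
      unfolding degree_power_eq[OF F_nz] .
  qed
  have "j \<le> J \<Longrightarrow> (j > 0 \<longrightarrow> good (j * degree F)) \<and> (\<forall>i. j * (degree F div p ^ i mod p) \<le> 2 * h + 1)" for j
  proof (induction j)
    case (Suc j)
    then have IH: "j > 0 \<Longrightarrow> good (j * degree F)" "\<And>i. j * (degree F div p ^ i mod p) \<le> 2 * h + 1"
      by auto
    have "good (Suc j * degree F)"
    proof (rule step)
      have "degree F \<le> 2 * e" using good F_nz by (intro good_le) simp
      moreover have "j * degree F \<le> 2 * e" if "j > 0" using IH(1) that by (intro good_le)
      ultimately show "Suc j * degree F \<le> q - 1" using q_eq by (cases "j = 0") auto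
    qed (use Suc.prems in simp)
    moreover have "Suc j * (degree F div p ^ i mod p) < p" for i
    proof (cases "j = 0")
      case True
      then show ?thesis by (simp add: p_eq)
    next
      case False
      then have "Suc j * (degree F div p ^ i mod p) \<le> 2 * (j * (degree F div p ^ i mod p))"
        by (cases j) simp_all
      then show ?thesis using IH(2)[of i] p_eq by linarith
    qed
    ultimately have "Suc j * (degree F div p ^ i mod p) \<le> 2 * h + 1" for i
      using good_digit[of "Suc j * degree F" i] digit_mult[of "Suc j" "degree F" i] by simp
    then show ?case using \<open>good (Suc j * degree F)\<close> by blast
  qed simp
  then show ?thesis by blast
qed

lemma no_kernel_large:
  assumes "\<delta> \<ge> 2"
  shows "\<not> kernel \<alpha> \<beta> \<epsilon> g"
proof
  assume ker: "kernel \<alpha> \<beta> \<epsilon> g"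
  obtain F where F: "\<And>x. poly F x = g x" "\<And>k. coeff F k \<noteq> 0 \<Longrightarrow> good k" "degree F > 0"
    using kernel_poly[OF ker] by blast
  \<comment> \<open>The one additional power available for \<open>\<delta> \<ge> 2\<close> is what
    forces every digit of the degree to be 0.\<close>
  have *: "(2 * h + 2) * (degree F div p ^ i mod p) \<le> 2 * h + 1" for i
    by (rule kernel_degree_digit[OF ker F(1) F(3) F(2)]) (use assms in auto)
  then have digit: "degree F div p ^ i mod p = 0" for i
  proof -
    have "(2 * h + 2) * (degree F div p ^ i mod p) < (2 * h + 2) * 1"
      by (rule le_less_trans[OF *]) simp
    then show ?thesis by (simp only: mult_less_cancel1) simp
  qed
  have "p ^ i dvd degree F" for i
  proof (induction i)
    case (Suc i)
    then show ?case using digit[of i]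
      by (metis dvd_eq_mod_eq_0 dvd_mult_div_cancel mult_dvd_mono dvd_refl power_Suc2)
  qed simp
  then have "p ^ degree F \<le> degree F" using F(3) by (simp add: dvd_imp_le)
  moreover have "degree F < p ^ degree F" using prime_gt_1_nat[OF prime_p] by (simp add: power_gt_expt)
  ultimately show False by simp
qed

text \<open>Since p = 3 and 9 = 1 modulo 4, raising to the p-th power exchanges the exponents e and
  3e modulo 4e = q - 1. All bounds obtained for g thus also apply to its p-th power.\<close>

lemma kernel_frob:
  assumes "kernel \<alpha> \<beta> \<epsilon> g"
  shows "kernel \<beta> \<alpha> \<epsilon> (\<lambda>x. g x ^ p)"
proof -
  have g: "bij g" and K: "\<alpha> * (g x - g y) ^ e + \<beta> * (g x - g y) ^ (3 * e) = \<epsilon> * (x - y) ^ (2 * e)" for x y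
    using assms by (auto simp: kernel_def)
  have add: "(a + b) ^ p = a ^ p + b ^ p" for a b :: 'a
    by (rule freshmans_dream) (simp_all add: prime_p CHAR_eq)
  have diff: "a ^ p - b ^ p = (a - b) ^ p" for a b :: 'a
    using add[of "a - b" b] unfolding diff_add_cancel by (metis add_diff_cancel_right')
  have e13: "(a ^ p) ^ e = a ^ (3 * e) \<and> (a ^ p) ^ (3 * e) = a ^ e" for a :: 'a
  proof (cases "a = 0")
    case False
    have red: "a ^ (4 * e * c + k) = a ^ k" for c k
      using power_q_minus_1[OF False] q_eq by (simp add: power_add power_mult)
    have "p * e = 4 * e * h + 3 * e" "p * (3 * e) = 4 * e * (3 * h + 2) + e"
      by (simp_all add: p_eq algebra_simps)
    with red[of h "3 * e"] red[of "3 * h + 2" e]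
    have "a ^ (p * e) = a ^ (3 * e)" "a ^ (p * (3 * e)) = a ^ e"
      by metis+
    then show ?thesis by (simp only: power_mult)
  qed (use e_pos p_eq in \<open>simp add: zero_power\<close>)
  have "inj (\<lambda>x. x ^ p :: 'a)"
  proof (rule injI)
    fix a b :: 'a assume "a ^ p = b ^ p"
    then have "(a - b) ^ p = 0" using diff[of a b] by simp
    then show "a = b" by simp
  qed
  then have "bij (\<lambda>x. x ^ p :: 'a)" by (simp add: bij_def finite_UNIV_inj_surj)
  then have "bij (\<lambda>x. g x ^ p)" using bij_comp[OF g] by (simp add: comp_def)
  moreover have "\<beta> * (g x ^ p - g y ^ p) ^ e + \<alpha> * (g x ^ p - g y ^ p) ^ (3 * e) = \<epsilon> * (x - y) ^ (2 * e)" for x y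
    unfolding diff e13[THEN conjunct1] e13[THEN conjunct2] using K[of x y] by (simp only: add.commute)
  ultimately show ?thesis
    using assms by (simp add: kernel_def)
qed

section \<open>The case d = 2\<close>

lemma kernel_degree:
  assumes "\<delta> = 1" "kernel \<alpha> \<beta> \<epsilon> g"
    and F: "\<And>x. poly F x = g x" "\<And>k. coeff F k \<noteq> 0 \<Longrightarrow> good k" "degree F > 0"
  shows "degree F \<le> p + 1"
proof -
  \<comment> \<open>The bound for J = 2h + 1 leaves only the digits 0 and 1, and a degree below p^2
    has two digits.\<close>
  have *: "(2 * h + 1) * (degree F div p ^ i mod p) \<le> 2 * h + 1" for i
    by (rule kernel_degree_digit[OF assms(2) F(1) F(3) F(2)]) auto
  have digit: "degree F div p ^ i mod p \<le> 1" for i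
    using *[of i] mult_le_cancel1[of "2 * h + 1" "degree F div p ^ i mod p" 1] by simp
  have "good (degree F)" using F by force
  then have "degree F \<le> 2 * e" by (rule good_le)
  then have "degree F < p * p"
    using q_eq q_pow assms(1) by (simp add: power2_eq_square)
  then have "degree F div p mod p = degree F div p" by (simp add: less_mult_imp_div_less)
  then have "degree F div p \<le> 1" "degree F mod p \<le> 1" using digit[of 1] digit[of 0] by simp_all
  then have "p * (degree F div p) + degree F mod p \<le> p * 1 + 1" by (intro add_mono mult_left_mono) auto
  then show ?thesis by simp
qed

lemma kernel_shift:
  assumes "kernel \<alpha> \<beta> \<epsilon> g"
  shows "kernel \<alpha> \<beta> \<epsilon> (\<lambda>x. g x - c)"
proof -
  have "bij (\<lambda>x::'a. x - c)" by (rule bij_betwI[where g = "\<lambda>x. x + c"]) auto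
  then have "bij (\<lambda>x. g x - c)"
    using assms bij_comp[of g "\<lambda>x. x - c"] by (simp add: kernel_def comp_def)
  then show ?thesis using assms by (simp add: kernel_def)
qed

lemma power_p_sum: "(\<Sum>k\<in>A. f k) ^ p = (\<Sum>k\<in>A. (f k :: 'a) ^ p)"
  by (rule freshmans_dream_sum) (simp_all add: prime_p CHAR_eq)

text \<open>Both g and its p-th power have polynomials of degree at most p + 1. Frobenius sends the
  exponent k to p k modulo p^2 - 1; for 2 <= k < p this is p k > p + 1, so the coefficient of x^k in
  g has to vanish.\<close>

lemma kernel_support:
  assumes "\<delta> = 1" and ker: "kernel \<alpha> \<beta> \<epsilon> g" and g0: "g 0 = 0"
  obtains a b c where "\<And>x. g x = a * x + b * x ^ p + c * x ^ (p + 1)"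
proof -
  have q2: "q = p * p" using q_pow assms(1) by (simp add: power2_eq_square)
  have p3: "p \<ge> 3" by (simp add: p_eq)
  obtain F where F: "\<And>x. poly F x = g x" "\<And>k. coeff F k \<noteq> 0 \<Longrightarrow> good k" "degree F > 0"
    using kernel_poly[OF ker] by blast
  have degF: "degree F \<le> p + 1" by (rule kernel_degree[OF assms(1) ker F])
  note ker' = kernel_frob[OF ker]
  obtain H where H: "\<And>x. poly H x = g x ^ p" "\<And>k. coeff H k \<noteq> 0 \<Longrightarrow> good k" "degree H > 0"
    using kernel_poly[OF ker'] by blast
  have degH: "degree H \<le> p + 1" by (rule kernel_degree[OF assms(1) ker' H])
  \<comment> \<open>This is p k reduced modulo p^2 - 1: p * p becomes 1, and p (p + 1) becomes p +
    1.\<close>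
  define r where "r k = (if k < p then p * k else if k = p then 1 else p + 1)" for k
  define H' where "H' = (\<Sum>k\<le>p + 1. monom (coeff F k ^ p) (r k))"
  have "(x ^ k) ^ p = x ^ r k" if "k \<le> p + 1" for x :: 'a and k
  proof -
    have "x ^ (p * p) = x" using power_q[of x] q2 by simp
    moreover have "k < p \<or> k = p \<or> k = p + 1" using that by linarith
    ultimately show ?thesis
      by (auto simp: r_def power_mult[symmetric] mult.commute power_add)
  qed
  then have "poly H' x = (\<Sum>k\<le>p + 1. (coeff F k * x ^ k) ^ p)" for x
    by (simp add: H'_def poly_sum poly_monom power_mult_distrib)
  moreover have Fx: "poly F x = (\<Sum>k\<le>p + 1. coeff F k * x ^ k)" for x
    unfolding poly_altdef using degF
    by (intro sum.mono_neutral_left) (auto simp: coeff_eq_0)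
  ultimately have "poly H' x = poly H x" for x
    by (simp add: power_p_sum[symmetric] H(1) F(1)[symmetric])
  moreover have "degree H' \<le> q - 1"
    unfolding H'_def
  proof (rule degree_sum_le)
    fix k assume "k \<in> {..p + 1}"
    have "p * k \<le> p * (p - 1)" if "k < p" using that by (intro mult_left_mono) auto
    moreover have "p * 3 \<le> p * p" using p3 by (intro mult_left_mono) auto
    moreover have "p * (p - 1) = p * p - p" by (simp add: diff_mult_distrib2)
    ultimately have "k < p \<Longrightarrow> p * k \<le> p * p - 1" "p + 1 \<le> p * p - 1" using p3 by linarith+
    then have "r k \<le> q - 1" by (auto simp: r_def q2)
    then show "degree (monom (coeff F k ^ p) (r k)) \<le> q - 1"
      using degree_monom_le order.trans by blast
  qed simp
  moreover have "p * 3 \<le> p * p" using p3 by (intro mult_left_mono) auto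
  then have "degree H \<le> q - 1" using degH q2 p3 by linarith
  ultimately have "H' = H" by (rule poly_eqI_q)
  have zero: "coeff F k = 0" if k: "2 \<le> k" "k < p" for k
  proof -
    have r_iff: "r i = p * k \<longleftrightarrow> i = k" if "i \<le> p + 1" for i
    proof -
      have "\<not> p dvd 1" using p3 by simp
      moreover from this have "\<not> p dvd p + 1" by (subst dvd_add_right_iff) simp_all
      ultimately have "1 \<noteq> p * k" "p + 1 \<noteq> p * k" by (metis dvd_triv_left)+
      then show ?thesis using k p3 by (auto simp: r_def)
    qed
    have "coeff H' (p * k) = (\<Sum>i\<le>p + 1. if i = k then coeff F i ^ p else 0)"
      unfolding H'_def coeff_sum by (intro sum.cong refl) (simp add: r_iff)
    also have "\<dots> = coeff F k ^ p" using k by (simp add: sum.delta)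
    finally have "coeff F k ^ p = coeff H (p * k)" using \<open>H' = H\<close> by simp
    moreover have "p * 2 \<le> p * k" using k by (intro mult_left_mono) auto
    then have "coeff H (p * k) = 0" using degH p3 by (intro coeff_eq_0) linarith
    ultimately show ?thesis by simp
  qed
  have "coeff F 0 = 0" using F(1)[of 0] g0 by (simp add: poly_0_coeff_0)
  then have z: "coeff F k = 0" if "k \<in> {..p + 1} - {1, p, p + 1}" for k
    using zero[of k] that by (cases "k = 0"; cases "k = 1") auto
  have "g x = coeff F 1 * x + coeff F p * x ^ p + coeff F (p + 1) * x ^ (p + 1)" for x
  proof -
    have "g x = (\<Sum>k\<le>p + 1. coeff F k * x ^ k)" using Fx F(1) by simp
    also have "\<dots> = (\<Sum>k\<in>{1, p, p + 1}. coeff F k * x ^ k)"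
      using z by (intro sum.mono_neutral_right) auto
    finally show ?thesis using p3 by (simp add: add.assoc)
  qed
  then show ?thesis by (rule that)
qed

lemma e_digits_small:
  assumes "\<delta> = 1"
  shows "e = p * h + (3 * h + 2)" "3 * e = p * (3 * h + 2) + h"
proof -
  obtain y where "4 * y + 1 = p ^ (2 * (\<delta> - 1))"
    and e: "e = p * (p * y + h) + (3 * h + 2)" "3 * e = p * (p * (3 * y) + (3 * h + 2)) + h"
    by (rule e_digits)
  then have "y = 0" using assms by simp
  then show "e = p * h + (3 * h + 2)" "3 * e = p * (3 * h + 2) + h" using e by simp_all
qed

text \<open>Take l = e - j with j = p + (2h + 1). The digits 1, 2h + 1 of j are at most the digits
  h, 3h + 2 of e because h > 0, while the last digit h + 1 of l exceeds the last digit h of 3e. The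
  power is chosen so that a term x^(p+1) in g would produce the digit 2h + 2.\<close>

lemma good_fun_mixed_power:
  assumes "\<delta> = 1" "h > 0" and ker: "kernel \<alpha> \<beta> \<epsilon> g"
  shows "good_fun (\<lambda>x. g x ^ (p + (2 * h + 1)))"
proof -
  note e = e_digits_small[OF assms(1)]
  define j where "j = p * 1 + (2 * h + 1)"
  have "\<not> p dvd h" using assms(2) by (auto simp: p_eq dest: dvd_imp_le)
  then have "of_nat (h choose 1) \<noteq> (0 :: 'a)" by (simp add: of_nat_eq_0_iff_char_dvd CHAR_eq)
  then have "of_nat (e choose j) \<noteq> (0 :: 'a)"
    unfolding e(1) j_def by (intro choose_nzI) (simp_all add: p_eq)
  moreover have je: "j \<le> e" using assms(2) by (cases h) (simp_all add: e(1) j_def)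
  ultimately have "of_nat (e choose (e - j)) \<noteq> (0 :: 'a)"
    by (simp add: binomial_symmetric[of j e])
  moreover have "of_nat ((3 * e) choose (e - j)) = (0 :: 'a)"
  proof (rule ccontr)
    assume "of_nat ((3 * e) choose (e - j)) \<noteq> (0 :: 'a)"
    then have "of_nat ((p * (3 * h + 2) + h) choose (e - j)) \<noteq> (0 :: 'a)" unfolding e(2) .
    moreover have "h < p" by (simp add: p_eq)
    ultimately have "(e - j) mod p \<le> h" using choose_nz_digit_le(1) by blast
    moreover have "e - j = p * (h - 1) + (h + 1)"
      using assms(2) by (cases h) (simp_all add: e(1) j_def)
    then have "(e - j) mod p = h + 1" by (simp add: p_eq)
    ultimately show False by simp
  qed
  ultimately have "good_fun (\<lambda>x. g x ^ (e - (e - j)))"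
    by (intro good_fun_power[OF ker]) auto
  moreover have "e - (e - j) = p + (2 * h + 1)" using je by (simp add: j_def)
  ultimately show ?thesis by simp
qed

text \<open>If c were nonzero, the power p + m of g with m = 2h + 1 would be represented by G1^m G2,
  where G1 and G2 represent g and its p-th power and both have degree p + 1. The degree (m + 1)(p +
  1) of this product has last digit 2h + 2, too large for a good exponent.\<close>

lemma kernel_additive:
  assumes "\<delta> = 1" "h > 0" and ker: "kernel \<alpha> \<beta> \<epsilon> g" and g0: "g 0 = 0"
  obtains a b where "\<And>x. g x = a * x + b * x ^ p"
proof -
  obtain a b c where g: "\<And>x. g x = a * x + b * x ^ p + c * x ^ (p + 1)"
    using kernel_support[OF assms(1) ker g0] by blast
  have p3: "p \<ge> 3" by (simp add: p_eq)
  have q2: "q = p * p" using q_pow assms(1) by (simp add: power2_eq_square)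
  have "c = 0"
  proof (rule ccontr)
    assume "c \<noteq> 0"
    have dc: "degree (monom a' 1 + monom b' p + monom c' (p + 1)) = p + 1" if "c' \<noteq> 0" for a' b' c' :: 'a
    proof (subst degree_add_eq_right)
      have "degree (monom a' 1 + monom b' p) \<le> p"
        using p3 by (intro degree_add_le) (auto intro: order.trans[OF degree_monom_le])
      then show "degree (monom a' 1 + monom b' p) < degree (monom c' (p + 1))"
        using that by (simp add: degree_monom_eq)
    qed (use that in \<open>simp add: degree_monom_eq\<close>)
    \<comment> \<open>In \<open>G2\<close> the first two coefficients change places since (x^p)^p =
      x, while x^(p+1) is fixed by Frobenius.\<close>
    define G1 G2 where "G1 = monom a 1 + monom b p + monom c (p + 1)"
      and "G2 = monom (b ^ p) 1 + monom (a ^ p) p + monom (c ^ p) (p + 1)"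
    have deg: "degree G1 = p + 1" "degree G2 = p + 1"
      unfolding G1_def G2_def using \<open>c \<noteq> 0\<close> by (intro dc; simp)+
    then have nz: "G1 \<noteq> 0" "G2 \<noteq> 0" by auto
    have add: "(x + y) ^ p = x ^ p + y ^ p" for x y :: 'a
      by (rule freshmans_dream) (simp_all add: prime_p CHAR_eq)
    have xpp: "x ^ (p * p) = x" for x :: 'a using power_q[of x] q2 by simp
    have G1: "poly G1 x = g x" for x by (simp add: G1_def poly_monom g)
    have G2: "poly G2 x = g x ^ p" for x
    proof -
      have "(x * x ^ p) ^ p = x * x ^ p"
        using xpp[of x] by (simp add: power_mult_distrib power_mult[symmetric])
      then show ?thesis
        using xpp[of x] by (simp add: G2_def poly_monom g add power_mult_distrib power_mult[symmetric])
    qed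
    define m where "m = 2 * h + 1"
    have m: "(m + 1) * (p + 1) \<le> (p - 1) * (p + 1)" by (intro mult_right_mono) (auto simp: p_eq m_def)
    have "(p - 1) * (p + 1) = q - 1" using p3 by (simp add: q2 algebra_simps diff_mult_distrib2)
    have degG: "degree (G1 ^ m * G2) = (m + 1) * (p + 1)"
      using nz by (simp add: degree_mult_eq degree_power_eq deg)
    have "good ((m + 1) * (p + 1))"
    proof (rule good_fun_poly)
      have "good_fun (\<lambda>x. g x ^ (p + m))"
        using good_fun_mixed_power[OF assms(1-3)] by (simp only: m_def)
      then show "good_fun (poly (G1 ^ m * G2))"
        by (simp add: good_fun_def G1 G2 power_add mult.commute)
      show "degree (G1 ^ m * G2) \<le> q - 1"
        unfolding degG using m \<open>(p - 1) * (p + 1) = q - 1\<close> by simp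
      have "coeff (G1 ^ m * G2) (degree (G1 ^ m * G2)) \<noteq> 0" using nz by simp
      then show "coeff (G1 ^ m * G2) ((m + 1) * (p + 1)) \<noteq> 0" unfolding degG .
    qed
    from good_digit[OF this, of 0] have "(m + 1) * (p + 1) mod p \<le> m" by (simp add: m_def)
    moreover have "(m + 1) * (p + 1) = (m + 1) + p * (m + 1)" by (simp add: algebra_simps)
    then have "(m + 1) * (p + 1) mod p = m + 1"
      by (simp only: mod_mult_self2) (simp add: m_def p_eq)
    ultimately show False by simp
  qed
  then show ?thesis using that g by simp
qed

lemma minus_one_power: "w ^ (2 * e) = -1"
proof -
  have "w ^ (2 * e) \<noteq> 1" using e_pos q_eq by (auto simp: power_eq_1_iff dest: dvd_imp_le)
  moreover have "w ^ (2 * e) * w ^ (2 * e) = 1"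
    using power_q_minus_1[OF w_nz] q_eq by (simp add: power_add[symmetric])
  ultimately show ?thesis by (metis square_eq_1_iff)
qed

lemma one_neq_minus_one: "(x :: 'a) \<noteq> 0 \<Longrightarrow> x \<noteq> - x"
proof
  assume "x \<noteq> 0" "x = - x"
  then have "2 * x = 0" by (metis add.right_inverse mult_2)
  then have "of_nat 2 = (0 :: 'a)" using \<open>x \<noteq> 0\<close> by simp
  then have "p dvd 2" unfolding of_nat_eq_0_iff_char_dvd CHAR_eq .
  then have "p \<le> 2" by (rule dvd_imp_le) simp
  then show False by (simp add: p_eq)
qed

text \<open>If a or b vanishes, then f(w^2) = u f(1) with u^e = -1, so the left side of the identity
  changes sign between 1 and w^2, whereas the right side does not. Otherwise let t = x^(p-1). Then
  f(x) and its p-th power are x times linear polynomials A and B in t, and e = p h + M turns the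
  identity into t (\<alpha> A^M B^h + \<beta> A^h B^M) = \<epsilon> t^(2h+2). As h > 0, the left
  side vanishes at the root of A, but the right side does not.\<close>

lemma no_kernel_small:
  assumes "\<delta> = 1" "h > 0"
  shows "\<not> kernel \<alpha> \<beta> \<epsilon> g"
proof
  assume "kernel \<alpha> \<beta> \<epsilon> g"
  then have ker: "kernel \<alpha> \<beta> \<epsilon> (\<lambda>x. g x - g 0)" by (rule kernel_shift)
  define f where "f x = g x - g 0" for x
  have "f 0 = 0" by (simp add: f_def)
  with ker obtain a b where f: "\<And>x. f x = a * x + b * x ^ p"
    using kernel_additive[OF assms, of \<alpha> \<beta> \<epsilon> f] unfolding f_def by metis
  have \<epsilon>: "\<epsilon> \<noteq> 0" and K: "\<alpha> * f x ^ e + \<beta> * f x ^ (3 * e) = \<epsilon> * x ^ (2 * e)" for x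
  proof -
    show "\<epsilon> \<noteq> 0" using ker by (simp add: kernel_def)
    have "\<alpha> * (f x - f 0) ^ e + \<beta> * (f x - f 0) ^ (3 * e) = \<epsilon> * (x - 0) ^ (2 * e)"
      using ker unfolding f_def kernel_def by blast
    then show "\<alpha> * f x ^ e + \<beta> * f x ^ (3 * e) = \<epsilon> * x ^ (2 * e)" by (simp add: \<open>f 0 = 0\<close>)
  qed
  note e = e_digits_small[OF assms(1)]
  have q2: "q = p * p" using q_pow assms(1) by (simp add: power2_eq_square)
  have "a \<noteq> 0 \<and> b \<noteq> 0"
  proof (rule ccontr)
    assume "\<not> (a \<noteq> 0 \<and> b \<noteq> 0)"
    then consider "a = 0" | "b = 0" by blast
    then obtain u where u: "f (w ^ 2) = u * f 1" "u ^ e = -1"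
    proof cases
      case 1
      have "odd p" by (simp add: p_eq)
      have "(w ^ (2 * p)) ^ e = (w ^ (2 * e)) ^ p" by (simp add: power_mult[symmetric] mult_ac)
      then have "(w ^ (2 * p)) ^ e = -1" using \<open>odd p\<close> by (simp add: minus_one_power)
      moreover have "f (w ^ 2) = w ^ (2 * p) * f 1" using 1 by (simp add: f power_mult)
      ultimately show ?thesis using that by blast
    next
      case 2
      then show ?thesis using that[of "w ^ 2"] minus_one_power by (simp add: f power_mult)
    qed
    then have "f (w ^ 2) ^ e = - (f 1 ^ e)" "f (w ^ 2) ^ (3 * e) = - (f 1 ^ (3 * e))"
      by (simp_all add: power_mult_distrib mult.commute[of 3] power_mult)
    moreover have "(w ^ 2) ^ (2 * e) = 1"
    proof -
      have "(w ^ 2) ^ (2 * e) = (w ^ (2 * e)) ^ 2" by (simp add: power_mult[symmetric] mult_ac)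
      then show ?thesis by (simp add: minus_one_power)
    qed
    ultimately have "\<epsilon> = - (\<alpha> * f 1 ^ e + \<beta> * f 1 ^ (3 * e))" using K[of "w ^ 2"] by simp
    also have "\<dots> = - \<epsilon>" using K[of 1] by simp
    finally have "\<epsilon> = - \<epsilon>" .
    then show False using one_neq_minus_one[OF \<epsilon>] by simp
  qed
  then have a: "a \<noteq> 0" and b: "b \<noteq> 0" by auto
  define M where "M = 3 * h + 2"
  define A B where "A = [:a, b:]" and "B = [:b ^ p, a ^ p:]"
  define L where "L = [:0, 1:] * (smult \<alpha> (A ^ M * B ^ h) + smult \<beta> (A ^ h * B ^ M))"
  have id: "poly L (x ^ (p - 1)) = poly (monom \<epsilon> (2 * h + 2)) (x ^ (p - 1))" if "x \<noteq> 0" for x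
  proof -
    define t where "t = x ^ (p - 1)"
    have xp: "x ^ p = x * t" using prime_gt_0_nat[OF prime_p] by (simp add: t_def power_eq_if)
    have fx: "f x = x * poly A t" by (simp add: f xp A_def algebra_simps)
    have "(x ^ p) ^ p = x" using power_q[of x] q2 by (simp add: power_mult)
    then have fp: "f x ^ p = x * poly B t"
      unfolding f B_def
      by (subst freshmans_dream) (simp_all add: prime_p CHAR_eq power_mult_distrib xp[symmetric], simp add: xp algebra_simps)
    have t: "x ^ h * x ^ M = t" by (simp add: t_def M_def p_eq power_add[symmetric])
    have "f x ^ e = (f x ^ p) ^ h * f x ^ M"
      unfolding e(1) M_def[symmetric] by (simp only: power_add power_mult)
    also have "\<dots> = (x ^ h * x ^ M) * (poly A t ^ M * poly B t ^ h)"
      by (simp only: fp) (simp add: fx power_mult_distrib mult_ac)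
    finally have 1: "f x ^ e = t * (poly A t ^ M * poly B t ^ h)" unfolding t .
    have "f x ^ (3 * e) = (f x ^ p) ^ M * f x ^ h"
      unfolding e(2) M_def[symmetric] by (simp only: power_add power_mult)
    also have "\<dots> = (x ^ h * x ^ M) * (poly A t ^ h * poly B t ^ M)"
      by (simp only: fp) (simp add: fx power_mult_distrib mult_ac)
    finally have 3: "f x ^ (3 * e) = t * (poly A t ^ h * poly B t ^ M)" unfolding t .
    have "2 * e = (p - 1) * (2 * h + 2)" by (simp add: e(1) p_eq algebra_simps)
    then have 2: "x ^ (2 * e) = t ^ (2 * h + 2)" by (simp only: t_def power_mult)
    show ?thesis
      using K[of x] unfolding 1 2 3 t_def[symmetric] by (simp add: L_def poly_monom algebra_simps)
  qed
  \<comment> \<open>The values t = (w^k)^(p-1) with k <= p are p + 1 distinct points, one more than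
    the bound p on both degrees.\<close>
  have "L = monom \<epsilon> (2 * h + 2)"
  proof (rule poly_eqI_degree[of "(\<lambda>k. (w ^ k) ^ (p - 1)) ` {..<p + 1}"])
    have "inj_on (\<lambda>k. (w ^ k) ^ (p - 1)) {..<p + 1}"
    proof (rule inj_onI)
      fix i j assume ij: "i \<in> {..<p + 1}" "j \<in> {..<p + 1}" "(w ^ i) ^ (p - 1) = (w ^ j) ^ (p - 1)"
      have q1: "q - 1 = (p + 1) * (p - 1)" unfolding q2 by (simp add: p_eq algebra_simps)
      have "[i * (p - 1) = j * (p - 1)] (mod (q - 1))"
        using ij(3) by (simp only: power_mult[symmetric] power_eq_iff)
      moreover have "i * (p - 1) < q - 1" "j * (p - 1) < q - 1"
        unfolding q1 using ij(1,2) p_eq by (intro mult_strict_right_mono; simp)+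
      ultimately have "i * (p - 1) = j * (p - 1)" by (rule cong_less_modulus_unique_nat)
      moreover have "p - 1 \<noteq> 0" by (simp add: p_eq)
      ultimately show "i = j" by (metis mult_cancel2)
    qed
    then have card: "card ((\<lambda>k. (w ^ k) ^ (p - 1)) ` {..<p + 1}) = p + 1" by (simp add: card_image)
    have dAB: "degree (A ^ i * B ^ j) \<le> i + j" for i j
    proof -
      have "degree A \<le> 1" "degree B \<le> 1" by (simp_all add: A_def B_def)
      then have "degree A * i \<le> 1 * i" "degree B * j \<le> 1 * j" by (intro mult_right_mono; simp)+
      then show ?thesis
        using degree_mult_le[of "A ^ i" "B ^ j"] degree_power_le[of A i] degree_power_le[of B j] by linarith
    qed
    have "degree (smult \<alpha> (A ^ M * B ^ h) + smult \<beta> (A ^ h * B ^ M)) \<le> M + h"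
      using dAB[of M h] dAB[of h M]
      by (intro degree_add_le) (auto intro: order.trans[OF degree_smult_le])
    then have "degree L \<le> 1 + (M + h)"
      unfolding L_def by (intro order.trans[OF degree_mult_le]) simp
    then show "degree L < card ((\<lambda>k. (w ^ k) ^ (p - 1)) ` {..<p + 1})"
      unfolding card by (simp add: M_def p_eq)
    show "degree (monom \<epsilon> (2 * h + 2)) < card ((\<lambda>k. (w ^ k) ^ (p - 1)) ` {..<p + 1})"
      unfolding card by (rule le_less_trans[OF degree_monom_le]) (simp add: p_eq)
    show "poly L x = poly (monom \<epsilon> (2 * h + 2)) x" if "x \<in> (\<lambda>k. (w ^ k) ^ (p - 1)) ` {..<p + 1}" for x
      using that id by auto
  qed
  moreover have "poly A (- a / b) = 0" using b by (simp add: A_def)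
  then have "poly L (- a / b) = 0"
    using assms(2) by (simp add: L_def M_def zero_power)
  moreover have "poly (monom \<epsilon> (2 * h + 2)) (- a / b) \<noteq> 0" using \<epsilon> a b by (simp add: poly_monom)
  ultimately show False by metis
qed

theorem no_kernel:
  assumes "q \<noteq> 9"
  shows "\<not> kernel \<alpha> \<beta> \<epsilon> g"
proof (cases "\<delta> = 1")
  case True
  have "h \<noteq> 0"
  proof
    assume "h = 0"
    then have "q = 9" using q_pow True by (simp add: p_eq)
    with assms show False ..
  qed
  with True show ?thesis by (intro no_kernel_small) auto
next
  case False
  with \<delta>_pos show ?thesis by (intro no_kernel_large) auto
qed

end

section \<open>Schemes of permutation groups\<close>

lemma Sym_carrier: "f \<in> carrier Sym \<longleftrightarrow> bij f"
  by (auto simp: BijGroup_def Bij_def)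

lemma Sym_mult: "bij f \<Longrightarrow> bij g \<Longrightarrow> f \<otimes>\<^bsub>Sym\<^esub> g = f \<circ> g"
  by (auto simp: BijGroup_def Bij_def compose_def)

lemma Sym_one: "\<one>\<^bsub>Sym\<^esub> = id"
  by (auto simp: BijGroup_def)

text \<open>Finiteness supplies the inverses: right composition with f maps S injectively, hence
  onto itself, so some h in S composes with f to the identity.\<close>

lemma subgroup_SymI:
  fixes S :: "('a::finite \<Rightarrow> 'a) set"
  assumes "id \<in> S" and comp: "\<And>f g. f \<in> S \<Longrightarrow> g \<in> S \<Longrightarrow> f \<circ> g \<in> S"
    and bij: "\<And>f. f \<in> S \<Longrightarrow> bij f"
  shows "subgroup S Sym"
proof -
  interpret S: group "Sym :: ('a \<Rightarrow> 'a) monoid" by (rule group_BijGroup)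
  show ?thesis
  proof
    fix f assume f: "f \<in> S"
    have "inj_on (\<lambda>h. h \<circ> f) S"
      using bij_is_surj[OF bij[OF f]] by (intro inj_onI) (metis comp_apply ext surjD)
    then have "(\<lambda>h. h \<circ> f) ` S = S"
      using comp[OF _ f] by (intro endo_inj_surj) auto
    then obtain h where h: "h \<in> S" "h \<circ> f = id" using assms(1) by (metis imageE)
    then have "inv\<^bsub>Sym\<^esub> f = h"
      using bij f by (intro S.inv_equality) (simp_all add: Sym_carrier Sym_mult Sym_one)
    then show "inv\<^bsub>Sym\<^esub> f \<in> S" using h by simp
  qed (use assms in \<open>auto simp: Sym_carrier Sym_mult Sym_one\<close>)
qed

lemma generate_Sym_subset:
  assumes "A \<subseteq> S" "subgroup S Sym"
  shows "generate Sym A \<subseteq> S"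
  by (rule group.generate_subgroup_incl[OF group_BijGroup assms])

lemma generate_Sym_comp:
  assumes "\<And>f. f \<in> A \<Longrightarrow> bij f" "f \<in> generate Sym A" "g \<in> generate Sym A"
  shows "f \<circ> g \<in> generate Sym A"
proof -
  have "A \<subseteq> carrier Sym" using assms(1) by (auto simp: Sym_carrier)
  then have "bij f" "bij g"
    using group.generate_in_carrier[OF group_BijGroup] assms(2,3) Sym_carrier by blast+
  then show ?thesis using generate.eng[OF assms(2,3)] by (simp add: Sym_mult)
qed

lemma id_in_generate_Sym: "id \<in> generate Sym A"
  using generate.one[of Sym A] by (simp add: Sym_one)

lemma map_prod_inv_image:
  assumes "bij f"
  shows "map_prod (inv_into UNIV f) (inv_into UNIV f) ` map_prod f f ` R = R"
    "map_prod f f ` map_prod (inv_into UNIV f) (inv_into UNIV f) ` R = R"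
proof -
  have "map_prod (inv_into UNIV f) (inv_into UNIV f) (map_prod f f z) = z"
    "map_prod f f (map_prod (inv_into UNIV f) (inv_into UNIV f) z) = z" for z
    using assms by (cases z; simp add: bij_is_inj bij_is_surj surj_f_inv_f)+
  then show "map_prod (inv_into UNIV f) (inv_into UNIV f) ` map_prod f f ` R = R"
    "map_prod f f ` map_prod (inv_into UNIV f) (inv_into UNIV f) ` R = R"
    by (simp_all add: image_image)
qed

lemma scheme_iso_refl: "scheme_iso X X"
  unfolding scheme_iso_def by (rule exI[of _ id]) (simp add: map_prod.id)

lemma scheme_iso_sym: "scheme_iso X Y \<Longrightarrow> scheme_iso Y X"
proof -
  assume "scheme_iso X Y"
  then obtain f where f: "bij f" "(\<lambda>R. map_prod f f ` R) ` X = Y" by (auto simp: scheme_iso_def)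
  have "(\<lambda>R. map_prod (inv_into UNIV f) (inv_into UNIV f) ` R) ` Y = X"
  proof -
    have "(\<lambda>R. map_prod (inv_into UNIV f) (inv_into UNIV f) ` R) ` ((\<lambda>R. map_prod f f ` R) ` X)
        = (\<lambda>R. map_prod (inv_into UNIV f) (inv_into UNIV f) ` map_prod f f ` R) ` X"
      by (rule image_image)
    then show ?thesis by (simp only: f(2) map_prod_inv_image[OF f(1)] image_ident)
  qed
  then show ?thesis using bij_imp_bij_inv[OF f(1)] unfolding scheme_iso_def by blast
qed

lemma bij_map_prod_Id:
  fixes f :: "'a \<Rightarrow> 'a"
  shows "bij f \<Longrightarrow> map_prod f f ` R = Id \<longleftrightarrow> R = Id"
proof
  assume f: "bij f"
  have *: "map_prod g g ` Id = Id" if "surj g" for g :: "'a \<Rightarrow> 'a"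
  proof -
    have "map_prod g g ` Id = (\<lambda>x. (x, x)) ` range g" by (auto simp: Id_def image_iff)
    then show ?thesis using that by auto
  qed
  show "map_prod f f ` R = Id" if "R = Id" unfolding that by (rule *[OF bij_is_surj[OF f]])
  show "R = Id" if "map_prod f f ` R = Id"
    using map_prod_inv_image(1)[OF f, of R] *[OF bij_is_surj[OF bij_imp_bij_inv[OF f]]] that by simp
qed

lemma inj_map_prod_image: "inj f \<Longrightarrow> inj (\<lambda>R. map_prod f f ` R)"
  by (rule injI) (simp add: inj_image_eq_iff prod.inj_map)

lemma scheme_iso_card: "scheme_iso X Y \<Longrightarrow> card X = card Y"
  unfolding scheme_iso_def
  by (metis bij_is_inj card_image inj_map_prod_image inj_on_subset subset_UNIV)

text \<open>The sizes are the valencies times the number of points. \<open>Id\<close> is removed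
  since its valency 1 would always be the least.\<close>

lemma scheme_iso_valencies:
  assumes "scheme_iso X Y"
  shows "card ` (X - {Id}) = card ` (Y - {Id})"
proof -
  obtain f where f: "bij f" "(\<lambda>R. map_prod f f ` R) ` X = Y"
    using assms by (auto simp: scheme_iso_def)
  have "card (map_prod f f ` R) = card R" for R
    using f(1) by (intro card_image inj_on_subset[OF prod.inj_map]) (auto simp: bij_is_inj)
  moreover have "Y - {Id} = (\<lambda>R. map_prod f f ` R) ` (X - {Id})"
    unfolding f(2)[symmetric] using bij_map_prod_Id[OF f(1)] by (auto simp: image_iff)
  ultimately show ?thesis by (simp add: image_image)
qed

definition conj_set :: "('a \<Rightarrow> 'a) \<Rightarrow> ('a \<Rightarrow> 'a) set \<Rightarrow> ('a \<Rightarrow> 'a) set" where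
  "conj_set f G = (\<lambda>g. f \<circ> g \<circ> inv_into UNIV f) ` G"

lemma conj_set_inv:
  assumes "bij f"
  shows "conj_set (inv_into UNIV f) (conj_set f G) = G"
proof -
  have "inv_into UNIV f \<circ> (f \<circ> g \<circ> inv_into UNIV f) \<circ> inv_into UNIV (inv_into UNIV f) = g" for g
    using assms by (simp add: fun_eq_iff inv_inv_eq bij_is_inj)
  then show ?thesis by (simp add: conj_set_def image_image)
qed

lemma Inv_conj_set:
  assumes "bij f"
  shows "Inv (conj_set f G) = (\<lambda>R. map_prod f f ` R) ` Inv G"
proof -
  have *: "{(g x, g y) |g. g \<in> conj_set f G} = map_prod f f ` {(g (inv_into UNIV f x), g (inv_into UNIV f y)) |g. g \<in> G}" for x y
    by (fastforce simp: conj_set_def)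
  show ?thesis
  proof (intro equalityI subsetI)
    fix R assume "R \<in> Inv (conj_set f G)"
    then obtain x y where "R = {(g x, g y) |g. g \<in> conj_set f G}" unfolding Inv_eq by auto
    then show "R \<in> (\<lambda>R. map_prod f f ` R) ` Inv G" unfolding * Inv_eq by blast
  next
    fix R assume "R \<in> (\<lambda>R. map_prod f f ` R) ` Inv G"
    then obtain x y where "R = map_prod f f ` {(g x, g y) |g. g \<in> G}" unfolding Inv_eq by auto
    then have "R = {(g (f x), g (f y)) |g. g \<in> conj_set f G}"
      unfolding * using assms by (simp add: bij_is_inj)
    then show "R \<in> Inv (conj_set f G)" unfolding Inv_eq by blast
  qed
qed

lemma scheme_iso_conj_set: "bij f \<Longrightarrow> scheme_iso (Inv G) (Inv (conj_set f G))"
  unfolding scheme_iso_def using Inv_conj_set by metis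

text \<open>Enlarging the group fuses basis relations and so moves down in the order of schemes;
  this is how minimality gets applied.\<close>

lemma scheme_le_Inv:
  assumes "subgroup G1 Sym" "subgroup G2 Sym" "G1 \<subseteq> G2"
  shows "scheme_le (Inv G2) (Inv G1)"
  unfolding scheme_le_def
proof
  fix R assume "R \<in> Inv G2"
  then obtain x y where R: "R = {(g x, g y) |g. g \<in> G2}" unfolding Inv_eq by auto
  define S where "S = {{(g (k x), g (k y)) |g. g \<in> G1} | k. k \<in> G2}"
  have "\<Union> S = R"
  proof (intro equalityI subsetI)
    fix z assume "z \<in> \<Union> S"
    then obtain g k where "z = (g (k x), g (k y))" "g \<in> G1" "k \<in> G2" unfolding S_def by auto
    then have "z = ((g \<circ> k) x, (g \<circ> k) y)" "g \<circ> k \<in> G2"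
      using subgroup_SymD(3)[OF assms(2)] assms(3) by auto
    then show "z \<in> R" unfolding R by blast
  next
    fix z assume "z \<in> R"
    then obtain k where "z = (id (k x), id (k y))" "k \<in> G2" unfolding R by auto
    then show "z \<in> \<Union> S" using subgroup_SymD(1)[OF assms(1)] unfolding S_def by blast
  qed
  moreover have "S \<subseteq> Inv G1" unfolding S_def Inv_eq by blast
  ultimately show "\<exists>S\<subseteq>Inv G1. R = \<Union> S" by blast
qed

section \<open>Translation-invariant relations and the orbits of the stabilizer\<close>

definition diff_rel :: "'a::ab_group_add set \<Rightarrow> ('a \<times> 'a) set" where
  "diff_rel S = {(x, y). y - x \<in> S}"

definition orb :: "('a \<Rightarrow> 'a) set \<Rightarrow> 'a \<Rightarrow> 'a set" where
  "orb H z = (\<lambda>h. h z) ` H"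

lemma diff_rel_eq_iff: "diff_rel S = diff_rel T \<longleftrightarrow> S = T"
proof
  assume eq: "diff_rel S = diff_rel T"
  show "S = T"
  proof (rule Set.set_eqI)
    fix z
    have "(0, z) \<in> diff_rel S \<longleftrightarrow> (0, z) \<in> diff_rel T" by (simp only: eq)
    then show "z \<in> S \<longleftrightarrow> z \<in> T" by (simp add: diff_rel_def)
  qed
qed simp

lemma Id_eq_diff_rel: "Id = diff_rel {0}"
  by (auto simp: diff_rel_def)

lemma card_diff_rel: "card (diff_rel (S :: 'a::{ab_group_add,finite} set)) = CARD('a) * card S"
proof -
  have "diff_rel S = (\<lambda>(x, z). (x, x + z)) ` (UNIV \<times> S)"
  proof (intro equalityI subsetI)
    fix u assume "u \<in> diff_rel S"
    then have "u = (\<lambda>(x, z). (x, x + z)) (fst u, snd u - fst u)" "snd u - fst u \<in> S"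
      by (auto simp: diff_rel_def)
    then show "u \<in> (\<lambda>(x, z). (x, x + z)) ` (UNIV \<times> S)" by blast
  qed (auto simp: diff_rel_def)
  moreover have "inj_on (\<lambda>(x, z). (x, x + z)) (UNIV \<times> S)" by (auto simp: inj_on_def)
  ultimately show ?thesis by (simp add: card_image card_cartesian_product)
qed

lemma semidirect_translations_eq:
  assumes "\<And>h. h \<in> H \<Longrightarrow> bij h"
  shows "semidirect_translations H = {\<lambda>x. h x + b | h b. h \<in> H}"
proof -
  have t: "bij (\<lambda>x. x + b)" for b :: 'a
    by (rule bij_betwI[where g = "\<lambda>x. x - b"]) auto
  have mult: "(\<lambda>x. x + b) \<otimes>\<^bsub>Sym\<^esub> h = (\<lambda>x. h x + b)" if "h \<in> H" for h b
    using Sym_mult[OF t assms[OF that]] by (simp add: comp_def)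
  show ?thesis
  proof (intro equalityI subsetI)
    fix f assume "f \<in> semidirect_translations H"
    then obtain b h where "h \<in> H" "f = (\<lambda>x. x + b) \<otimes>\<^bsub>Sym\<^esub> h"
      unfolding semidirect_translations_def translation_group_def set_mult_def by blast
    then show "f \<in> {\<lambda>x. h x + b | h b. h \<in> H}" using mult by blast
  next
    fix f assume "f \<in> {\<lambda>x. h x + b | h b. h \<in> H}"
    then obtain b h where "h \<in> H" "f = (\<lambda>x. h x + b)" by blast
    then have "h \<in> H" "f = (\<lambda>x. x + b) \<otimes>\<^bsub>Sym\<^esub> h" using mult by simp_all
    then show "f \<in> semidirect_translations H"
      unfolding semidirect_translations_def translation_group_def set_mult_def by blast
  qed
qed

text \<open>\<open>H\<close> stands for the stabilizer of 0. Additivity makes it normalize the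
  translations, so that its product with them is again a group.\<close>

locale additive_group =
  fixes H :: "('a::finite_field \<Rightarrow> 'a) set"
  assumes subgroup_H: "subgroup H Sym" and additive: "\<And>h x y. h \<in> H \<Longrightarrow> h (x + y) = h x + h y"
begin

lemmas H_id = subgroup_SymD(1)[OF subgroup_H]
  and H_bij = subgroup_SymD(2)[OF subgroup_H]
  and H_comp = subgroup_SymD(3)[OF subgroup_H]
  and H_inv = subgroup_SymD(4)[OF subgroup_H]

lemma H_diff: "h \<in> H \<Longrightarrow> h (x - y) = h x - h y"
  using additive[of h "x - y" y] by simp

lemma H_zero: "h \<in> H \<Longrightarrow> h 0 = 0"
  using H_diff[of h 0 0] by simp

lemma semidirect_eq: "semidirect_translations H = {\<lambda>x. h x + b | h b. h \<in> H}"
  using H_bij by (rule semidirect_translations_eq)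

lemma translations_subset: "translation_group \<subseteq> semidirect_translations H"
  proof
  fix f :: "'a \<Rightarrow> 'a" assume "f \<in> translation_group"
  then obtain b where "f = (\<lambda>x. id x + b)" unfolding translation_group_def by auto
  then show "f \<in> semidirect_translations H" unfolding semidirect_eq using H_id by blast
qed

lemma subgroup_semidirect: "subgroup (semidirect_translations H) Sym"
proof (rule subgroup_SymI)
  show "id \<in> semidirect_translations H"
    using translations_subset unfolding translation_group_def by (force simp: id_def)
  fix f assume f: "f \<in> semidirect_translations H"
  then obtain h b where h: "h \<in> H" "f = (\<lambda>x. h x + b)" unfolding semidirect_eq by auto
  have "bij (\<lambda>x. x + b)" by (rule bij_betwI[where g = "\<lambda>x. x - b"]) auto
  then show "bij f" using bij_comp[OF H_bij[OF h(1)]] by (simp add: h(2) comp_def)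
  fix g assume "g \<in> semidirect_translations H"
  then obtain k c where k: "k \<in> H" "g = (\<lambda>x. k x + c)" unfolding semidirect_eq by auto
  have "f \<circ> g = (\<lambda>x. (h \<circ> k) x + (h c + b))" using h k by (simp add: fun_eq_iff additive)
  then show "f \<circ> g \<in> semidirect_translations H"
    unfolding semidirect_eq using H_comp[OF h(1) k(1)] by blast
qed

text \<open>By additivity, an element h x + b acts on the difference y - x through h alone, and
  translations move the first point anywhere. So the basis relations are the Cayley relations of the
  orbits of H.\<close>

lemma Inv_semidirect: "Inv (semidirect_translations H) = range (\<lambda>z. diff_rel (orb H z))"
proof -
  have *: "{(g x, g y) |g. g \<in> semidirect_translations H} = diff_rel (orb H (y - x))" for x y
  proof (intro equalityI subsetI)
    fix z assume "z \<in> {(g x, g y) |g. g \<in> semidirect_translations H}"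
    then obtain h b where "h \<in> H" "z = (h x + b, h y + b)" unfolding semidirect_eq by auto
    then show "z \<in> diff_rel (orb H (y - x))" by (auto simp: diff_rel_def orb_def H_diff)
  next
    fix z assume "z \<in> diff_rel (orb H (y - x))"
    then obtain h where h: "h \<in> H" "snd z - fst z = h y - h x"
      by (auto simp: diff_rel_def orb_def H_diff)
    define b where "b = fst z - h x"
    have "snd z = h y - h x + fst z" using h(2) by (metis diff_add_cancel)
    then have "h y + b = snd z" by (simp add: b_def)
    then have "z = (h x + b, h y + b)" by (simp add: b_def prod_eq_iff)
    moreover define g where "g = (\<lambda>x. h x + b)"
    moreover have "g \<in> semidirect_translations H"
      unfolding semidirect_eq g_def using h(1) by blast
    ultimately have "z = (g x, g y)" "g \<in> semidirect_translations H" by simp_all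
    then show "z \<in> {(g x, g y) |g. g \<in> semidirect_translations H}" by blast
  qed
  show ?thesis
  proof (intro equalityI subsetI)
    fix R assume "R \<in> range (\<lambda>z. diff_rel (orb H z))"
    then obtain z where "R = diff_rel (orb H (z - 0))" by auto
    then show "R \<in> Inv (semidirect_translations H)" unfolding Inv_eq * by blast
  next
    fix R assume "R \<in> Inv (semidirect_translations H)"
    then show "R \<in> range (\<lambda>z. diff_rel (orb H z))" unfolding Inv_eq * by blast
  qed
qed

lemma orb_self: "z \<in> orb H z"
proof -
  have "id z \<in> orb H z" unfolding orb_def using H_id by (rule imageI)
  then show ?thesis by simp
qed

lemma orb_eq: "z \<in> orb H x \<Longrightarrow> orb H z = orb H x"
proof -
  have sub: "orb H z \<subseteq> orb H x" if "z \<in> orb H x" for x z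
  proof
    fix y assume "y \<in> orb H z"
    with that obtain h k where "h \<in> H" "k \<in> H" "y = (k \<circ> h) x" unfolding orb_def by auto
    then show "y \<in> orb H x" using H_comp unfolding orb_def by blast
  qed
  assume z: "z \<in> orb H x"
  then obtain h where h: "h \<in> H" "z = h x" by (auto simp: orb_def)
  obtain k where "k \<in> H" "k \<circ> h = id" using H_inv[OF h(1)] by blast
  then have "x = k z" using h(2) by (simp add: fun_eq_iff)
  then have "x \<in> orb H z" using \<open>k \<in> H\<close> by (simp add: orb_def)
  then show ?thesis using sub z by blast
qed

lemma orb_0: "orb H 0 = {0}"
proof -
  have "orb H 0 = (\<lambda>h. 0) ` H" unfolding orb_def by (rule image_cong) (simp_all add: H_zero)
  then show ?thesis using H_id by auto
qed

lemma orb_eq_0_iff: "orb H z = {0} \<longleftrightarrow> z = 0"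
proof
  assume "orb H z = {0}"
  then show "z = 0" using orb_self[of z] by simp
qed (simp add: orb_0)

lemma Inv_minus_Id: "Inv (semidirect_translations H) - {Id} = (\<lambda>z. diff_rel (orb H z)) ` (UNIV - {0})"
proof -
  have "diff_rel (orb H z) = Id \<longleftrightarrow> z = 0" for z
    by (simp add: Id_eq_diff_rel diff_rel_eq_iff orb_eq_0_iff)
  then show ?thesis unfolding Inv_semidirect by blast
qed

lemma nontrivial_Inv:
  assumes "x \<noteq> 0" "y \<noteq> 0" "y \<notin> orb H x"
  shows "\<not> trivial_scheme (Inv (semidirect_translations H))"
proof -
  have "orb H x \<noteq> orb H y" using orb_self[of y] assms(3) by auto
  then have "card {diff_rel (orb H 0), diff_rel (orb H x), diff_rel (orb H y)} = 3"
    using assms by (simp add: diff_rel_eq_iff orb_0 orb_eq_0_iff eq_commute[of "{0}"])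
  moreover have "card {diff_rel (orb H 0), diff_rel (orb H x), diff_rel (orb H y)}
      \<le> card (Inv (semidirect_translations H))"
    unfolding Inv_semidirect by (intro card_mono) auto
  ultimately show ?thesis by (simp add: trivial_scheme_def)
qed

end

section \<open>The Hull-Dobell criterion\<close>

text \<open>\<open>e * geom_sum u k\<close> is the k-th iterate at 0 of the affine map sending x to
  u x + e.\<close>

definition geom_sum :: "nat \<Rightarrow> nat \<Rightarrow> nat" where
  "geom_sum u k = (\<Sum>i<k. u ^ i)"

lemma geom_sum_0 [simp]: "geom_sum u 0 = 0"
  by (simp add: geom_sum_def)

lemma geom_sum_Suc: "geom_sum u (Suc k) = 1 + u * geom_sum u k"
  unfolding geom_sum_def sum.lessThan_Suc_shift by (simp add: sum_distrib_left)

lemma geom_sum_add: "geom_sum u (k + l) = geom_sum u k + u ^ k * geom_sum u l"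
  by (induction k) (simp_all add: geom_sum_Suc algebra_simps)

lemma geom_sum_mult: "geom_sum u (k * r) = geom_sum u k * geom_sum (u ^ k) r"
proof (induction r)
  case (Suc r)
  have "geom_sum u (k * Suc r) = geom_sum u k + u ^ k * geom_sum u (k * r)"
    by (simp add: geom_sum_add)
  then show ?case by (simp add: Suc geom_sum_Suc algebra_simps)
qed simp

lemma geom_sum_power: "u ^ k = (u - 1) * geom_sum u k + 1" if "u > 0"
proof (induction k)
  case (Suc k)
  obtain v where "u = v + 1" using \<open>u > 0\<close> by (metis Suc_eq_plus1 gr0_implies_Suc)
  then show ?case using Suc by (simp add: geom_sum_Suc algebra_simps)
qed simp

text \<open>In (1 + r z)^i all terms beyond the linear one carry the factor r^2.\<close>

lemma geom_sum_cong_square: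
  "[geom_sum (1 + r * z) k = k + r * z * (\<Sum>i<k. i)] (mod r ^ 2)"
proof -
  have "[(1 + r * z) ^ i = 1 + i * (r * z)] (mod r ^ 2)" for i
  proof (induction i)
    case (Suc i)
    have "[(1 + r * z) ^ Suc i = (1 + r * z) * (1 + i * (r * z))] (mod r ^ 2)"
      unfolding power_Suc using Suc by (rule cong_scalar_left)
    also have "(1 + r * z) * (1 + i * (r * z)) = (1 + Suc i * (r * z)) + r ^ 2 * (i * z ^ 2)"
      by (simp add: algebra_simps power2_eq_square)
    also have "[(1 + Suc i * (r * z)) + r ^ 2 * (i * z ^ 2) = 1 + Suc i * (r * z)] (mod r ^ 2)"
      by (simp add: cong_def)
    finally show ?case .
  qed simp
  then have "[geom_sum (1 + r * z) k = (\<Sum>i<k. 1 + i * (r * z))] (mod r ^ 2)"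
    unfolding geom_sum_def by (intro cong_sum)
  moreover have "(\<Sum>i<k. 1 + i * (r * z)) = k + r * z * (\<Sum>i<k. i)"
    by (induction k) (simp_all add: distrib_left mult.commute mult.left_commute)
  ultimately show ?thesis by simp
qed

text \<open>With u = 1 + r z the sum is r + r z r (r - 1)/2 modulo r^2. For odd r the second term
  vanishes because r divides r (r - 1)/2; for r = 2 it is 2 z, and z is even because 4 divides u -
  1. So the sum is r modulo r^2.\<close>

lemma geom_sum_prime:
  assumes r: "prime r" and u: "u > 0" "r dvd u - 1" and 4: "r = 2 \<Longrightarrow> 4 dvd u - 1"
  obtains t where "geom_sum u r = r * t" "\<not> r dvd t"
proof -
  obtain z where z: "u = 1 + r * z" using u by (metis dvdE Suc_eq_plus1_left Suc_pred')
  have c: "[geom_sum u r = r + r * z * (\<Sum>i<r. i)] (mod r ^ 2)"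
    unfolding z by (rule geom_sum_cong_square)
  have "r dvd z * (\<Sum>i<r. i)"
  proof (cases "r = 2")
    case True
    then have "4 dvd 2 * z" using 4 z by simp
    then have "2 dvd z" by (auto simp: dvd_def)
    then show ?thesis using True by simp
  next
    case False
    then have "odd r" using r primes_dvd_imp_eq[OF two_is_prime_nat r] by auto
    then obtain t where t: "r = 2 * t + 1" by (elim oddE)
    have "2 * (\<Sum>i<r. i) = (r - 1) * r" using r
      by (simp add: Sum_Ico_nat lessThan_atLeast0 t)
    then have "(\<Sum>i<r. i) = r * t" by (simp add: t)
    then show ?thesis by simp
  qed
  then obtain y where "z * (\<Sum>i<r. i) = r * y" by auto
  then have "[geom_sum u r = r + r ^ 2 * y] (mod r ^ 2)"
    using c by (simp add: mult.assoc power2_eq_square)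
  then have c': "[geom_sum u r = r] (mod r ^ 2)" by (simp add: cong_def)
  then have "[geom_sum u r = r] (mod r)" by (rule cong_dvd_modulus_nat) (simp add: power2_eq_square)
  then have "r dvd geom_sum u r" by (simp add: cong_dvd_iff)
  then obtain t where t: "geom_sum u r = r * t" by auto
  moreover have "\<not> r dvd t"
  proof
    assume "r dvd t"
    then have "r ^ 2 dvd geom_sum u r" by (auto simp: t power2_eq_square)
    then have "r ^ 2 dvd r" using c' by (simp add: cong_dvd_iff)
    then have "r ^ 2 \<le> r" using prime_gt_0_nat[OF r] by (rule dvd_imp_le)
    then show False using prime_gt_1_nat[OF r] by (simp add: power2_eq_square)
  qed
  ultimately show ?thesis by (rule that)
qed

text \<open>Modulo r the sum equals k, so k = k' r. The sum then factors into
  \<open>geom_sum u k'\<close> and a geometric sum of length r in u^k', which contains r exactly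
  once. Thus each factor r of the sum is matched by one of k.\<close>

lemma prime_power_dvd_geom_sum:
  assumes r: "prime r" and u: "u > 0" "r dvd u - 1" and 4: "r = 2 \<Longrightarrow> v \<ge> 2 \<Longrightarrow> 4 dvd u - 1"
    and "r ^ v dvd geom_sum u k"
  shows "r ^ v dvd k"
  using 4 assms(5)
proof (induction v arbitrary: k)
  case (Suc v)
  have "[u = 1] (mod r)" using u by (simp add: cong_altdef_nat)
  then have "[u ^ i = 1 ^ i] (mod r)" for i by (rule cong_pow)
  then have "[geom_sum u k = (\<Sum>i<k. 1 ^ i)] (mod r)"
    unfolding geom_sum_def by (rule cong_sum)
  moreover have "r dvd geom_sum u k" using dvd_trans[OF _ Suc.prems(2), of r] by simp
  ultimately have "r dvd k" by (simp add: cong_dvd_iff)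
  define k' where "k' = k div r"
  have k': "k = k' * r" using \<open>r dvd k\<close> by (simp add: k'_def)
  show ?case
  proof (cases "v = 0")
    case True
    then show ?thesis using \<open>r dvd k\<close> by simp
  next
    case False
    have "u ^ k' - 1 = (u - 1) * geom_sum u k'"
      using geom_sum_power[OF u(1), of k'] by simp
    then have dvd_pow: "m dvd u ^ k' - 1" if "m dvd u - 1" for m
      using that by simp
    obtain t where t: "geom_sum (u ^ k') r = r * t" "\<not> r dvd t"
    proof (rule geom_sum_prime[OF r])
      show "u ^ k' > 0" using u(1) by simp
      show "r dvd u ^ k' - 1" using u(2) by (rule dvd_pow)
      show "4 dvd u ^ k' - 1" if "r = 2" using that Suc.prems(1) False by (intro dvd_pow) simp
    qed
    have "geom_sum u k = r * (geom_sum u k' * t)"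
      unfolding k' geom_sum_mult t(1) by (simp only: mult_ac)
    then have "r * r ^ v dvd r * (geom_sum u k' * t)"
      using Suc.prems(2) by simp
    then have "r ^ v dvd geom_sum u k' * t"
      by (rule nat_mult_dvd_cancel1[OF prime_gt_0_nat[OF r], THEN iffD1])
    moreover have "coprime (r ^ v) t" using prime_imp_coprime[OF r t(2)] by simp
    ultimately have "r ^ v dvd geom_sum u k'" by (simp only: coprime_dvd_mult_left_iff)
    moreover have "4 dvd u - 1" if "r = 2" "v \<ge> 2" using that Suc.prems(1) by simp
    ultimately have "r ^ v dvd k'" using Suc.IH by blast
    then show ?thesis unfolding k' power_Suc2 by (rule mult_dvd_mono) simp
  qed
qed simp

lemma dvd_geom_sum_imp_dvd:
  assumes "n > 0" "u > 0" and r: "\<And>r. prime r \<Longrightarrow> r dvd n \<Longrightarrow> r dvd u - 1" and 4: "4 dvd n \<Longrightarrow> 4 dvd u - 1"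
    and "n dvd geom_sum u k"
  shows "n dvd k"
proof (cases "k = 0")
  case False
  show ?thesis
  proof (rule multiplicity_le_imp_dvd)
    show "n \<noteq> 0" using assms(1) by simp
    fix r :: nat assume r': "prime r"
    define v where "v = multiplicity r n"
    have v: "r ^ v dvd n" unfolding v_def by (rule multiplicity_dvd)
    have "r ^ v dvd k"
    proof (cases "v = 0")
      case False
      show ?thesis
      proof (rule prime_power_dvd_geom_sum[OF r' assms(2)])
        have "r dvd r ^ v" using False by simp
        then have "r dvd n" using v by (rule dvd_trans)
        with r' show "r dvd u - 1" by (rule r)
        show "4 dvd u - 1" if "r = 2" "v \<ge> 2"
        proof (rule 4)
          have "2 ^ 2 dvd (2 ^ v :: nat)" using that(2) by (rule le_imp_power_dvd)
          then have "2 ^ 2 dvd n" using v unfolding that(1) by (rule dvd_trans)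
          then show "4 dvd n" by simp
        qed
        show "r ^ v dvd geom_sum u k" using v assms(5) by (rule dvd_trans)
      qed
    qed simp
    moreover have "\<not> is_unit r" using r' not_prime_unit by blast
    ultimately show "multiplicity r n \<le> multiplicity r k"
      unfolding v_def[symmetric] using False by (intro multiplicity_geI)
  qed
qed simp

text \<open>The first n iterates at 0 are distinct modulo n, and hence exhaust the residues: the
  difference of the a-th and the b-th is e u^a times a geometric sum of length b - a, where e u^a is
  a unit, so a coincidence would make n divide b - a.\<close>

lemma hull_dobell:
  assumes "n > 0" "u > 0" "coprime e n"
    and r: "\<And>r. prime r \<Longrightarrow> r dvd n \<Longrightarrow> r dvd u - 1" and 4: "4 dvd n \<Longrightarrow> 4 dvd u - 1"
  obtains a where "[e * geom_sum u a = k] (mod n)"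
proof -
  \<comment> \<open>A common prime of u and n would divide both u and u - 1.\<close>
  have "coprime u n"
  proof (rule ccontr)
    assume "\<not> coprime u n"
    then have "gcd u n \<noteq> 1" by (simp add: coprime_iff_gcd_eq_1)
    then obtain r where r': "prime r" "r dvd u" "r dvd n"
      using prime_factor_nat[of "gcd u n"] by auto
    have "r dvd u - 1" using r'(1,3) by (rule r)
    moreover have "u = (u - 1) + 1" using assms(2) by simp
    then have "r dvd (u - 1) + 1" using r'(2) by metis
    ultimately have "r dvd 1" using dvd_add_right_iff by blast
    then show False using r'(1) by simp
  qed
  define f where "f a = e * geom_sum u a mod n" for a
  have inj: "a = b" if "a < n" "b < n" "f a = f b" "a \<le> b" for a b
  proof -
    define c where "c = b - a"
    have "e * geom_sum u b = e * geom_sum u a + e * u ^ a * geom_sum u c"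
    proof -
      have "b = a + c" using that(4) by (simp add: c_def)
      then show ?thesis by (simp only: geom_sum_add distrib_left mult.assoc)
    qed
    moreover have "[e * geom_sum u a = e * geom_sum u b] (mod n)"
      using that(3) unfolding f_def cong_def .
    ultimately have "[e * geom_sum u a + 0 = e * geom_sum u a + e * u ^ a * geom_sum u c] (mod n)"
      by simp
    then have "[0 = e * u ^ a * geom_sum u c] (mod n)" by (simp only: cong_add_lcancel_nat)
    then have "n dvd (e * u ^ a) * geom_sum u c" by (metis cong_0_iff cong_sym)
    moreover have "coprime n (e * u ^ a)"
      using assms(3) \<open>coprime u n\<close> by (simp add: coprime_commute[of n])
    ultimately have "n dvd geom_sum u c" by (simp only: coprime_dvd_mult_right_iff)
    with assms(1,2) r 4 have "n dvd c" by (rule dvd_geom_sum_imp_dvd)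
    moreover have "c < n" using that(2) by (simp add: c_def)
    ultimately have "c = 0" by (cases c) (auto dest: dvd_imp_le)
    then show "a = b" using that(4) by (simp add: c_def)
  qed
  have "inj_on f {..<n}"
  proof (rule inj_onI)
    fix a b assume "a \<in> {..<n}" "b \<in> {..<n}" "f a = f b"
    then show "a = b" using inj[of a b] inj[of b a] by (cases "a \<le> b") auto
  qed
  moreover have "f ` {..<n} \<subseteq> {..<n}" using assms(1) by (auto simp: f_def)
  ultimately have "f ` {..<n} = {..<n}" by (intro endo_inj_surj) auto
  moreover have "k mod n \<in> {..<n}" using assms(1) by simp
  ultimately obtain a where "f a = k mod n" by (metis imageE)
  then have "[e * geom_sum u a = k] (mod n)" unfolding f_def cong_def .
  then show ?thesis by (rule that)
qed

section \<open>Semilinear maps and the candidate groups\<close>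

context primitive_field
begin

text \<open>Exponents are natural numbers, effectively read modulo q - 1 and d, so one map has many
  such names.\<close>

definition slin :: "nat \<Rightarrow> nat \<Rightarrow> 'a \<Rightarrow> 'a" where
  "slin k j = (\<lambda>x. w ^ k * x ^ (p ^ j))"

definition SL :: "('a \<Rightarrow> 'a) set" where
  "SL = {slin k j | k j. True}"

lemma slin_comp: "slin k j \<circ> slin l i = slin (k + l * p ^ j) (i + j)"
  by (simp add: slin_def fun_eq_iff power_mult_distrib power_add power_mult[symmetric])

lemma slin_0_0: "slin 0 0 = id"
  by (simp add: slin_def fun_eq_iff)

lemma slin_cong: "[k = l] (mod (q - 1)) \<Longrightarrow> slin k j = slin l j"
  using power_eq_iff[of k l] by (simp add: slin_def)

lemma slin_order: "slin (q - 1) 0 = id" "slin 0 d = id"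
  using power_q_minus_1[OF w_nz] power_q by (simp_all add: slin_def fun_eq_iff q_def[symmetric])

lemma slin_add: "slin k j (x + y) = slin k j x + slin k j y"
proof -
  have "(x + y) ^ (p ^ j) = x ^ (p ^ j) + y ^ (p ^ j)"
    by (rule freshmans_dream') (simp_all add: prime_p CHAR_eq)
  then show ?thesis by (simp add: slin_def distrib_left)
qed

lemma slin_eq_0_iff: "slin k j x = 0 \<longleftrightarrow> x = 0"
  using prime_gt_0_nat[OF prime_p] by (simp add: slin_def)

lemma bij_slin: "bij (slin k j)"
proof -
  have "inj (slin k j)"
  proof (rule injI)
    fix x y assume "slin k j x = slin k j y"
    then have "slin k j (x - y) = 0" using slin_add[of k j "x - y" y] by simp
    then show "x = y" by (simp add: slin_eq_0_iff)
  qed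
  then show ?thesis by (simp add: bij_def finite_UNIV_inj_surj)
qed

lemma frob_eq: "frob = slin 0 1"
  by (simp add: frob_def slin_def fun_eq_iff CHAR_eq)

lemma mul_by_eq: "mul_by (w ^ k) = slin k 0"
  by (simp add: mul_by_def slin_def fun_eq_iff mult.commute)

lemma mul_by_frob_eq: "mul_by w \<circ> frob = slin 1 1"
  using mul_by_eq[of 1] frob_eq slin_comp[of 1 0 0 1] by simp

lemma subgroup_SL:
  assumes "S \<subseteq> SL" "id \<in> S" "\<And>f g. f \<in> S \<Longrightarrow> g \<in> S \<Longrightarrow> f \<circ> g \<in> S"
  shows "subgroup S Sym"
  using assms by (intro subgroup_SymI) (auto simp: SL_def bij_slin)

lemma slin_power_generate:
  assumes "\<And>f. f \<in> A \<Longrightarrow> bij f" "slin k 0 \<in> generate Sym A"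
  shows "slin (k * i) 0 \<in> generate Sym A"
proof (induction i)
  case 0
  show ?case unfolding mult_0_right slin_0_0 by (rule id_in_generate_Sym)
next
  case (Suc i)
  show ?case using generate_Sym_comp[OF assms(1,2) Suc] slin_comp[of k 0 "k * i" 0] by simp
qed

lemma generate_frob: "generate Sym {frob} = {slin 0 j | j. True}"
proof
  have "subgroup {slin 0 j | j. True} Sym"
  proof (rule subgroup_SL)
    show "id \<in> {slin 0 j | j. True}" using slin_0_0[symmetric] by blast
    show "f \<circ> g \<in> {slin 0 j | j. True}" if "f \<in> {slin 0 j | j. True}" "g \<in> {slin 0 j | j. True}" for f g
      using that slin_comp[of 0 _ 0] by auto
  qed (auto simp: SL_def)
  moreover have "{frob} \<subseteq> {slin 0 j | j. True}" using frob_eq by auto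
  ultimately show "generate Sym {frob} \<subseteq> {slin 0 j | j. True}" by (intro generate_Sym_subset)
  have "slin 0 j \<in> generate Sym {frob}" for j
  proof (induction j)
    case 0
    show ?case unfolding slin_0_0 by (rule id_in_generate_Sym)
  next
    case (Suc j)
    have "slin 0 1 \<in> generate Sym {frob}" by (rule generate.incl) (simp add: frob_eq)
    then show ?case
      using generate_Sym_comp[OF _ _ Suc, of "slin 0 1"] slin_comp[of 0 1 0 j]
      by (simp add: frob_eq bij_slin)
  qed
  then show "{slin 0 j | j. True} \<subseteq> generate Sym {frob}" by auto
qed

lemma mult_group_eq: "mult_group = {slin k 0 | k. True}"
proof (intro equalityI subsetI)
  fix f :: "'a \<Rightarrow> 'a" assume "f \<in> mult_group"
  then obtain u where "u \<noteq> 0" "f = mul_by u" unfolding mult_group_def by auto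
  then show "f \<in> {slin k 0 | k. True}" using ex_power[of u] mul_by_eq by blast
next
  fix f assume "f \<in> {slin k 0 | k. True}"
  then obtain k where "f = mul_by (w ^ k)" using mul_by_eq by auto
  then show "f \<in> mult_group" unfolding mult_group_def by auto
qed

lemma GammaL1_eq: "GammaL1 = SL"
proof (intro equalityI subsetI)
  fix f :: "'a \<Rightarrow> 'a" assume "f \<in> GammaL1"
  then obtain k j where "f = slin k 0 \<otimes>\<^bsub>Sym\<^esub> slin 0 j"
    unfolding GammaL1_def set_mult_def mult_group_eq generate_frob by auto
  then have "f = slin k j" by (simp add: Sym_mult bij_slin slin_comp)
  then show "f \<in> SL" unfolding SL_def by blast
next
  fix f assume "f \<in> SL"
  then obtain k j where "f = slin k j" unfolding SL_def by auto
  then have "f = slin k 0 \<otimes>\<^bsub>Sym\<^esub> slin 0 j" by (simp add: Sym_mult bij_slin slin_comp)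
  then show "f \<in> GammaL1"
    unfolding GammaL1_def set_mult_def mult_group_eq generate_frob by blast
qed

lemma M_group_eq: "M_group w r = {slin k j | k j. r dvd k}"
proof
  let ?S = "{slin k j | k j. r dvd k}"
  have "subgroup ?S Sym"
  proof (rule subgroup_SL)
    have "id = slin 0 0" "r dvd 0" using slin_0_0 by simp_all
    then show "id \<in> ?S" by blast
    fix f g assume "f \<in> ?S" "g \<in> ?S"
    then obtain k j l i where "f = slin k j" "g = slin l i" "r dvd k" "r dvd l" by auto
    then have "f \<circ> g = slin (k + l * p ^ j) (i + j)" "r dvd k + l * p ^ j" by (simp_all add: slin_comp)
    then show "f \<circ> g \<in> ?S" by blast
  qed (auto simp: SL_def)
  moreover have "{frob, mul_by (w ^ r)} \<subseteq> ?S" using frob_eq mul_by_eq[of r] by auto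
  ultimately show "M_group w r \<subseteq> ?S" unfolding M_group_def by (intro generate_Sym_subset)
  have bij: "bij f" if "f \<in> {frob, mul_by (w ^ r)}" for f
    using that bij_slin unfolding frob_eq mul_by_eq by blast
  show "?S \<subseteq> M_group w r"
  proof
    fix f assume "f \<in> ?S"
    then obtain i j where f: "f = slin (r * i) j" by auto
    have "slin r 0 \<in> M_group w r"
      unfolding M_group_def by (rule generate.incl) (simp add: mul_by_eq)
    then have 1: "slin (r * i) 0 \<in> M_group w r"
      unfolding M_group_def by (intro slin_power_generate[OF bij])
    have "generate Sym {frob} \<subseteq> M_group w r"
      unfolding M_group_def by (rule group.mono_generate[OF group_BijGroup]) simp
    then have 2: "slin 0 j \<in> M_group w r" unfolding generate_frob by blast
    have "slin (r * i) 0 \<circ> slin 0 j \<in> M_group w r"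
      using 1 2 unfolding M_group_def by (intro generate_Sym_comp[OF bij])
    then show "f \<in> M_group w r" by (simp add: f slin_comp)
  qed
qed

text \<open>As q - 2 = -1 modulo every divisor of q - 1, \<open>X * (q - 2)\<close> serves as -X.
  This keeps all exponents of w natural.\<close>

lemma cong_minus:
  assumes "r dvd q - 1"
  shows "[k + X * (q - 2) = 0] (mod r) \<longleftrightarrow> [k = X] (mod r)"
proof -
  have "[X * (q - 1) = 0] (mod r)" using assms by (simp add: cong_0_iff)
  then have 0: "[k + X * (q - 1) = k] (mod r)" using cong_add[OF cong_refl, of _ 0 r k] by simp
  have "q - 1 = Suc (q - 2)" using q_gt_1 by simp
  then have eq: "k + X * (q - 1) = X + (k + X * (q - 2))" by simp
  have "[k + X * (q - 2) = 0] (mod r) \<longleftrightarrow> [X + (k + X * (q - 2)) = X + 0] (mod r)"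
    by (simp only: cong_add_lcancel_nat)
  also have "\<dots> \<longleftrightarrow> [k + X * (q - 1) = X] (mod r)" by (simp only: eq add_0_right)
  also have "\<dots> \<longleftrightarrow> [k = X] (mod r)" using 0 cong_trans cong_sym by blast
  finally show ?thesis .
qed

end

lemma power_mod_4:
  fixes p :: nat
  assumes "p mod 4 = 3"
  shows "p ^ j mod 4 = (if even j then 1 else 3)"
proof (induction j)
  case (Suc j)
  have "p ^ Suc j mod 4 = (p mod 4) * (p ^ j mod 4) mod 4" by (simp add: mod_mult_eq)
  then show ?case using Suc assms by simp
qed simp

locale peisert_condition = primitive_field +
  assumes p3: "p mod 4 = 3" and d_even: "even d"
begin

lemmas p_power_mod4 = power_mod_4[OF p3]

lemma four_dvd: "4 dvd q - 1"
proof -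
  have "q mod 4 = 1" using p_power_mod4[of d] d_even by (simp add: q_def)
  then show ?thesis using q_gt_1 by (metis dvd_minus_mod)
qed

text \<open>Explicit form of P. The condition is closed under composition because p^j is 1 or -1
  modulo 4 according to the parity of j; for two odd Frobenius exponents the exponents of w combine
  to 1 - 1 = 0 modulo 4.\<close>

definition P_set :: "('a \<Rightarrow> 'a) set" where
  "P_set = {slin k j | k j. k mod 4 = j mod 2}"

lemma P_set_comp:
  assumes "k mod 4 = j mod 2" "l mod 4 = i mod 2"
  shows "(k + l * p ^ j) mod 4 = (i + j) mod 2"
proof -
  have "[k = k mod 4] (mod 4)" "[l = l mod 4] (mod 4)" "[p ^ j = p ^ j mod 4] (mod 4)"
    by (simp_all add: cong_def)
  then have "[k + l * p ^ j = k mod 4 + (l mod 4) * (p ^ j mod 4)] (mod 4)"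
    by (intro cong_add cong_mult)
  then have "(k + l * p ^ j) mod 4 = (k mod 4 + (l mod 4) * (p ^ j mod 4)) mod 4"
    unfolding cong_def .
  also have "\<dots> = (i + j) mod 2"
    unfolding assms p_power_mod4 by (cases "even i"; cases "even j") (simp_all add: mod2_eq_if)
  finally show ?thesis .
qed

lemma P_group_eq: "P_group w = P_set"
proof
  have "subgroup P_set Sym"
  proof (rule subgroup_SL)
    have "id = slin 0 0" "0 mod 4 = (0::nat) mod 2" using slin_0_0 by simp_all
    then show "id \<in> P_set" unfolding P_set_def by blast
    fix f g assume "f \<in> P_set" "g \<in> P_set"
    then obtain k j l i where "f = slin k j" "g = slin l i" "k mod 4 = j mod 2" "l mod 4 = i mod 2"
      unfolding P_set_def by auto
    then have "f \<circ> g = slin (k + l * p ^ j) (i + j)" "(k + l * p ^ j) mod 4 = (i + j) mod 2"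
      using P_set_comp by (simp_all add: slin_comp)
    then show "f \<circ> g \<in> P_set" unfolding P_set_def by blast
  qed (auto simp: SL_def P_set_def)
  moreover have "{mul_by w \<circ> frob, mul_by (w ^ 4)} \<subseteq> P_set"
  proof -
    have "1 mod 4 = (1::nat) mod 2" "4 mod 4 = (0::nat) mod 2" by simp_all
    then show ?thesis unfolding mul_by_frob_eq mul_by_eq P_set_def by blast
  qed
  ultimately show "P_group w \<subseteq> P_set" unfolding P_group_def by (intro generate_Sym_subset)
  have bij: "bij f" if "f \<in> {mul_by w \<circ> frob, mul_by (w ^ 4)}" for f
    using that bij_slin unfolding mul_by_frob_eq mul_by_eq by blast
  have 1: "slin 1 1 \<in> P_group w"
    unfolding P_group_def by (rule generate.incl) (simp only: mul_by_frob_eq insertI1)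
  have 4: "slin 4 0 \<in> P_group w"
    unfolding P_group_def by (rule generate.incl) (simp add: mul_by_eq)
  have "\<exists>s. s mod 4 = j mod 2 \<and> slin s j \<in> P_group w" for j
  proof (induction j)
    case 0
    have "slin 0 0 \<in> P_group w" unfolding P_group_def slin_0_0 by (rule id_in_generate_Sym)
    then show ?case by (intro exI[of _ 0]) simp
  next
    case (Suc j)
    then obtain s where s: "s mod 4 = j mod 2" "slin s j \<in> P_group w" by blast
    have "slin 1 1 \<circ> slin s j \<in> P_group w"
      using 1 s(2) unfolding P_group_def by (intro generate_Sym_comp[OF bij])
    moreover have "(1 + s * p ^ 1) mod 4 = (j + 1) mod 2" using P_set_comp[of 1 1 s j] s(1) by simp
    ultimately show ?case using slin_comp[of 1 1 s j] by (intro exI[of _ "1 + s * p ^ 1"]) simp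
  qed
  then obtain s where s: "\<And>j. s j mod 4 = j mod 2" "\<And>j. slin (s j) j \<in> P_group w" by metis
  show "P_set \<subseteq> P_group w"
  proof
    fix f assume "f \<in> P_set"
    then obtain k j where f: "f = slin k j" and kj: "k mod 4 = j mod 2" unfolding P_set_def by auto
    \<comment> \<open>\<open>l\<close> stands for k - s j: the quotient by the representative
      already found is a multiplication by a power of w^4.\<close>
    define l where "l = k + s j * (q - 2)"
    have "[k = s j] (mod 4)" using s(1) kj by (simp add: cong_def)
    then have "[l = 0] (mod 4)" unfolding l_def using cong_minus[OF four_dvd] by blast
    then obtain i where i: "l = 4 * i" by (auto simp: cong_0_iff)
    have "slin (4 * i) 0 \<in> P_group w"
      using 4 unfolding P_group_def by (intro slin_power_generate[OF bij])
    then have "slin l 0 \<circ> slin (s j) j \<in> P_group w"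
      using s(2)[of j] unfolding P_group_def i by (intro generate_Sym_comp[OF bij])
    moreover have "l + s j = k + s j * (q - 1)"
    proof -
      have "q - 1 = Suc (q - 2)" using q_gt_1 by simp
      then show ?thesis by (simp add: l_def)
    qed
    then have "slin (l + s j) j = slin k j" by (intro slin_cong) (simp add: cong_def)
    ultimately show "f \<in> P_group w" by (simp add: f slin_comp)
  qed
qed

end

context primitive_field
begin

lemma peisert_conditionI:
  assumes "p mod 4 = 3" "even d"
  shows "peisert_condition w p d"
  using assms by unfold_locales

lemma candidate_M: "prime r \<Longrightarrow> r dvd q - 1 \<Longrightarrow> M_group w r \<in> candidate_stabilizers w p d"
  by (auto simp: candidate_stabilizers_def)

lemma cong_minus_one_iff: "[int p = -1] (mod 4) \<longleftrightarrow> p mod 4 = 3"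
proof -
  have "[int p = -1] (mod 4) \<longleftrightarrow> [int p = int 3] (mod int 4)" by (simp add: cong_def)
  also have "\<dots> \<longleftrightarrow> [p = 3] (mod 4)" by (rule cong_int_iff)
  finally show ?thesis by (simp add: cong_def)
qed

lemma candidate_cases:
  assumes "H \<in> candidate_stabilizers w p d"
  obtains (M) r where "prime r" "r dvd q - 1" "H = M_group w r"
  | (P) "p mod 4 = 3" "even d" "H = P_group w"
  using assms by (auto simp: candidate_stabilizers_def cong_minus_one_iff split: if_splits)

lemma candidate_P: "p mod 4 = 3 \<Longrightarrow> even d \<Longrightarrow> P_group w \<in> candidate_stabilizers w p d"
  by (simp add: candidate_stabilizers_def cong_minus_one_iff)

end

section \<open>Standard generators of a group of semilinear maps\<close>

locale semilinear_group = primitive_field +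
  fixes G0 :: "('a \<Rightarrow> 'a) set"
  assumes G0_SL: "G0 \<subseteq> SL" and G0_id: "id \<in> G0"
    and G0_comp: "\<And>f g. f \<in> G0 \<Longrightarrow> g \<in> G0 \<Longrightarrow> f \<circ> g \<in> G0"
    and G0_inv: "\<And>f. f \<in> G0 \<Longrightarrow> \<exists>g\<in>G0. g \<circ> f = id \<and> f \<circ> g = id"
begin

lemma add_closed: "slin k j \<in> G0 \<Longrightarrow> slin l i \<in> G0 \<Longrightarrow> slin (k + l * p ^ j) (i + j) \<in> G0"
  using G0_comp[of "slin k j" "slin l i"] by (simp add: slin_comp)

text \<open>The new map is the quotient of the two given ones, with k2 - k1 p^b as exponent of w. It
  is the division step of the Euclidean arguments for s and n.\<close>

lemma diff_closed:
  assumes "slin k1 j1 \<in> G0" "slin k2 (b + j1) \<in> G0"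
  shows "slin (k2 + k1 * p ^ b * (q - 2)) b \<in> G0"
proof -
  let ?h = "slin (k2 + k1 * p ^ b * (q - 2)) b"
  obtain g where g: "g \<in> G0" "slin k1 j1 \<circ> g = id" using G0_inv[OF assms(1)] by blast
  have "Suc (q - 2) = q - 1" using q_gt_1 by simp
  have "k2 + k1 * p ^ b * (q - 2) + k1 * p ^ b = k2 + k1 * p ^ b * Suc (q - 2)" by simp
  then have "k2 + k1 * p ^ b * (q - 2) + k1 * p ^ b = k2 + k1 * p ^ b * (q - 1)"
    unfolding \<open>Suc (q - 2) = q - 1\<close> .
  then have "[k2 + k1 * p ^ b * (q - 2) + k1 * p ^ b = k2] (mod (q - 1))"
    unfolding cong_def by (simp only: mod_mult_self1)
  then have "?h \<circ> slin k1 j1 = slin k2 (j1 + b)" unfolding slin_comp by (rule slin_cong)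
  then have "?h \<circ> slin k1 j1 \<circ> g \<in> G0" using G0_comp[OF assms(2) g(1)] by (simp add: add.commute)
  then show ?thesis using g(2) by (simp add: comp_assoc)
qed

text \<open>The standard generators are \<open>slin e s\<close> with the least positive Frobenius
  exponent s, and multiplication by w^n with the least positive n.\<close>

definition s :: nat where
  "s = (LEAST s. s > 0 \<and> (\<exists>e. slin e s \<in> G0))"

definition n :: nat where
  "n = (LEAST n. n > 0 \<and> slin n 0 \<in> G0)"

lemma s_pos: "s > 0" and s_gen: "\<exists>e. slin e s \<in> G0"
proof -
  have "d > 0 \<and> (\<exists>e. slin e d \<in> G0)" using d_pos slin_order(2) G0_id by metis
  then have "s > 0 \<and> (\<exists>e. slin e s \<in> G0)" unfolding s_def by (rule LeastI)
  then show "s > 0" "\<exists>e. slin e s \<in> G0" by auto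
qed

lemma n_pos: "n > 0" and n_gen: "slin n 0 \<in> G0"
proof -
  have "q - 1 > 0 \<and> slin (q - 1) 0 \<in> G0" using q_gt_1 slin_order(1) G0_id by simp
  then have "n > 0 \<and> slin n 0 \<in> G0" unfolding n_def by (rule LeastI)
  then show "n > 0" "slin n 0 \<in> G0" by auto
qed

lemma s_dvd: "slin k j \<in> G0 \<Longrightarrow> s dvd j"
proof (induction j arbitrary: k rule: less_induct)
  case (less j)
  obtain e where e: "slin e s \<in> G0" using s_gen by blast
  show ?case
  proof (cases "j < s")
    case True
    then have "\<not> (j > 0 \<and> (\<exists>e. slin e j \<in> G0))" unfolding s_def by (rule not_less_Least)
    then show ?thesis using less.prems by auto
  next
    case False
    then have j: "j = j - s + s" by simp
    have "slin (k + e * p ^ (j - s) * (q - 2)) (j - s) \<in> G0"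
      using less.prems j by (intro diff_closed[OF e]) simp
    then have "s dvd j - s" using less.IH[of "j - s"] s_pos False by auto
    then show ?thesis using False by (simp add: dvd_minus_self)
  qed
qed

lemma n_dvd: "slin k 0 \<in> G0 \<Longrightarrow> n dvd k"
proof (induction k rule: less_induct)
  case (less k)
  show ?case
  proof (cases "k < n")
    case True
    then have "\<not> (k > 0 \<and> slin k 0 \<in> G0)" unfolding n_def by (rule not_less_Least)
    then show ?thesis using less.prems by auto
  next
    case False
    have "slin (k + n * p ^ 0 * (q - 2)) 0 \<in> G0"
      using less.prems by (intro diff_closed[OF n_gen]) simp
    moreover have "k + n * p ^ 0 * (q - 2) = (k - n) + n * (q - 1)"
    proof -
      have "q - 1 = Suc (q - 2)" using q_gt_1 by simp
      then show ?thesis using False by simp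
    qed
    then have "slin (k + n * p ^ 0 * (q - 2)) 0 = slin (k - n) 0"
      by (intro slin_cong) (simp add: cong_def)
    ultimately have "slin (k - n) 0 \<in> G0" by simp
    then have "n dvd k - n" using less.IH[of "k - n"] n_pos False by auto
    then show ?thesis using False by (simp add: dvd_minus_self)
  qed
qed

lemma n_dvd_q1: "n dvd q - 1"
  using slin_order(1) G0_id by (intro n_dvd) simp

lemma slin_mult_n: "slin (n * l) 0 \<in> G0"
proof (induction l)
  case 0
  show ?case using G0_id by (simp only: mult_0_right geom_sum_0 slin_0_0)
next
  case (Suc l)
  show ?case using add_closed[OF n_gen Suc] by simp
qed

lemma slin_geom:
  assumes "slin e s \<in> G0"
  shows "slin (e * geom_sum (p ^ s) a) (s * a) \<in> G0"
proof (induction a)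
  case 0
  show ?case using G0_id by (simp only: mult_0_right geom_sum_0 slin_0_0)
next
  case (Suc a)
  show ?case using add_closed[OF assms Suc] by (simp add: geom_sum_Suc algebra_simps)
qed

text \<open>Dividing by the a-th power of \<open>slin e s\<close> leaves a multiplication, whose
  exponent is a multiple of n. So the Frobenius exponent determines k modulo n.\<close>

lemma exponent_cong:
  assumes "slin e s \<in> G0" "slin k j \<in> G0" "r dvd n"
  obtains a where "j = s * a" "[k = e * geom_sum (p ^ s) a] (mod r)"
proof -
  obtain a where a: "j = s * a" using s_dvd[OF assms(2)] by auto
  have "slin (k + e * geom_sum (p ^ s) a * p ^ 0 * (q - 2)) 0 \<in> G0"
    using assms(2) a by (intro diff_closed[OF slin_geom[OF assms(1)]]) simp
  then have "n dvd k + e * geom_sum (p ^ s) a * (q - 2)" using n_dvd by simp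
  then have "[k + e * geom_sum (p ^ s) a * (q - 2) = 0] (mod r)"
    using assms(3) by (metis cong_0_iff dvd_trans)
  then have "[k = e * geom_sum (p ^ s) a] (mod r)"
    using cong_minus[OF dvd_trans[OF assms(3) n_dvd_q1]] by blast
  with a show ?thesis by (rule that)
qed

text \<open>Powers of \<open>slin e s\<close> send 1 to elements with exponents in every class
  modulo n, and powers of w^n then fill each class.\<close>

lemma transitive:
  assumes e: "slin e s \<in> G0" and surj: "\<And>k. \<exists>a. [e * geom_sum (p ^ s) a = k] (mod n)"
    and "x \<noteq> 0" "y \<noteq> 0"
  shows "\<exists>g\<in>G0. g x = y"
proof -
  have *: "\<exists>g\<in>G0. g 1 = w ^ k" for k
  proof -
    obtain a where a: "[e * geom_sum (p ^ s) a = k] (mod n)" using surj by blast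
    define X where "X = e * geom_sum (p ^ s) a"
    have "[k + X * (q - 2) = 0] (mod n)"
      using a cong_minus[OF n_dvd_q1] cong_sym unfolding X_def by blast
    then obtain l where l: "k + X * (q - 2) = n * l" by (auto simp: cong_0_iff)
    have "slin (n * l) 0 \<circ> slin X (s * a) \<in> G0"
      unfolding X_def by (intro G0_comp slin_mult_n slin_geom[OF e])
    moreover have "n * l + X = k + X * (q - 1)"
    proof -
      have "q - 1 = Suc (q - 2)" using q_gt_1 by simp
      then show ?thesis using l by simp
    qed
    then have "slin (n * l + X) (s * a) = slin k (s * a)" by (intro slin_cong) (simp add: cong_def)
    then have "(slin (n * l) 0 \<circ> slin X (s * a)) 1 = w ^ k" by (simp add: slin_comp) (simp add: slin_def)
    ultimately show ?thesis by blast
  qed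
  obtain i k where "x = w ^ i" "y = w ^ k" using assms(3,4) ex_power by metis
  then obtain f g where f: "f \<in> G0" "f 1 = x" and g: "g \<in> G0" "g 1 = y" using * by metis
  obtain h where h: "h \<in> G0" "h \<circ> f = id" using G0_inv[OF f(1)] by blast
  have "(g \<circ> h) x = g ((h \<circ> f) 1)" by (simp add: f(2))
  then have "(g \<circ> h) x = y" by (simp add: h(2) g(2))
  then show ?thesis using G0_comp[OF g(1) h(1)] by blast
qed

text \<open>Conjugation by multiplication with w^c changes the exponent k of \<open>slin k j\<close>
  into k + c - c p^j. If G0 is intransitive, a hypothesis of the Hull-Dobell criterion fails: some
  prime r of n divides e, or does not divide u - 1, or 4 divides n but not u - 1. In the first two
  cases a class -c modulo r is fixed, and the conjugation moves it to 0.\<close>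

lemma intransitive:
  assumes "x \<noteq> 0" "y \<noteq> 0" "\<And>g. g \<in> G0 \<Longrightarrow> g x \<noteq> y"
  obtains c H where "H \<in> candidate_stabilizers w p d"
    "\<And>k j. slin k j \<in> G0 \<Longrightarrow> slin (k + c + c * p ^ j * (q - 2)) j \<in> H"
proof -
  note result = that
  obtain e where e: "slin e s \<in> G0" using s_gen by blast
  define u where "u = p ^ s"
  have u_pos: "u > 0" using prime_gt_0_nat[OF prime_p] by (simp add: u_def)
  note ec = exponent_cong[OF e, folded u_def]
  have pu: "p ^ (s * a) = u ^ a" for a by (simp add: u_def power_mult)
  \<comment> \<open>The condition on c says, without subtraction, that all iterates of the affine
    map fix -c modulo r.\<close>
  have M: thesis if r: "prime r" "r dvd n" and
    c: "\<And>a. [e * geom_sum u a + c = c * u ^ a] (mod r)" for r c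
  proof (rule result)
    have rq: "r dvd q - 1" using r(2) n_dvd_q1 by (rule dvd_trans)
    show "M_group w r \<in> candidate_stabilizers w p d" using r(1) rq by (rule candidate_M)
    fix k j assume kj: "slin k j \<in> G0"
    obtain a where a: "j = s * a" "[k = e * geom_sum u a] (mod r)" using ec[OF kj r(2)] by blast
    have "[k + c = e * geom_sum u a + c] (mod r)" using a(2) by (rule cong_add) simp
    then have "[k + c = c * p ^ j] (mod r)" using c unfolding a(1) pu by (rule cong_trans)
    then have "[k + c + c * p ^ j * (q - 2) = 0] (mod r)" using cong_minus[OF rq] by blast
    then show "slin (k + c + c * p ^ j * (q - 2)) j \<in> M_group w r"
      unfolding M_group_eq cong_0_iff by blast
  qed
  consider r where "prime r" "r dvd n" "r dvd e" | r where "prime r" "r dvd n" "\<not> r dvd u - 1"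
    | "4 dvd n" "\<not> 4 dvd u - 1" "odd e" "2 dvd u - 1"
  proof -
    have False if no1: "\<And>r. prime r \<Longrightarrow> r dvd n \<Longrightarrow> \<not> r dvd e"
      and no2: "\<And>r. prime r \<Longrightarrow> r dvd n \<Longrightarrow> r dvd u - 1" and no3: "4 dvd n \<Longrightarrow> 4 dvd u - 1"
    proof -
      have "coprime e n"
      proof (rule ccontr)
        assume "\<not> coprime e n"
        then have "gcd e n \<noteq> 1" by (simp add: coprime_iff_gcd_eq_1)
        then obtain r where "prime r" "r dvd gcd e n" using prime_factor_nat by blast
        then show False using no1[of r] by simp
      qed
      then have "\<exists>a. [e * geom_sum u a = k] (mod n)" for k
        using hull_dobell[OF n_pos u_pos _ no2 no3] by metis
      then show False using transitive[OF e _ assms(1,2)] assms(3) unfolding u_def by blast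
    qed
    moreover have "2 dvd n" if "4 dvd n" using dvd_trans[OF _ that, of 2] by simp
    ultimately show thesis using that two_is_prime_nat by metis
  qed
  then show thesis
  proof cases
    case (1 r)
    have "[e * geom_sum u a + 0 = 0 * u ^ a] (mod r)" for a using 1(3) by (simp add: cong_0_iff)
    then show thesis using M[OF 1(1,2)] by blast
  next
    case (2 r)
    then have "coprime (u - 1) r" using prime_imp_coprime coprime_commute by blast
    then obtain v where v: "[(u - 1) * v = 1] (mod r)" using cong_solve_coprime_nat by auto
    \<comment> \<open>Since v inverts u - 1 modulo r, the fixed class is -e v.\<close>
    have "[e * geom_sum u a + e * v = e * v * u ^ a] (mod r)" for a
    proof -
      have "[e * geom_sum u a * 1 + e * v = e * geom_sum u a * ((u - 1) * v) + e * v] (mod r)"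
        using v by (intro cong_add cong_mult) (auto intro: cong_sym)
      also have "e * geom_sum u a * ((u - 1) * v) + e * v = e * v * u ^ a"
        unfolding geom_sum_power[OF u_pos, of a] by (simp add: algebra_simps)
      finally show ?thesis by simp
    qed
    then show thesis using M[OF 2(1,2)] by blast
  next
    case 3
    have u_mod: "u mod 4 = 3"
    proof -
      have "odd u" using 3(4) u_pos by presburger
      then show ?thesis using 3(2) u_pos by presburger
    qed
    have p_mod: "p mod 4 = 3"
    proof (rule ccontr)
      assume "p mod 4 \<noteq> 3"
      moreover have "odd (p ^ s)" using u_mod unfolding u_def by presburger
      then have "odd p" using s_pos by simp
      ultimately have "p mod 4 = 1" by presburger
      then have "[p = 1] (mod 4)" by (simp add: cong_def)
      then have "[p ^ s = 1 ^ s] (mod 4)" by (rule cong_pow)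
      then show False using u_mod by (simp add: cong_def u_def)
    qed
    note mod4 = power_mod_4[OF p_mod]
    \<comment> \<open>As p^s is 3 modulo 4, s is odd, so j = s a and a have the same parity; and p^d
      = 1 modulo 4 makes d even, as required for P.\<close>
    have s_odd: "odd s" using u_mod mod4[of s] by (auto simp: u_def split: if_splits)
    have "4 dvd q - 1" using 3(1) n_dvd_q1 by (rule dvd_trans)
    then have "q mod 4 = 1" using q_gt_1 by presburger
    then have "p ^ d mod 4 = 1" unfolding q_def .
    then have d_even: "even d" unfolding mod4 by presburger
    interpret P: peisert_condition w p d using peisert_conditionI[OF p_mod d_even] .
    \<comment> \<open>Conjugation gives the generator the exponent e + c - c u = e + 2c modulo 4; c
      is chosen to make this 1.\<close>
    define c :: nat where "c = (if e mod 4 = 1 then 0 else 1)"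
    have e_mod: "e mod 4 = 1 \<or> e mod 4 = 3" using 3(3) by presburger
    have geom: "geom_sum u a mod 4 = a mod 2" for a
    proof (induction a)
      case (Suc a)
      have "[u * geom_sum u a = 3 * (a mod 2)] (mod 4)"
        using Suc u_mod by (intro cong_mult) (simp_all add: cong_def)
      then have "[1 + u * geom_sum u a = 1 + 3 * (a mod 2)] (mod 4)" by (intro cong_add) simp_all
      then show ?case by (cases "even a") (simp_all add: geom_sum_Suc cong_def mod2_eq_if)
    qed simp
    show thesis
    proof (rule result)
      show "P_group w \<in> candidate_stabilizers w p d" using p_mod d_even by (rule candidate_P)
      fix k j assume kj: "slin k j \<in> G0"
      obtain a where a: "j = s * a" "[k = e * geom_sum u a] (mod 4)" using ec[OF kj 3(1)] by blast
      have ja: "even j \<longleftrightarrow> even a" using s_odd a(1) by simp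
      have "[e * geom_sum u a = (e mod 4) * (a mod 2)] (mod 4)"
        using geom[of a] by (intro cong_mult) (simp_all add: cong_def)
      with a(2) have "[k = (e mod 4) * (a mod 2)] (mod 4)" by (rule cong_trans)
      then have k: "k mod 4 = (if even j then 0 else e mod 4)"
        using e_mod ja by (auto simp: cong_def mod2_eq_if)
      have "[(k + c) = (j mod 2) + c * p ^ j] (mod 4)"
      proof (cases "even j")
        case True
        then have "[k + c = 0 + c * 1] (mod 4)" using k by (intro cong_add) (simp_all add: cong_def)
        also have "[0 + c * 1 = (j mod 2) + c * p ^ j] (mod 4)"
          using True mod4[of j] by (intro cong_add cong_mult) (simp_all add: cong_def)
        finally show ?thesis .
      next
        case False
        then have "[k + c = e mod 4 + c] (mod 4)" using k by (intro cong_add) (simp_all add: cong_def)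
        also have "[e mod 4 + c = 1 + c * 3] (mod 4)" using e_mod by (auto simp: c_def cong_def)
        also have "[1 + c * 3 = (j mod 2) + c * p ^ j] (mod 4)"
          using False mod4[of j] by (intro cong_add cong_mult) (simp_all add: cong_def mod2_eq_if)
        finally show ?thesis .
      qed
      define X where "X = c * p ^ j"
      have "[X + X * (q - 2) = 0] (mod 4)" by (rule cong_minus[OF P.four_dvd, THEN iffD2]) (rule cong_refl)
      then have "[j mod 2 + (X + X * (q - 2)) = j mod 2 + 0] (mod 4)" by (rule cong_add[OF cong_refl])
      moreover have "[k + c + X * (q - 2) = j mod 2 + X + X * (q - 2)] (mod 4)"
        using \<open>[(k + c) = (j mod 2) + c * p ^ j] (mod 4)\<close> unfolding X_def by (rule cong_add[OF _ cong_refl])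
      ultimately have "[k + c + X * (q - 2) = j mod 2] (mod 4)"
        unfolding add.assoc add_0_right by (rule cong_trans[rotated])
      moreover have "j mod 2 mod 4 = j mod 2" by (rule mod_less) (simp add: mod2_eq_if)
      ultimately have "(k + c + c * p ^ j * (q - 2)) mod 4 = j mod 2"
        unfolding cong_def X_def by (rule trans)
      then show "slin (k + c + c * p ^ j * (q - 2)) j \<in> P_group w"
        unfolding P.P_group_eq P.P_set_def by blast
    qed
  qed
qed

end

section \<open>Orbits and valencies\<close>

context primitive_field
begin

lemma additive_group_SL: "subgroup H Sym \<Longrightarrow> H \<subseteq> SL \<Longrightarrow> additive_group H"
  by (intro additive_group.intro) (auto simp: SL_def slin_add)

lemma AGammaL1_eq: "AGammaL1 = {\<lambda>x. h x + b | h b. h \<in> SL}"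
  unfolding AGammaL1_def GammaL1_eq
  by (rule semidirect_translations_eq) (auto simp: SL_def bij_slin)

lemma subgroup_generate_Sym: "(\<And>f. f \<in> A \<Longrightarrow> bij f) \<Longrightarrow> subgroup (generate Sym A) Sym"
  by (rule group.generate_is_subgroup[OF group_BijGroup]) (auto simp: Sym_carrier)

lemma subgroup_M: "subgroup (M_group w r) Sym"
  unfolding M_group_def using bij_slin frob_eq mul_by_eq
  by (intro subgroup_generate_Sym) (metis insert_iff singletonD)

lemma subgroup_P: "subgroup (P_group w) Sym"
  unfolding P_group_def using bij_slin mul_by_frob_eq mul_by_eq
  by (intro subgroup_generate_Sym) (metis insert_iff singletonD)

lemma M_subset_SL: "M_group w r \<subseteq> SL"
  unfolding M_group_eq SL_def by blast

lemma additive_group_M: "additive_group (M_group w r)"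
  by (rule additive_group_SL[OF subgroup_M M_subset_SL])

lemma card_image_powers:
  assumes "r dvd q - 1" "z \<noteq> 0"
  shows "card ((\<lambda>i. w ^ (r * i) * z) ` {..<(q - 1) div r}) = (q - 1) div r"
proof -
  have qr: "q - 1 = r * ((q - 1) div r)" using assms(1) by simp
  have "r > 0" using assms(1) q_gt_1 by (cases r) auto
  have "inj_on (\<lambda>i. w ^ (r * i) * z) {..<(q - 1) div r}"
  proof (rule inj_onI)
    fix i j assume ij: "i \<in> {..<(q - 1) div r}" "j \<in> {..<(q - 1) div r}"
      "w ^ (r * i) * z = w ^ (r * j) * z"
    then have "[r * i = r * j] (mod (q - 1))" using assms(2) by (simp only: mult_cancel_right power_eq_iff) simp
    moreover have "r * i < q - 1" "r * j < q - 1"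
      using ij(1,2) \<open>r > 0\<close> by (subst qr, simp)+
    ultimately have "r * i = r * j" by (rule cong_less_modulus_unique_nat)
    then show "i = j" using \<open>r > 0\<close> by simp
  qed
  then show ?thesis by (simp add: card_image)
qed

lemma orb_M_1: "orb (M_group w r) 1 = {w ^ k | k. r dvd k}"
proof (intro equalityI subsetI)
  fix x assume "x \<in> orb (M_group w r) 1"
  then obtain k j where "x = slin k j 1" "r dvd k" unfolding orb_def M_group_eq by auto
  then show "x \<in> {w ^ k | k. r dvd k}" by (auto simp: slin_def)
next
  fix x assume "x \<in> {w ^ k | k. r dvd k}"
  then obtain k where k: "x = w ^ k" "r dvd k" by auto
  then have "x = slin k 0 1" by (simp add: slin_def)
  moreover have "slin k 0 \<in> M_group w r" unfolding M_group_eq using k(2) by blast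
  ultimately show "x \<in> orb (M_group w r) 1" unfolding orb_def by blast
qed

text \<open>Every nonzero orbit contains a coset of the group of r-th powers. The orbit of 1 is that
  group itself, as Frobenius fixes 1, so the bound is attained.\<close>

lemma card_orb_M_ge:
  assumes "r dvd q - 1" "z \<noteq> 0"
  shows "card (orb (M_group w r) z) \<ge> (q - 1) div r"
proof -
  have "(\<lambda>i. w ^ (r * i) * z) ` {..<(q - 1) div r} \<subseteq> orb (M_group w r) z"
  proof
    fix x assume "x \<in> (\<lambda>i. w ^ (r * i) * z) ` {..<(q - 1) div r}"
    then obtain i where "x = slin (r * i) 0 z" by (auto simp: slin_def)
    moreover have "slin (r * i) 0 \<in> M_group w r" by (auto simp: M_group_eq)
    ultimately show "x \<in> orb (M_group w r) z" unfolding orb_def by blast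
  qed
  then have "card ((\<lambda>i. w ^ (r * i) * z) ` {..<(q - 1) div r}) \<le> card (orb (M_group w r) z)"
    by (intro card_mono) auto
  then show ?thesis by (simp only: card_image_powers[OF assms])
qed

lemma card_orb_M_1:
  assumes "r dvd q - 1"
  shows "card (orb (M_group w r) 1) = (q - 1) div r"
proof -
  have qr: "q - 1 = r * ((q - 1) div r)" using assms(1) by simp
  have "r > 0" using assms(1) q_gt_1 by (cases r) auto
  have "orb (M_group w r) 1 \<subseteq> (\<lambda>i. w ^ (r * i) * 1) ` {..<(q - 1) div r}"
  proof
    fix x assume x: "x \<in> orb (M_group w r) 1"
    then obtain k where k: "x = w ^ k" "r dvd k" unfolding orb_M_1 by auto
    define l where "l = k mod (q - 1)"
    have "r dvd l" unfolding l_def using k(2) assms by (simp add: dvd_mod)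
    then obtain i where i: "l = r * i" by auto
    have "l < r * ((q - 1) div r)" using q_gt_1 qr by (simp add: l_def)
    then have "i < (q - 1) div r" using i by simp
    moreover have "x = w ^ l" unfolding l_def k(1) by (rule power_mod_q[OF w_nz, symmetric])
    ultimately show "x \<in> (\<lambda>i. w ^ (r * i) * 1) ` {..<(q - 1) div r}" using i by auto
  qed
  then have "card (orb (M_group w r) 1) \<le> card ((\<lambda>i. w ^ (r * i) * 1) ` {..<(q - 1) div r})"
    by (intro card_mono) auto
  also have "\<dots> = (q - 1) div r" by (rule card_image_powers[OF assms]) simp
  finally show ?thesis using card_orb_M_ge[OF assms, of 1] by simp
qed

lemma scheme_iso_min_valency:
  assumes "additive_group G" "additive_group H"
    "scheme_iso (Inv (semidirect_translations G)) (Inv (semidirect_translations H))"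
    and "x \<noteq> 0" and "\<And>z. z \<noteq> 0 \<Longrightarrow> card (orb H z) \<ge> v"
  shows "card (orb G x) \<ge> v"
proof -
  interpret G: additive_group G by fact
  interpret H: additive_group H by fact
  have "card (diff_rel (orb G x)) \<in> card ` (Inv (semidirect_translations H) - {Id})"
    unfolding scheme_iso_valencies[OF assms(3), symmetric] G.Inv_minus_Id using assms(4) by blast
  then obtain z where "z \<noteq> 0" "card (diff_rel (orb G x)) = card (diff_rel (orb H z))"
    unfolding H.Inv_minus_Id by auto
  then show ?thesis using assms(5)[of z] q_gt_1 by (simp add: card_diff_rel)
qed

lemma M_nontrivial:
  assumes "prime r" "r dvd q - 1"
  shows "w \<notin> orb (M_group w r) 1"
proof
  assume "w \<in> orb (M_group w r) 1"
  then obtain k where "w ^ 1 = w ^ k" "r dvd k" unfolding orb_M_1 by auto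
  then have "[1 = k] (mod (q - 1))" by (simp only: power_eq_iff)
  then have "[1 = k] (mod r)" using assms(2) by (rule cong_dvd_modulus_nat)
  then have "r dvd 1" using \<open>r dvd k\<close> cong_dvd_iff by blast
  then show False using assms(1) by simp
qed

lemma iso_M_M:
  assumes r: "prime r" "r dvd q - 1" and r': "prime r'" "r' dvd q - 1"
    and iso: "scheme_iso (Inv (semidirect_translations (M_group w r))) (Inv (semidirect_translations (M_group w r')))"
  shows "r = r'"
proof -
  have "(q - 1) div r' \<le> (q - 1) div r"
    using scheme_iso_min_valency[OF additive_group_M additive_group_M iso, of 1] card_orb_M_ge[OF r'(2)]
    by (simp add: card_orb_M_1[OF r(2)])
  moreover have "(q - 1) div r \<le> (q - 1) div r'"
    using scheme_iso_min_valency[OF additive_group_M additive_group_M scheme_iso_sym[OF iso], of 1]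
      card_orb_M_ge[OF r(2)] by (simp add: card_orb_M_1[OF r'(2)])
  ultimately have eq: "(q - 1) div r = (q - 1) div r'" by simp
  have "r * ((q - 1) div r) = r' * ((q - 1) div r')" using r(2) r'(2) by simp
  moreover have "(q - 1) div r \<noteq> 0" using r(2) q_gt_1 by (auto simp: dvd_div_eq_0_iff)
  ultimately show ?thesis unfolding eq by simp
qed

end

context peisert_condition
begin

lemma P_subset_SL: "P_group w \<subseteq> SL"
  unfolding P_group_eq P_set_def SL_def by blast

lemma additive_group_P: "additive_group (P_group w)"
  by (rule additive_group_SL[OF subgroup_P P_subset_SL])

lemma P_slin: "slin k j \<in> P_group w" if "k mod 4 = j mod 2"
  using that unfolding P_group_eq P_set_def by blast

lemma orb_P:
  "x \<in> orb (P_group w) z \<longleftrightarrow> (\<exists>k j. k mod 4 = j mod 2 \<and> x = w ^ k * z ^ (p ^ j))"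
proof
  assume "x \<in> orb (P_group w) z"
  then obtain k j where "k mod 4 = j mod 2" "x = slin k j z"
    unfolding orb_def P_group_eq P_set_def by auto
  then show "\<exists>k j. k mod 4 = j mod 2 \<and> x = w ^ k * z ^ (p ^ j)" unfolding slin_def by blast
next
  assume "\<exists>k j. k mod 4 = j mod 2 \<and> x = w ^ k * z ^ (p ^ j)"
  then obtain k j where "k mod 4 = j mod 2" "x = slin k j z" unfolding slin_def by blast
  then show "x \<in> orb (P_group w) z" unfolding orb_def using P_slin by blast
qed

lemma mod4_cong: "[k = l] (mod (q - 1)) \<Longrightarrow> k mod 4 = l mod 4"
  using cong_dvd_modulus_nat[OF _ four_dvd, of k l] unfolding cong_def by blast

text \<open>The class 1 modulo 4 is reached through odd Frobenius exponents, which have no effect on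
  1.\<close>

lemma orb_P_1: "orb (P_group w) 1 = {w ^ k | k. k mod 4 < 2}"
proof (intro equalityI subsetI)
  fix x assume "x \<in> orb (P_group w) 1"
  then obtain k j where "k mod 4 = j mod 2" "x = w ^ k" by (auto simp: orb_P)
  moreover have "j mod 2 < 2" by simp
  ultimately show "x \<in> {w ^ k | k. k mod 4 < 2}" by auto
next
  fix x assume "x \<in> {w ^ k | k. k mod 4 < 2}"
  then obtain k where "x = w ^ k" "k mod 4 < 2" by auto
  then have "k mod 4 = (k mod 4) mod 2" "x = w ^ k * 1 ^ (p ^ (k mod 4))" by auto
  then show "x \<in> orb (P_group w) 1" unfolding orb_P by blast
qed

lemma orb_P_w2: "orb (P_group w) (w ^ 2) = {w ^ k | k. k mod 4 \<ge> 2}"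
proof (intro equalityI subsetI)
  fix x assume "x \<in> orb (P_group w) (w ^ 2)"
  then obtain k j where kj: "k mod 4 = j mod 2" "x = w ^ (k + 2 * p ^ j)"
    by (auto simp: orb_P power_add power_mult)
  have "[k + 2 * p ^ j = j mod 2 + 2 * (if even j then 1 else 3)] (mod 4)"
    using kj(1) p_power_mod4[of j] by (intro cong_add cong_mult) (simp_all add: cong_def)
  then have "(k + 2 * p ^ j) mod 4 \<ge> 2" by (simp add: cong_def mod2_eq_if split: if_splits)
  then show "x \<in> {w ^ k | k. k mod 4 \<ge> 2}" using kj(2) by blast
next
  fix x assume "x \<in> {w ^ k | k. k mod 4 \<ge> 2}"
  then obtain l where l: "x = w ^ l" "l mod 4 \<ge> 2" by auto
  \<comment> \<open>The task is to write l as k + 2 p^j with k mod 4 = j mod 2. Since 2 p^j is 2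
    modulo 4, j has to be even or odd according as l is 2 or 3 modulo 4, and k is l - 2 p^j.\<close>
  define j :: nat where "j = (if l mod 4 = 2 then 0 else 1)"
  define k where "k = l + 2 * p ^ j * (q - 2)"
  have "[l = j mod 2 + 2 * p ^ j] (mod 4)"
  proof -
    have "[j mod 2 + 2 * p ^ j = j mod 2 + 2 * (if even j then 1 else 3)] (mod 4)"
      using p_power_mod4[of j] by (intro cong_add cong_mult) (simp_all add: cong_def)
    moreover have "[l = j mod 2 + 2 * (if even j then 1 else 3)] (mod 4)"
      using l(2) by (auto simp: j_def cong_def)
    ultimately show ?thesis by (metis cong_trans cong_sym)
  qed
  define X where "X = 2 * p ^ j"
  have "[X + X * (q - 2) = 0] (mod 4)" by (rule cong_minus[OF four_dvd, THEN iffD2]) (rule cong_refl)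
  then have "[j mod 2 + (X + X * (q - 2)) = j mod 2 + 0] (mod 4)" by (rule cong_add[OF cong_refl])
  moreover have "[k = j mod 2 + X + X * (q - 2)] (mod 4)"
    using \<open>[l = j mod 2 + 2 * p ^ j] (mod 4)\<close> unfolding X_def k_def by (rule cong_add[OF _ cong_refl])
  ultimately have "[k = j mod 2] (mod 4)"
    unfolding add.assoc add_0_right by (rule cong_trans[rotated])
  moreover have "j mod 2 mod 4 = j mod 2" by (rule mod_less) (simp add: mod2_eq_if)
  ultimately have "k mod 4 = j mod 2"
    unfolding cong_def by (rule trans)
  moreover have "x = w ^ k * (w ^ 2) ^ (p ^ j)"
  proof -
    have "q - 1 = Suc (q - 2)" using q_gt_1 by simp
    then have "k + 2 * p ^ j = l + 2 * p ^ j * (q - 1)" by (simp add: k_def)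
    then have "w ^ (k + 2 * p ^ j) = w ^ l" unfolding power_eq_iff by (simp add: cong_def)
    then show ?thesis by (simp add: l(1) power_add power_mult)
  qed
  ultimately show "x \<in> orb (P_group w) (w ^ 2)" unfolding orb_P by blast
qed

lemma orb_P_cases:
  assumes "z \<noteq> 0"
  shows "orb (P_group w) z = orb (P_group w) 1 \<or> orb (P_group w) z = orb (P_group w) (w ^ 2)"
proof -
  interpret additive_group "P_group w" by (rule additive_group_P)
  obtain k where "z = w ^ k" using ex_power[OF assms] by blast
  then have "z \<in> orb (P_group w) 1 \<or> z \<in> orb (P_group w) (w ^ 2)"
    unfolding orb_P_1 orb_P_w2 using not_less by blast
  then show ?thesis using orb_eq by blast
qed

lemma orb_P_disjoint: "orb (P_group w) 1 \<inter> orb (P_group w) (w ^ 2) = {}"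
proof -
  have False if "w ^ k = w ^ l" "k mod 4 < 2" "l mod 4 \<ge> 2" for k l
    using mod4_cong[of k l] that by (simp add: power_eq_iff)
  then show ?thesis unfolding orb_P_1 orb_P_w2 by auto
qed

lemma orb_P_Un: "orb (P_group w) 1 \<union> orb (P_group w) (w ^ 2) = UNIV - {0}"
proof -
  interpret additive_group "P_group w" by (rule additive_group_P)
  show ?thesis
  proof (intro equalityI subsetI)
    fix z :: 'a assume "z \<in> UNIV - {0}"
    then show "z \<in> orb (P_group w) 1 \<union> orb (P_group w) (w ^ 2)"
      using orb_P_cases[of z] orb_self[of z] by auto
  qed (auto simp: orb_P_1 orb_P_w2)
qed

lemma card_orb_P: "z \<noteq> 0 \<Longrightarrow> card (orb (P_group w) z) = (q - 1) div 2"
proof -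
  \<comment> \<open>Multiplication by w^2 shifts exponents by 2 modulo 4, so the two orbits have
    equal size.\<close>
  have "orb (P_group w) (w ^ 2) = (\<lambda>x. x * w ^ 2) ` orb (P_group w) 1"
  proof (intro equalityI subsetI)
    fix x assume "x \<in> orb (P_group w) (w ^ 2)"
    then obtain k where k: "x = w ^ k" "k mod 4 \<ge> 2" unfolding orb_P_w2 by auto
    have "2 \<le> k" using k(2) by (rule order.trans) simp
    then have "k = (k - 2) + 2" by simp
    then obtain l where l: "k = l + 2" by blast
    have "l mod 4 < 2" using k(2) unfolding l by presburger
    moreover have "x = w ^ l * w ^ 2" unfolding k(1) l by (rule power_add)
    ultimately show "x \<in> (\<lambda>x. x * w ^ 2) ` orb (P_group w) 1"
      unfolding orb_P_1 by blast
  next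
    fix x assume "x \<in> (\<lambda>x. x * w ^ 2) ` orb (P_group w) 1"
    then obtain k where k: "x = w ^ k * w ^ 2" "k mod 4 < 2" unfolding orb_P_1 by blast
    then have "(k + 2) mod 4 \<ge> 2" by presburger
    moreover have "x = w ^ (k + 2)" unfolding k(1) by (rule power_add[symmetric])
    ultimately show "x \<in> orb (P_group w) (w ^ 2)" unfolding orb_P_w2 by blast
  qed
  then have eq: "card (orb (P_group w) (w ^ 2)) = card (orb (P_group w) 1)"
    by (simp add: card_image inj_on_def)
  have "card (orb (P_group w) 1 \<union> orb (P_group w) (w ^ 2)) = q - 1"
    unfolding orb_P_Un by (simp add: card_Diff_singleton)
  then have "card (orb (P_group w) 1) + card (orb (P_group w) (w ^ 2)) = q - 1"
    using card_Un_disjoint[OF _ _ orb_P_disjoint] by simp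
  then have "card (orb (P_group w) 1) = (q - 1) div 2" using eq by linarith
  moreover assume "z \<noteq> 0"
  ultimately show "card (orb (P_group w) z) = (q - 1) div 2"
    using orb_P_cases[OF \<open>z \<noteq> 0\<close>] eq by (elim disjE) simp_all
qed

lemma iso_M_P:
  assumes r: "prime r" "r dvd q - 1"
    and iso: "scheme_iso (Inv (semidirect_translations (M_group w r))) (Inv (semidirect_translations (P_group w)))"
  shows "r = 2"
proof -
  have "(q - 1) div 2 \<le> (q - 1) div r"
    using scheme_iso_min_valency[OF additive_group_M additive_group_P iso, of 1 "(q - 1) div 2"]
    by (simp add: card_orb_M_1[OF r(2)] card_orb_P)
  show "r = 2"
  proof (rule ccontr)
    assume "r \<noteq> 2"
    then have "r \<ge> 3" using prime_ge_2_nat[OF r(1)] by simp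
    then have "(q - 1) div r \<le> (q - 1) div 3" by (intro div_le_mono2) simp_all
    moreover have "(q - 1) div 3 < (q - 1) div 2"
    proof -
      obtain c where "q - 1 = 4 * c" using four_dvd by auto
      moreover from this have "c > 0" using q_gt_1 by (cases c) auto
      ultimately show ?thesis by simp
    qed
    ultimately show False using \<open>(q - 1) div 2 \<le> (q - 1) div r\<close> by simp
  qed
qed

end

section \<open>Minimal schemes\<close>

lemma (in primitive_field) q_9:
  assumes "q = 9"
  shows "p = 3" "d = 2"
proof -
  have "p dvd p ^ d" using d_pos by simp
  then have "p dvd 3 ^ 2" using assms unfolding q_def by simp
  then have "p dvd 3" by (rule prime_dvd_power[OF prime_p])
  then show p: "p = 3" using primes_dvd_imp_eq[OF prime_p] by simp
  have "p ^ d = 9" using assms unfolding q_def .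
  then have "(3::nat) ^ d = 3 ^ 2" using p by simp
  then show "d = 2" by (subst (asm) power_inject_exp) simp_all
qed

context peisert_condition
begin

lemma q_cong: "\<exists>e. q = 4 * e + 1"
proof -
  obtain e where "q - 1 = 4 * e" using four_dvd by auto
  then have "q = 4 * e + 1" using q_gt_1 by simp
  then show ?thesis ..
qed

lemma orb_M2_1: "orb (M_group w 2) 1 = {w ^ k | k. even k}"
  by (rule orb_M_1)

lemma two_dvd_q1: "2 dvd q - 1"
  using dvd_trans[OF _ four_dvd, of 2] by simp

lemma orb_M2_w: "orb (M_group w 2) w = {w ^ k | k. odd k}"
proof (intro equalityI subsetI)
  fix x assume "x \<in> orb (M_group w 2) w"
  then obtain k j where "x = slin k j w" "even k" unfolding orb_def M_group_eq by auto
  then have "x = w ^ (k + p ^ j)" by (simp add: slin_def power_add)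
  moreover have "odd p" using p3 by presburger
  then have "odd (k + p ^ j)" using \<open>even k\<close> by simp
  ultimately show "x \<in> {w ^ k | k. odd k}" by blast
next
  fix x assume "x \<in> {w ^ k | k. odd k}"
  then obtain k where k: "x = w ^ k" "odd k" by auto
  then obtain l where "k = 2 * l + 1" by (elim oddE)
  then have "x = slin (2 * l) 0 w" using k(1) by (simp add: slin_def)
  moreover have "slin (2 * l) 0 \<in> M_group w 2"
    unfolding M_group_eq using dvd_triv_left[of 2 l] by blast
  ultimately show "x \<in> orb (M_group w 2) w" unfolding orb_def by blast
qed

lemma even_cong: "w ^ k = w ^ l \<Longrightarrow> even k \<longleftrightarrow> even l"
  unfolding power_eq_iff using mod4_cong[of k l] by presburger

lemma orb_M2_Un: "orb (M_group w 2) 1 \<union> orb (M_group w 2) w = UNIV - {0}"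
proof (intro equalityI subsetI)
  fix z :: 'a assume "z \<in> UNIV - {0}"
  then obtain k where "z = w ^ k" using ex_power by blast
  then show "z \<in> orb (M_group w 2) 1 \<union> orb (M_group w 2) w" unfolding orb_M2_1 orb_M2_w by blast
qed (auto simp: orb_M2_1 orb_M2_w)

lemma orb_M2_disjoint: "orb (M_group w 2) 1 \<inter> orb (M_group w 2) w = {}"
  unfolding orb_M2_1 orb_M2_w using even_cong by blast

text \<open>The two nondiagonal relations are complementary, so a bijection that respects one of
  them respects the whole scheme.\<close>

lemma Inv_rank_3:
  assumes H: "additive_group H" and y: "y \<noteq> 0" "orb H 1 \<union> orb H y = UNIV - {0}" "orb H 1 \<inter> orb H y = {}"
  shows "Inv (semidirect_translations H) =
    {diff_rel {0}, diff_rel (orb H 1), diff_rel (UNIV - {0} - orb H 1)}"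
proof -
  interpret additive_group H by fact
  have y': "orb H y = UNIV - {0} - orb H 1" using y(2,3) by blast
  have "orb H z \<in> {{0}, orb H 1, orb H y}" for z
  proof (cases "z = 0")
    case False
    then have "z \<in> orb H 1 \<or> z \<in> orb H y" using y(2) by blast
    then show ?thesis using orb_eq by blast
  qed (simp add: orb_0)
  then have "range (orb H) \<subseteq> {{0}, orb H 1, orb H y}" by blast
  moreover have "{{0}, orb H 1, orb H y} \<subseteq> range (orb H)"
    using orb_0 by (simp only: insert_subset empty_subsetI) (metis rangeI)
  ultimately have "range (orb H) = {{0}, orb H 1, orb H y}" by (rule equalityI)
  then have "range (\<lambda>z. diff_rel (orb H z)) = diff_rel ` {{0}, orb H 1, orb H y}"
    by (metis image_image)
  then show ?thesis unfolding Inv_semidirect y' by simp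
qed

lemma Inv_M2:
  "Inv (semidirect_translations (M_group w 2)) =
    {diff_rel {0}, diff_rel (orb (M_group w 2) 1), diff_rel (UNIV - {0} - orb (M_group w 2) 1)}"
  using additive_group_M w_nz orb_M2_Un orb_M2_disjoint by (rule Inv_rank_3)

lemma Inv_P:
  "Inv (semidirect_translations (P_group w)) =
    {diff_rel {0}, diff_rel (orb (P_group w) 1), diff_rel (UNIV - {0} - orb (P_group w) 1)}"
  by (rule Inv_rank_3[OF additive_group_P _ orb_P_Un orb_P_disjoint]) simp

lemma image_diff_rel:
  fixes f :: "'a \<Rightarrow> 'a"
  assumes "bij f" "\<And>x y. f (x + y) = f x + f y"
  shows "map_prod f f ` diff_rel S = diff_rel (f ` S)"
proof -
  have diff: "f (x - y) = f x - f y" for x y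
    using assms(2)[of "x - y" y] by simp
  show ?thesis
  proof (intro equalityI subsetI)
    fix z assume "z \<in> map_prod f f ` diff_rel S"
    then obtain x y where "z = (f x, f y)" "y - x \<in> S" by (auto simp: diff_rel_def)
    then show "z \<in> diff_rel (f ` S)" by (auto simp: diff_rel_def diff[symmetric])
  next
    fix z assume z: "z \<in> diff_rel (f ` S)"
    obtain x y where xy: "fst z = f x" "snd z = f y" using bij_is_surj[OF assms(1)] by (metis surjD)
    then have "f (y - x) \<in> f ` S" using z by (simp add: diff_rel_def diff split_beta)
    then have "y - x \<in> S" using bij_is_inj[OF assms(1)] by (simp add: inj_image_mem_iff)
    then have "(x, y) \<in> diff_rel S" by (simp add: diff_rel_def)
    moreover have "z = map_prod f f (x, y)" using xy by (simp add: prod_eq_iff)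
    ultimately show "z \<in> map_prod f f ` diff_rel S" by blast
  qed
qed

text \<open>
  In the field of order 9 the squares are the fourth roots of unity 1, -1, \<open>w\<^sup>2\<close>, \<open>-w\<^sup>2\<close>, and the
  orbit of 1 under \<open>P\<close> consists of 1, -1, \<open>w\<close>, \<open>-w\<close>. So a linear map over the prime field fixing 1 and
  sending \<open>w\<^sup>2\<close> to \<open>w\<close> is an isomorphism; it has the form \<open>x \<mapsto> ax + bx\<^sup>3\<close>.
\<close>

lemma scheme_iso_9:
  assumes "q = 9"
  shows "scheme_iso (Inv (semidirect_translations (M_group w 2))) (Inv (semidirect_translations (P_group w)))"
proof -
  note p = q_9(1)[OF assms]
  have w8: "w ^ 8 = 1" using power_q_minus_1[OF w_nz] assms by simp
  have three: "(3 :: 'a) = 0" using of_nat_CHAR[where 'a = 'a] by (simp add: CHAR_eq p)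
  have "w ^ 4 \<noteq> 1" "w ^ 2 \<noteq> 1" unfolding power_eq_1_iff using assms by (auto dest: dvd_imp_le)
  moreover have "(w ^ 4) ^ 2 = 1" using w8 by (simp add: power_mult[symmetric])
  ultimately have w4: "w ^ 4 = -1" by (metis power2_eq_1_iff)
  \<comment> \<open>The requirements f(1) = 1 and f(w^2) = w mean a + b = 1 and, as w^6 = -w^2, a -
    b = 1/w = w^7 = v. In characteristic 3 the factor 1/2 is -1, hence the signs of a and b.\<close>
  define v where "v = w ^ 7"
  define a b where "a = - (1 + v)" and "b = - (1 - v)"
  define f where "f x = a * x + b * x ^ 3" for x
  have add: "f (x + y) = f x + f y" for x y
  proof -
    have "(x + y) ^ 3 = x ^ 3 + y ^ 3"
      by (rule freshmans_dream) (simp_all add: CHAR_eq p)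
    then show ?thesis by (simp add: f_def algebra_simps)
  qed
  have f0: "f 0 = 0" by (simp add: f_def)
  have f_minus: "f (- x) = - f x" for x using add[of x "- x"] f0 by (simp add: eq_neg_iff_add_eq_0 add.commute)
  have "(2 :: 'a) + 1 = 0" using three by simp
  then have two: "(2 :: 'a) = -1" by (simp only: eq_neg_iff_add_eq_0)
  have "a + b = - 2" by (simp add: a_def b_def)
  then have f1: "f 1 = 1" by (simp add: f_def two)
  have w6: "w ^ 6 = - (w ^ 2)" using power_add[of w 4 2] w4 by simp
  have w5: "w ^ 5 = - w" using power_add[of w 4 1] w4 by simp
  have fw2: "f (w ^ 2) = w"
  proof -
    have "f (w ^ 2) = (a - b) * w ^ 2"
      using w6 by (simp add: f_def power_mult[symmetric] left_diff_distrib)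
    also have "a - b = - 2 * v" by (simp add: a_def b_def)
    also have "- 2 * v * w ^ 2 = w ^ 7 * w ^ 2" by (simp add: two v_def)
    also have "\<dots> = w ^ 8 * w ^ 1" by (simp only: power_add[symmetric]) simp
    finally show ?thesis using w8 by simp
  qed
  have "inj f"
  proof (rule injI)
    fix x y assume "f x = f y"
    then have f_diff: "f (x - y) = 0" using add[of "x - y" y] by simp
    have "z = 0" if "f z = 0" for z
    proof (rule ccontr)
      assume "z \<noteq> 0"
      have "z * (a + b * z ^ 2) = 0" using that by (simp add: f_def algebra_simps power2_eq_square power3_eq_cube)
      \<comment> \<open>A nonzero root z of f gives a^4 = b^4 because z^8 = 1. But (1 + v)^4 - (1 -
        v)^4 = 8 v (1 + v^2), and v^2 = -w^2 differs from -1.\<close>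
      then have "a = - (b * z ^ 2)" using \<open>z \<noteq> 0\<close> by (simp add: eq_neg_iff_add_eq_0)
      then have "a ^ 4 = b ^ 4 * z ^ 8" by (simp add: power_mult_distrib power_mult[symmetric])
      also have "z ^ 8 = 1" using power_q_minus_1[OF \<open>z \<noteq> 0\<close>] assms by simp
      finally have "a ^ 4 = b ^ 4" by simp
      moreover have "(- x) ^ 4 = x ^ 4" for x :: 'a by simp
      ultimately have "(1 + v) ^ 4 = (1 - v) ^ 4" unfolding a_def b_def by metis
      then have "(1 + v) ^ 4 - (1 - v) ^ 4 = 0" by simp
      moreover have "(1 + v) ^ 4 - (1 - v) ^ 4 = 2 * 2 * 2 * (v * (1 + v ^ 2))"
        by (simp add: power4_eq_xxxx power2_eq_square algebra_simps)
      ultimately have "v * (1 + v ^ 2) = 0" unfolding two by simp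
      then have "1 + v ^ 2 = 0" by (simp add: v_def)
      moreover have "v ^ 2 = w ^ 8 * w ^ 6" unfolding v_def power_mult[symmetric] power_add[symmetric] by simp
      ultimately have "w ^ 2 = 1" using w8 w6 by simp
      with \<open>w ^ 2 \<noteq> 1\<close> show False ..
    qed
    from this[OF f_diff] show "x = y" by simp
  qed
  then have bij: "bij f" by (simp add: bij_def finite_UNIV_inj_surj)
  let ?S = "orb (M_group w 2) 1" and ?T = "orb (P_group w) 1"
  have "f ` ?S \<subseteq> ?T"
  proof
    fix y assume "y \<in> f ` ?S"
    then obtain k where k: "y = f (w ^ k)" "even k" unfolding orb_M2_1 by auto
    define l where "l = k mod 8"
    have "w ^ k = w ^ l" using power_mod_q[OF w_nz, of k] assms by (simp add: l_def)
    have "l = 0 \<or> l = 2 \<or> l = 4 \<or> l = 6" using k(2) unfolding l_def by presburger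
    then have "y = w ^ 0 \<or> y = w ^ 1 \<or> y = w ^ 4 \<or> y = w ^ 5"
      unfolding k(1) \<open>w ^ k = w ^ l\<close>
      by (elim disjE) (simp_all add: f1 fw2 w4 w5 w6 f_minus)
    moreover have "0 mod 4 < (2::nat)" "1 mod 4 < (2::nat)" "4 mod 4 < (2::nat)" "5 mod 4 < (2::nat)"
      by simp_all
    ultimately show "y \<in> ?T" unfolding orb_P_1 by blast
  qed
  moreover have "card (f ` ?S) = card ?T"
    using card_orb_M_1[OF two_dvd_q1] card_orb_P[of 1] \<open>inj f\<close> by (simp add: card_image inj_on_subset)
  ultimately have S: "f ` ?S = ?T" by (intro card_subset_eq) simp_all
  have "f ` (UNIV - {0} - ?S) = UNIV - {0} - ?T"
    using bij_is_surj[OF bij] by (simp add: image_set_diff[OF \<open>inj f\<close>] S f0)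
  with S have "(\<lambda>R. map_prod f f ` R) ` Inv (semidirect_translations (M_group w 2))
      = Inv (semidirect_translations (P_group w))"
    unfolding Inv_M2 Inv_P by (simp add: image_diff_rel[OF bij add] f0)
  with bij show ?thesis unfolding scheme_iso_def by blast
qed

lemma scheme_iso_imp_9:
  assumes "scheme_iso (Inv (semidirect_translations (M_group w 2))) (Inv (semidirect_translations (P_group w)))"
  shows "q = 9"
proof -
  obtain e where e: "q = 4 * e + 1" using q_cong by blast
  have "p = 4 * (p div 4) + 3" using p3 by presburger
  moreover have "d = 2 * (d div 2)" using d_even by simp
  ultimately interpret K: peisert_field w p d "p div 4" "d div 2" e
    using e by unfold_locales
  define i where "i = w ^ e"
  have ii: "i * i = - 1" using K.minus_one_power by (simp add: i_def power_add[symmetric] mult_2[symmetric])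
  have two: "(2 :: 'a) \<noteq> 0" using K.one_neq_minus_one[of 1] by (metis one_add_one one_neq_zero add.inverse_unique)
  \<comment> \<open>The solution of \<alpha> + \<beta> = 1 and i (\<alpha> - \<beta>) = 1: then
    \<alpha> X + \<beta> X^3 takes the values 1, 1, -1, -1 at 1, i, -1, -i.\<close>
  define \<alpha> \<beta> where "\<alpha> = (1 - i) / 2" and "\<beta> = (1 + i) / 2"
  define \<psi> where "\<psi> x = \<alpha> * x ^ e + \<beta> * x ^ (3 * e)" for x
  have "i \<noteq> 1" "i \<noteq> - 1" using ii K.one_neq_minus_one[of 1] by auto
  then have nz: "\<alpha> \<noteq> 0" "\<beta> \<noteq> 0"
    using two by (simp_all add: \<alpha>_def \<beta>_def add_eq_0_iff)
  have sum: "\<alpha> + \<beta> = 1" and diff: "\<alpha> - \<beta> = - i"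
    using two by (simp_all add: \<alpha>_def \<beta>_def add_divide_distrib[symmetric] diff_divide_distrib[symmetric])
  have \<psi>: "\<psi> (w ^ k) = (if k mod 4 < 2 then 1 else -1)" for k
  proof -
    define I where "I = i ^ k"
    have "i ^ 4 = 1" using ii by (simp add: power4_eq_xxxx)
    have "i ^ k = i ^ (4 * (k div 4) + k mod 4)" by simp
    also have "\<dots> = i ^ (k mod 4)" by (simp only: power_add power_mult \<open>i ^ 4 = 1\<close>) simp
    finally have I: "I = i ^ (k mod 4)" by (simp add: I_def)
    have "(w ^ k) ^ e = I" by (simp add: I_def i_def power_mult[symmetric] mult.commute)
    moreover have "(w ^ k) ^ (3 * e) = ((w ^ k) ^ e) ^ 3" by (simp only: power_mult[symmetric] mult_ac)
    ultimately have "(w ^ k) ^ e = I" "(w ^ k) ^ (3 * e) = I * I * I" by (simp_all only: power3_eq_cube)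
    moreover define F where "F x = x * (\<alpha> + \<beta> * (x * x))" for x
    ultimately have "\<psi> (w ^ k) = F I" by (simp add: \<psi>_def algebra_simps)
    moreover have "F 1 = 1" "F i = 1" "F (- 1) = - 1" "F (- i) = - 1"
      using sum diff ii by (simp_all add: F_def)
    moreover have "k mod 4 = 0 \<or> k mod 4 = 1 \<or> k mod 4 = 2 \<or> k mod 4 = 3" by presburger
    then have "(k mod 4 < 2 \<longrightarrow> I = 1 \<or> I = i) \<and> (\<not> k mod 4 < 2 \<longrightarrow> I = - 1 \<or> I = - i)"
      using ii unfolding I by (elim disjE) (simp_all add: power2_eq_square power3_eq_cube)
    ultimately show ?thesis by metis
  qed
  let ?S = "orb (M_group w 2) 1" and ?T = "orb (P_group w) 1"
  obtain f where f: "bij f"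
    "(\<lambda>R. map_prod f f ` R) ` Inv (semidirect_translations (M_group w 2)) = Inv (semidirect_translations (P_group w))"
    using assms unfolding scheme_iso_def by blast
  have "map_prod f f ` diff_rel ?S \<in> Inv (semidirect_translations (P_group w))"
    unfolding f(2)[symmetric] Inv_M2 by blast
  moreover have "map_prod f f ` diff_rel ?S \<noteq> diff_rel {0}"
  proof -
    have "1 \<in> ?S" unfolding orb_M2_1 by (metis (mono_tags) even_zero mem_Collect_eq power_0)
    then have "diff_rel ?S \<noteq> Id" unfolding Id_eq_diff_rel diff_rel_eq_iff by auto
    then show ?thesis using bij_map_prod_Id[OF f(1)] unfolding Id_eq_diff_rel[symmetric] by blast
  qed
  ultimately obtain T where T: "map_prod f f ` diff_rel ?S = diff_rel T" "T = ?T \<or> T = UNIV - {0} - ?T"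
    unfolding Inv_P by blast
  have f_iff: "x - y \<in> ?S \<longleftrightarrow> f x - f y \<in> T" for x y
  proof -
    have "inj (map_prod f f)" using bij_is_inj[OF f(1)] by (intro prod.inj_map)
    then have "(y, x) \<in> diff_rel ?S \<longleftrightarrow> map_prod f f (y, x) \<in> diff_rel T"
      unfolding T(1)[symmetric] by (simp only: inj_image_mem_iff)
    then show ?thesis by (simp add: diff_rel_def)
  qed
  \<comment> \<open>The isomorphism may carry the Paley relation of the squares to either
    nondiagonal Peisert relation; the sign records which.\<close>
  define \<epsilon> :: 'a where "\<epsilon> = (if T = ?T then 1 else -1)"
  have \<psi>T: "\<psi> z = (if z \<in> T then \<epsilon> else - \<epsilon>)" if z: "z \<noteq> 0" for z
  proof -
    obtain k where k: "z = w ^ k" using ex_power[OF z] by blast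
    have "z \<in> ?T \<longleftrightarrow> k mod 4 < 2"
    proof
      assume "z \<in> ?T"
      then obtain l where "w ^ k = w ^ l" "l mod 4 < 2" unfolding k orb_P_1 by blast
      then show "k mod 4 < 2" using mod4_cong[of k l] by (simp add: power_eq_iff)
    qed (auto simp: k orb_P_1)
    then have "\<psi> z = (if z \<in> ?T then 1 else -1)" using \<psi>[of k] k by simp
    then show ?thesis using T(2) z by (auto simp: \<epsilon>_def)
  qed
  have "K.kernel \<alpha> \<beta> \<epsilon> f"
    unfolding K.kernel_def
  proof (intro conjI allI f(1) nz)
    show "\<epsilon> \<noteq> 0" by (simp add: \<epsilon>_def)
    fix x y
    show "\<alpha> * (f x - f y) ^ e + \<beta> * (f x - f y) ^ (3 * e) = \<epsilon> * (x - y) ^ (2 * e)"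
    proof (cases "x = y")
      case True
      then show ?thesis using K.e_pos by (simp add: zero_power)
    next
      case False
      then have "f x - f y \<noteq> 0" using bij_is_inj[OF f(1)] by (simp add: inj_eq)
      then have "\<psi> (f x - f y) = (if x - y \<in> ?S then \<epsilon> else - \<epsilon>)" using \<psi>T f_iff by simp
      moreover have "x - y \<noteq> 0" using False by simp
      then obtain k where k: "x - y = w ^ k" using ex_power by blast
      have "x - y \<in> ?S \<longleftrightarrow> even k"
      proof
        assume "x - y \<in> ?S"
        then obtain l where "w ^ k = w ^ l" "even l" unfolding k orb_M2_1 by blast
        then show "even k" using even_cong[of k l] by simp
      qed (auto simp: k orb_M2_1)
      moreover have "(x - y) ^ (2 * e) = (w ^ (2 * e)) ^ k"
        unfolding k by (simp only: power_mult[symmetric] mult_ac)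
      then have "(x - y) ^ (2 * e) = (if even k then 1 else - 1)" by (simp add: K.minus_one_power)
      ultimately show ?thesis by (simp add: \<psi>_def)
    qed
  qed
  then show "q = 9" using K.no_kernel by blast
qed

end

context primitive_field
begin

lemma candidate_facts:
  assumes "H \<in> candidate_stabilizers w p d"
  shows "subgroup H Sym" "H \<subseteq> SL" "\<not> trivial_scheme (Inv (semidirect_translations H))"
proof -
  have "subgroup H Sym \<and> H \<subseteq> SL \<and> \<not> trivial_scheme (Inv (semidirect_translations H))"
    using assms
  proof (cases rule: candidate_cases)
    case (M r)
    interpret additive_group "M_group w r" by (rule additive_group_M)
    show ?thesis
      using subgroup_M M_subset_SL nontrivial_Inv[OF _ _ M_nontrivial[OF M(1,2)]] by (simp add: M(3))
  next
    case P
    interpret peisert_condition w p d using P(1,2) by (rule peisert_conditionI)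
    interpret additive_group "P_group w" by (rule additive_group_P)
    have "w ^ 2 \<notin> orb (P_group w) 1" using orb_P_disjoint orb_self by blast
    then show ?thesis
      using subgroup_P P_subset_SL nontrivial_Inv[of 1 "w ^ 2"] by (simp add: P(3))
  qed
  then show "subgroup H Sym" "H \<subseteq> SL" "\<not> trivial_scheme (Inv (semidirect_translations H))" by auto
qed

text \<open>The group compared with G is K, the candidate group conjugated back by the inverse
  multiplication. It contains G and stays inside \<open>AGammaL1\<close>, so X is the scheme of K,
  which is isomorphic to that of the candidate.\<close>

lemma minimal_scheme_iso:
  assumes "minimal_nontrivial_scheme X"
  shows "\<exists>H\<in>candidate_stabilizers w p d. scheme_iso X (Inv (semidirect_translations H))"
proof -
  obtain G where G: "one_dim_affine_group G" "X = Inv G" and nontriv: "\<not> trivial_scheme X"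
    using assms unfolding minimal_nontrivial_scheme_def one_dim_affine_scheme_def by blast
  have sub: "subgroup G Sym" and trans: "translation_group \<subseteq> G" and AG: "G \<subseteq> AGammaL1"
    using G(1) by (auto simp: one_dim_affine_group_def)
  \<comment> \<open>The stabilizer of 0 in G, as \<open>SL\<close> consists of the elements of
    \<open>AGammaL1\<close> that fix 0.\<close>
  define G0 where "G0 = {h \<in> SL. h \<in> G}"
  have split: "\<exists>h b. h \<in> G0 \<and> g = (\<lambda>x. h x + b)" if "g \<in> G" for g
  proof -
    have "g \<in> {\<lambda>x. h x + b | h b. h \<in> SL}"
      using AG that unfolding AGammaL1_eq by (rule subsetD)
    then obtain h b where h: "h \<in> SL" "g = (\<lambda>x. h x + b)" by auto
    have "(\<lambda>x. x + - b) \<in> G" using trans unfolding translation_group_def by blast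
    then have "(\<lambda>x. x + - b) \<circ> g \<in> G" using that by (rule subgroup_SymD(3)[OF sub])
    moreover have "(\<lambda>x. x + - b) \<circ> g = h" by (simp add: h(2) comp_def)
    ultimately show ?thesis using h unfolding G0_def by blast
  qed
  interpret semilinear_group w p d G0
  proof
    show "G0 \<subseteq> SL" by (auto simp: G0_def)
    have "slin 0 0 \<in> SL" unfolding SL_def by blast
    then show "id \<in> G0" using subgroup_SymD(1)[OF sub] by (simp only: G0_def slin_0_0 mem_Collect_eq)
    show comp: "f \<circ> g \<in> G0" if fg: "f \<in> G0" "g \<in> G0" for f g
    proof -
      obtain k j l i where "f = slin k j" "g = slin l i" using fg unfolding G0_def SL_def by auto
      then have "f \<circ> g = slin (k + l * p ^ j) (i + j)" by (simp only: slin_comp)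
      then have "f \<circ> g \<in> SL" unfolding SL_def by blast
      moreover have "f \<circ> g \<in> G" using fg subgroup_SymD(3)[OF sub] unfolding G0_def by blast
      ultimately show ?thesis unfolding G0_def by blast
    qed
    show "\<exists>g\<in>G0. g \<circ> f = id \<and> f \<circ> g = id" if "f \<in> G0" for f
    proof -
      have "subgroup G0 Sym"
        using comp \<open>G0 \<subseteq> SL\<close> \<open>id \<in> G0\<close> by (intro subgroup_SL)
      from subgroup_SymD(4)[OF this that] show ?thesis .
    qed
  qed
  \<comment> \<open>A stabilizer transitive on the nonzero elements would leave only one nondiagonal
    relation.\<close>
  have "\<exists>x y. x \<noteq> 0 \<and> y \<noteq> 0 \<and> (\<forall>g\<in>G0. g x \<noteq> y)"
  proof (rule ccontr)
    assume "\<not> ?thesis"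
    then have tr: "\<exists>g\<in>G0. g x = y" if "x \<noteq> 0" "y \<noteq> 0" for x y using that by blast
    have G0_sub: "subgroup G0 Sym" by (rule subgroup_SL[OF G0_SL G0_id G0_comp])
    interpret A: additive_group G0 by (rule additive_group_SL[OF G0_sub G0_SL])
    have "G = semidirect_translations G0"
    proof (intro equalityI subsetI)
      fix g assume "g \<in> G"
      then show "g \<in> semidirect_translations G0" using split unfolding A.semidirect_eq by blast
    next
      fix g assume "g \<in> semidirect_translations G0"
      then obtain h b where h: "h \<in> G0" "g = (\<lambda>x. x + b) \<circ> h" unfolding A.semidirect_eq by (auto simp: comp_def)
      have "(\<lambda>x. x + b) \<in> G" using trans unfolding translation_group_def by blast
      then show "g \<in> G" unfolding h(2) using h(1) by (intro subgroup_SymD(3)[OF sub]) (auto simp: G0_def)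
    qed
    then have X: "X - {Id} = (\<lambda>z. diff_rel (orb G0 z)) ` (UNIV - {0})"
      using A.Inv_minus_Id G(2) by simp
    have "orb G0 z = UNIV - {0}" if "z \<noteq> 0" for z
    proof (intro equalityI subsetI)
      fix y assume "y \<in> orb G0 z"
      then obtain g where "g \<in> G0" "y = g z" unfolding orb_def by auto
      then obtain k j where "y = slin k j z" using G0_SL unfolding SL_def by auto
      then show "y \<in> UNIV - {0}" using that by (simp add: slin_eq_0_iff)
    next
      fix y :: 'a assume "y \<in> UNIV - {0}"
      then show "y \<in> orb G0 z" using tr[OF that] unfolding orb_def by blast
    qed
    then have "X - {Id} = (\<lambda>z. diff_rel (UNIV - {0})) ` (UNIV - {0 :: 'a})" unfolding X by (intro image_cong) simp_all
    also have "\<dots> = {diff_rel (UNIV - {0})}" using w_nz by blast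
    finally have "X - {Id} = {diff_rel (UNIV - {0})}" .
    moreover have "Id \<in> X"
      using assms unfolding minimal_nontrivial_scheme_def one_dim_affine_scheme_def association_scheme_def by blast
    ultimately have "X = {Id, diff_rel (UNIV - {0})}" by blast
    moreover have "Id \<noteq> diff_rel (UNIV - {0 :: 'a})" unfolding Id_eq_diff_rel diff_rel_eq_iff by blast
    ultimately have "card X = 2" by simp
    then show False using nontriv by (simp add: trivial_scheme_def)
  qed
  then obtain x y where xy: "x \<noteq> 0" "y \<noteq> 0" "\<And>g. g \<in> G0 \<Longrightarrow> g x \<noteq> y" by blast
  obtain c H where H: "H \<in> candidate_stabilizers w p d"
    and cH: "\<And>k j. slin k j \<in> G0 \<Longrightarrow> slin (k + c + c * p ^ j * (q - 2)) j \<in> H"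
  proof (rule intransitive[OF xy(1,2)])
    show "g x \<noteq> y" if "g \<in> G0" for g using that by (rule xy(3))
  qed blast
  note HF = candidate_facts[OF H]
  interpret H: additive_group H by (rule additive_group_SL[OF HF(1,2)])
  define t where "t = slin c 0"
  \<comment> \<open>The inverse of \<open>t\<close>, with -c written as c (q - 2).\<close>
  define t' where "t' = slin (c * (q - 2)) 0"
  have tt: "t \<circ> t' = id" "t' \<circ> t = id"
  proof -
    have "q - 1 = Suc (q - 2)" using q_gt_1 by simp
    then have "c * (q - 2) + c = c * (q - 1)" by simp
    then have "slin (c * (q - 2) + c) 0 = slin 0 0" by (intro slin_cong) (simp add: cong_def)
    then show "t \<circ> t' = id" "t' \<circ> t = id" by (simp_all add: t_def t'_def slin_comp slin_0_0 add.commute)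
  qed
  have t: "bij t" unfolding t_def by (rule bij_slin)
  have t': "bij t'" unfolding t'_def by (rule bij_slin)
  have t_inv: "inv_into UNIV t = t'" and t'_inv: "inv_into UNIV t' = t"
    using tt by (simp_all only: inv_unique_comp)
  define K where "K = conj_set t' (semidirect_translations H)"
  have K: "K = (\<lambda>g. t' \<circ> g \<circ> t) ` semidirect_translations H"
    unfolding K_def conj_set_def t'_inv ..
  have conj_subset: "conj_set t G \<subseteq> semidirect_translations H"
  proof
    fix g assume "g \<in> conj_set t G"
    then obtain g' where g': "g' \<in> G" "g = t \<circ> g' \<circ> t'" unfolding conj_set_def t_inv by blast
    obtain h b where h: "h \<in> G0" "g' = (\<lambda>x. h x + b)" using split[OF g'(1)] by blast
    obtain k j where kj: "h = slin k j" using h(1) G0_SL unfolding SL_def by auto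
    have "t \<circ> h \<circ> t' = slin (c + k + c * (q - 2) * p ^ j) j"
      unfolding kj t_def t'_def by (simp add: slin_comp)
    also have "c + k + c * (q - 2) * p ^ j = k + c + c * p ^ j * (q - 2)" by (simp add: mult_ac)
    finally have "t \<circ> h \<circ> t' = slin (k + c + c * p ^ j * (q - 2)) j" .
    moreover have "slin (k + c + c * p ^ j * (q - 2)) j \<in> H" using h(1) unfolding kj by (rule cH)
    ultimately have "t \<circ> h \<circ> t' \<in> H" by (simp only:)
    moreover have "g = (\<lambda>x. (t \<circ> h \<circ> t') x + t b)"
      unfolding g'(2) h(2) t_def by (simp add: fun_eq_iff slin_add)
    ultimately show "g \<in> semidirect_translations H" unfolding H.semidirect_eq by blast
  qed
  have "conj_set t' (conj_set t G) = G" using conj_set_inv[OF t, of G] unfolding t_inv .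
  then have "G \<subseteq> K" using conj_subset unfolding K_def conj_set_def by blast
  have K_sub: "subgroup K Sym"
  proof (rule subgroup_SymI)
    show "id \<in> K" using subgroup_SymD(1)[OF sub] \<open>G \<subseteq> K\<close> by blast
    fix f assume "f \<in> K"
    then obtain f' where f: "f' \<in> semidirect_translations H" "f = t' \<circ> f' \<circ> t" unfolding K by blast
    show "bij f" unfolding f(2) using t t' subgroup_SymD(2)[OF H.subgroup_semidirect f(1)]
      by (intro bij_comp)
    fix g assume "g \<in> K"
    then obtain g' where g: "g' \<in> semidirect_translations H" "g = t' \<circ> g' \<circ> t" unfolding K by blast
    have "f \<circ> g = t' \<circ> (f' \<circ> (t \<circ> t') \<circ> g') \<circ> t" unfolding f(2) g(2) by (simp add: comp_assoc)
    also have "f' \<circ> (t \<circ> t') \<circ> g' = f' \<circ> g'" unfolding tt by simp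
    finally show "f \<circ> g \<in> K"
      using subgroup_SymD(3)[OF H.subgroup_semidirect f(1) g(1)] unfolding K by blast
  qed
  moreover have "K \<subseteq> AGammaL1"
  proof
    fix f assume "f \<in> K"
    then obtain h b where h: "h \<in> H" "f = t' \<circ> (\<lambda>x. h x + b) \<circ> t"
      unfolding K H.semidirect_eq by blast
    obtain k j where "h = slin k j" using h(1) HF(2) unfolding SL_def by auto
    then have "t' \<circ> h \<circ> t \<in> SL" unfolding t_def t'_def SL_def by (auto simp: slin_comp)
    moreover have "f = (\<lambda>x. (t' \<circ> h \<circ> t) x + t' b)"
      unfolding h(2) t'_def by (simp add: fun_eq_iff slin_add)
    ultimately show "f \<in> AGammaL1" unfolding AGammaL1_eq by blast
  qed
  ultimately have "one_dim_affine_group K"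
    using trans \<open>G \<subseteq> K\<close> unfolding one_dim_affine_group_def by blast
  then have "one_dim_affine_scheme (Inv K)"
    using association_scheme_Inv_affine unfolding one_dim_affine_scheme_def by blast
  moreover have iso: "scheme_iso (Inv (semidirect_translations H)) (Inv K)"
    unfolding K_def using t' by (rule scheme_iso_conj_set)
  then have "\<not> trivial_scheme (Inv K)"
    using scheme_iso_card[OF iso] HF(3) by (simp add: trivial_scheme_def)
  moreover have "scheme_le (Inv K) X"
    unfolding G(2) using sub K_sub \<open>G \<subseteq> K\<close> by (rule scheme_le_Inv)
  ultimately have "Inv K = X" using assms unfolding minimal_nontrivial_scheme_def by blast
  then show ?thesis using scheme_iso_sym[OF iso] H by blast
qed

text \<open>The statement compares groups, whereas valencies compare the parameters r. Reflexivity
  of isomorphism links the two: equal groups have isomorphic schemes, so distinct r give distinct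
  M(r), and M(r) = P would force r = 2.\<close>

lemma candidates_iso_iff:
  assumes G: "G0 \<in> candidate_stabilizers w p d" and H: "H0 \<in> candidate_stabilizers w p d" and "G0 \<noteq> H0"
  shows "scheme_iso (Inv (semidirect_translations G0)) (Inv (semidirect_translations H0)) \<longleftrightarrow>
    q = 9 \<and> {G0, H0} = {M_group w 2, P_group w}"
proof -
  have MP: "scheme_iso (Inv (semidirect_translations (M_group w r))) (Inv (semidirect_translations (P_group w))) \<longleftrightarrow>
      q = 9 \<and> r = 2" if r: "prime r" "r dvd q - 1" and P: "p mod 4 = 3" "even d" for r
  proof -
    interpret peisert_condition w p d using P by (rule peisert_conditionI)
    show ?thesis using iso_M_P[OF r] scheme_iso_imp_9 scheme_iso_9 by blast
  qed
  have M_inj: "r = r'" if "prime r" "r dvd q - 1" "prime r'" "r' dvd q - 1" "M_group w r = M_group w r'" for r r'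
    using iso_M_M[OF that(1-4)] scheme_iso_refl unfolding that(5) by blast
  have two: "2 dvd q - 1" if "p mod 4 = 3" "even d"
  proof -
    interpret peisert_condition w p d using that by (rule peisert_conditionI)
    show ?thesis by (rule two_dvd_q1)
  qed
  have MP': "scheme_iso (Inv (semidirect_translations (M_group w r))) (Inv (semidirect_translations (P_group w))) \<longleftrightarrow>
      q = 9 \<and> {M_group w r, P_group w} = {M_group w 2, P_group w}"
    if r: "prime r" "r dvd q - 1" and P: "p mod 4 = 3" "even d" for r
  proof -
    have "M_group w r = M_group w 2 \<longleftrightarrow> r = 2"
      using M_inj[OF r two_is_prime_nat two[OF P]] by blast
    then show ?thesis unfolding MP[OF r P] doubleton_eq_iff by blast
  qed
  show ?thesis
    using G
  proof (cases rule: candidate_cases)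
    case (M r)
    note r = M
    show ?thesis
      using H
    proof (cases rule: candidate_cases)
      case (M r')
      have "r \<noteq> r'" using assms(3) r(3) M(3) by blast
      then have "\<not> scheme_iso (Inv (semidirect_translations G0)) (Inv (semidirect_translations H0))"
        using iso_M_M[OF r(1,2) M(1,2)] unfolding r(3) M(3) by blast
      \<comment> \<open>P might a priori coincide with M(r) or M(r'); in every case the equality of
        the pairs would force r = r' = 2.\<close>
      moreover have False if q: "q = 9" and eq: "{G0, H0} = {M_group w 2, P_group w}"
      proof -
        have P: "p mod 4 = 3" "even d" using q_9[OF q] by simp_all
        have "s = 2" if "prime s" "s dvd q - 1" "M_group w s = P_group w" for s
          using MP[OF that(1,2) P] scheme_iso_refl unfolding that(3) by blast
        moreover have "s = 2" if "prime s" "s dvd q - 1" "M_group w s = M_group w 2" for s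
          using M_inj[OF that(1,2) two_is_prime_nat two[OF P] that(3)] .
        ultimately have "r = 2" "r' = 2"
          using eq r M unfolding doubleton_eq_iff by blast+
        with \<open>r \<noteq> r'\<close> show False by simp
      qed
      ultimately show ?thesis by blast
    next
      case P
      show ?thesis unfolding r(3) P(3) by (rule MP'[OF r(1,2) P(1,2)])
    qed
  next
    case P
    note P' = P
    show ?thesis
      using H
    proof (cases rule: candidate_cases)
      case (M r)
      have "scheme_iso (Inv (semidirect_translations G0)) (Inv (semidirect_translations H0)) \<longleftrightarrow>
          scheme_iso (Inv (semidirect_translations H0)) (Inv (semidirect_translations G0))"
        using scheme_iso_sym by blast
      then show ?thesis
        using MP'[OF M(1,2) P'(1,2)] unfolding M(3) P'(3) by (simp only: insert_commute)
    next
      case P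
      then show ?thesis using P'(3) assms(3) by simp
    qed
  qed
qed

end

theorem corollary9p2:
  fixes w :: "'a::finite_field" and p d :: nat
  assumes "prime p" and "CARD('a) = p ^ d" and "primitive_element w"
  shows "(\<forall>X. minimal_nontrivial_scheme X \<longrightarrow>
            (\<exists>G0\<in>candidate_stabilizers w p d.
               scheme_iso X (Inv (semidirect_translations G0)))) \<and>
         (\<forall>G0\<in>candidate_stabilizers w p d. \<forall>H0\<in>candidate_stabilizers w p d. G0 \<noteq> H0 \<longrightarrow>
            (scheme_iso (Inv (semidirect_translations G0)) (Inv (semidirect_translations H0)) \<longleftrightarrow>
             CARD('a) = 9 \<and> {G0, H0} = {M_group w 2, P_group w}))"
proof -
  interpret primitive_field w p d using assms by unfold_locales
  show ?thesis using minimal_scheme_iso candidates_iso_iff by simp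
qed

end
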